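(* Let $p,\mu,\kappa:(0,\infty)\to\mathbb{R}$ be smooth with $\mu,\kappa>0$, $p'<0$, $p''>0$. Assume that $V^->0$ is such that $$-\kappa'(V^-)p'(V^-)+\kappa(V^-)p''(V^-)=:M>0.$$ For a compressive $1$-shock $(V^\pm,U^\pm,s)$ of the $p$-system, let $(V,U)$ be the corresponding viscous-dispersive shock profile and let $\mathcal L$ be the integrated linearized operator around it. If the shock amplitude $\varepsilon=V^--V^+>0$ is sufficiently small, then $\mathcal L$ is point spectrally stable, that is, $$\sigma_{\mathrm{pt}}(\mathcal L)\subset\{\lambda\in\mathbb{C}:\ \mathrm{Re}\,\lambda<0\}.$$
   Context: $L^2,H^m$ denote the Lebesgue and Sobolev spaces of complex-valued functions on $\mathbb{R}$. Shock. $(V^\pm,U^\pm,s)$ with $V^\pm>0$ is a compressive $1$-shock (backward shock) of $v_t-u_x=0$, $u_t+p(v)_x=0$ if $s(V^+-V^-)=U^--U^+$, $s(U^+-U^-)=p(V^+)-p(V^-)$ and $-\sqrt{-p'(V^+)}<s<-\sqrt{-p'(V^-)}$ (the further Lax condition $s<\sqrt{-p'(V^+)}$ is then automatic); thus $s<0$ and $V^->V^+$. Profile. $(V,U)$ is the unique (up to translations) smooth solution, with $V>0$, of $-sV'-U'=0$, $-sU'+p(V)'=\big(\frac{\mu(V)}{V}U'\big)'-\big(\kappa(V)V''+\frac12\kappa'(V)(V')^2\big)'$ on $\mathbb{R}$ with $(V,U)(y)\to(V^\pm,U^\pm)$ as $y\to\pm\infty$. Integrated operator. $\mathcal L$ is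 the operator on $L^2\times L^2$ with domain $H^3\times H^2$ given by $$\mathcal L\begin{pmatrix} v \\ u \end{pmatrix}=\begin{pmatrix} sv'+u' \\ su'+\Big[-p'(V)+\frac{\mu'(V)V-\mu(V)}{V^2}U'\Big]v'+\frac{\mu(V)}{V}u''+\mathcal L_c v \end{pmatrix},$$ $$\mathcal L_cv=-\kappa(V)v'''-\kappa'(V)V''v'-\kappa'(V)V'v''-\tfrac12\kappa''(V)(V')^2v'.$$ Point spectrum. $\sigma_{\mathrm{pt}}(\mathcal L)$ is the set of $\lambda\in\mathbb{C}$ for which $\mathcal L-\lambda$ is Fredholm with index zero and has a non-trivial kernel. "Sufficiently small" means: for fixed $V^-$ (and $p,\mu,\kappa$) there is $\varepsilon_0>0$ such that the conclusion holds whenever $0<V^--V^+<\varepsilon_0$. *)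

theory Defs
  imports "HOL-Analysis.Analysis"
begin

class complex_vector = real_vector +
  fixes scaleC :: "complex \<Rightarrow> 'a \<Rightarrow> 'a"  (infixr \<open>*\<^sub>C\<close> 75)
  assumes scaleC_add_right: "c *\<^sub>C (x + y) = c *\<^sub>C x + c *\<^sub>C y"
    and scaleC_add_left: "(c + d) *\<^sub>C x = c *\<^sub>C x + d *\<^sub>C x"
    and scaleC_scaleC: "c *\<^sub>C (d *\<^sub>C x) = (c * d) *\<^sub>C x"
    and scaleC_one: "1 *\<^sub>C x = x"
    and scaleR_scaleC: "r *\<^sub>R x = complex_of_real r *\<^sub>C x"

class complex_normed_vector = complex_vector + real_normed_vector +
  assumes norm_scaleC: "norm (c *\<^sub>C x) = norm c * norm x"

global_interpretation complex_vector: vector_space "scaleC :: complex \<Rightarrow> 'a \<Rightarrow> 'a::complex_vector"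
  defines cspan = complex_vector.span
    and cdim = complex_vector.dim
  by unfold_locales (rule scaleC_add_right scaleC_add_left scaleC_scaleC scaleC_one)+

instantiation prod :: (complex_vector, complex_vector) complex_vector
begin

definition "scaleC c w = (c *\<^sub>C fst w, c *\<^sub>C snd w)"

instance
  by standard
    (auto simp: scaleC_prod_def scaleC_add_right scaleC_add_left scaleC_scaleC scaleC_one
      scaleR_scaleC scaleR_prod_def)

end

instance prod :: (complex_normed_vector, complex_normed_vector) complex_normed_vector
proof
  fix c :: complex and w :: "'a \<times> 'b"
  have "norm (c *\<^sub>C w) = sqrt ((norm c)\<^sup>2 * ((norm (fst w))\<^sup>2 + (norm (snd w))\<^sup>2))"
    by (simp add: scaleC_prod_def norm_prod_def norm_scaleC power_mult_distrib distrib_left)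
  then show "norm (c *\<^sub>C w) = norm c * norm w"
    by (simp add: norm_prod_def real_sqrt_mult)
qed

text \<open>An operator in a space \<open>X\<close> is given by its graph, a subset of \<open>X \<times> X\<close>; its domain is the
  \<^const>\<open>Domain\<close> and its image the \<^const>\<open>Range\<close> of the graph.\<close>

definition ker :: "('a::complex_normed_vector \<times> 'a) set \<Rightarrow> 'a set" where
  "ker T = {x. (x, 0) \<in> T}"

definition minus_scalar :: "('a::complex_normed_vector \<times> 'a) set \<Rightarrow> complex \<Rightarrow> ('a \<times> 'a) set" where
  "minus_scalar T z = {(x, y - z *\<^sub>C x) | x y. (x, y) \<in> T}"

definition finite_cdim :: "'a::complex_normed_vector set \<Rightarrow> bool" where
  "finite_cdim S \<longleftrightarrow> (\<exists>B. finite B \<and> S \<subseteq> cspan B)"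

definition finite_ccodim :: "'a::complex_normed_vector set \<Rightarrow> bool" where
  "finite_ccodim S \<longleftrightarrow> (\<exists>B. finite B \<and> cspan (S \<union> B) = UNIV)"

text \<open>The dimension of \<open>X / S\<close> is the least number of vectors that span \<open>X\<close> together
  with \<open>S\<close>.\<close>

definition ccodim :: "'a::complex_normed_vector set \<Rightarrow> nat" where
  "ccodim S = (LEAST n. \<exists>B. finite B \<and> card B = n \<and> cspan (S \<union> B) = UNIV)"

definition fredholm :: "('a::complex_normed_vector \<times> 'a) set \<Rightarrow> bool" where
  "fredholm T \<longleftrightarrow> finite_cdim (ker T) \<and> closed (Range T) \<and> finite_ccodim (Range T)"

definition fredholm_index :: "('a::complex_normed_vector \<times> 'a) set \<Rightarrow> int" where
  "fredholm_index T = int (cdim (ker T)) - int (ccodim (Range T))"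

text \<open>The Fredholm property is a notion for closed operators, so for a closable operator it refers
  to the closure; for a closed operator \<^const>\<open>closure\<close> has no effect below. The distinction matters
  for the operator \<open>integrated_operator\<close> defined at the end, which is not closed: on the domain
  \<open>H\<^sup>3 \<times> H\<^sup>2\<close> the first component of \<open>\<L> - \<lambda>\<close> takes its values in \<open>H\<^sup>1\<close>, so the range has infinite
  codimension in \<open>L\<^sup>2 \<times> L\<^sup>2\<close>, and without the closure the point spectrum would be empty for a
  trivial reason.\<close>

definition point_spectrum :: "('a::complex_normed_vector \<times> 'a) set \<Rightarrow> complex set" where
  "point_spectrum T =
     {z. fredholm (closure (minus_scalar T z)) \<and>
         fredholm_index (closure (minus_scalar T z)) = 0 \<and>
         (\<exists>x. x \<noteq> 0 \<and> x \<in> ker (minus_scalar T z))}"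

definition square_integrable :: "(real \<Rightarrow> complex) \<Rightarrow> bool" where
  "square_integrable f \<longleftrightarrow> f \<in> borel_measurable lborel \<and> integrable lborel (\<lambda>x. (norm (f x))\<^sup>2)"

definition l2_rel :: "(real \<Rightarrow> complex) \<Rightarrow> (real \<Rightarrow> complex) \<Rightarrow> bool" where
  "l2_rel f g \<longleftrightarrow> square_integrable f \<and> square_integrable g \<and> (AE x in lborel. f x = g x)"

lemma square_integrable_0: "square_integrable (\<lambda>x. 0)"
  by (simp add: square_integrable_def)

lemma square_integrable_add:
  assumes "square_integrable f" "square_integrable g"
  shows "square_integrable (\<lambda>x. f x + g x)"
proof -
  have [measurable]: "f \<in> borel_measurable lborel" "g \<in> borel_measurable lborel"
    using assms by (auto simp: square_integrable_def)
  have "integrable lborel (\<lambda>x. 2 * (norm (f x))\<^sup>2 + 2 * (norm (g x))\<^sup>2)"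
    using assms by (auto simp: square_integrable_def)
  then have "integrable lborel (\<lambda>x. (norm (f x + g x))\<^sup>2)"
  proof (rule Bochner_Integration.integrable_bound)
    show "AE x in lborel. norm ((norm (f x + g x))\<^sup>2)
        \<le> norm (2 * (norm (f x))\<^sup>2 + 2 * (norm (g x))\<^sup>2)"
    proof (rule AE_I2)
      fix x
      have "(norm (f x + g x))\<^sup>2 \<le> (norm (f x) + norm (g x))\<^sup>2"
        by (intro power_mono norm_triangle_ineq) auto
      also have "\<dots> \<le> 2 * (norm (f x))\<^sup>2 + 2 * (norm (g x))\<^sup>2"
        using zero_le_power2[of "norm (f x) - norm (g x)"] by (simp add: power2_eq_square algebra_simps)
      finally show "norm ((norm (f x + g x))\<^sup>2) \<le> norm (2 * (norm (f x))\<^sup>2 + 2 * (norm (g x))\<^sup>2)"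
        by simp
    qed
  qed simp
  then show ?thesis by (simp add: square_integrable_def)
qed

lemma square_integrable_mult:
  assumes "square_integrable f"
  shows "square_integrable (\<lambda>x. c * f x)"
  using assms by (auto simp: square_integrable_def norm_mult power_mult_distrib)

lemma square_integrable_inner:
  assumes "square_integrable f" "square_integrable g"
  shows "integrable lborel (\<lambda>x. inner (f x) (g x))"
proof -
  have [measurable]: "f \<in> borel_measurable lborel" "g \<in> borel_measurable lborel"
    using assms by (auto simp: square_integrable_def)
  have "integrable lborel (\<lambda>x. (norm (f x))\<^sup>2 + (norm (g x))\<^sup>2)"
    using assms by (auto simp: square_integrable_def)
  then show ?thesis
  proof (rule Bochner_Integration.integrable_bound)
    show "AE x in lborel. norm (inner (f x) (g x)) \<le> norm ((norm (f x))\<^sup>2 + (norm (g x))\<^sup>2)"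
    proof (rule AE_I2)
      fix x
      have "norm (inner (f x) (g x)) \<le> norm (f x) * norm (g x)"
        using Cauchy_Schwarz_ineq2[of "f x" "g x"] by simp
      also have "\<dots> \<le> (norm (f x))\<^sup>2 + (norm (g x))\<^sup>2"
        using sum_squares_bound[of "norm (f x)" "norm (g x)"]
          mult_nonneg_nonneg[OF norm_ge_zero[of "f x"] norm_ge_zero[of "g x"]] by linarith
      finally show "norm (inner (f x) (g x)) \<le> norm ((norm (f x))\<^sup>2 + (norm (g x))\<^sup>2)"
        by simp
    qed
  qed simp
qed

text \<open>Restricting to Borel functions loses nothing: every Lebesgue measurable function agrees
  almost everywhere with a Borel one.\<close>

quotient_type l2 = "real \<Rightarrow> complex" / partial: l2_rel
proof (rule part_equivpI)
  show "\<exists>f. l2_rel f f"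
    using square_integrable_0 by (auto simp: l2_rel_def)
  show "symp l2_rel"
    by (auto simp: symp_def l2_rel_def)
  show "transp l2_rel"
    by (auto simp: transp_def l2_rel_def)
qed

instantiation l2 :: real_inner
begin

lift_definition zero_l2 :: l2 is "\<lambda>x. 0"
  by (simp add: l2_rel_def square_integrable_0)

lift_definition plus_l2 :: "l2 \<Rightarrow> l2 \<Rightarrow> l2" is "\<lambda>f g x. f x + g x"
  by (auto simp: l2_rel_def square_integrable_add)

lift_definition uminus_l2 :: "l2 \<Rightarrow> l2" is "\<lambda>f x. - f x"
  using square_integrable_mult[where c = "-1"] by (auto simp: l2_rel_def)

lift_definition minus_l2 :: "l2 \<Rightarrow> l2 \<Rightarrow> l2" is "\<lambda>f g x. f x - g x"
  using square_integrable_add[OF _ square_integrable_mult[where c = "-1"]] by (auto simp: l2_rel_def)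

lift_definition scaleR_l2 :: "real \<Rightarrow> l2 \<Rightarrow> l2" is "\<lambda>r f x. complex_of_real r * f x"
  by (auto simp: l2_rel_def square_integrable_mult)

lift_definition inner_l2 :: "l2 \<Rightarrow> l2 \<Rightarrow> real" is "\<lambda>f g. \<integral>x. inner (f x) (g x) \<partial>lborel"
  by (rule integral_cong_AE) (auto simp: l2_rel_def square_integrable_def)

definition norm_l2 :: "l2 \<Rightarrow> real" where "norm_l2 f = sqrt (inner f f)"

definition dist_l2 :: "l2 \<Rightarrow> l2 \<Rightarrow> real" where "dist_l2 f g = norm (f - g)"

definition sgn_l2 :: "l2 \<Rightarrow> l2" where "sgn_l2 f = scaleR (inverse (norm f)) f"

definition uniformity_l2 :: "(l2 \<times> l2) filter" where
  "uniformity_l2 = (INF e\<in>{0<..}. principal {(f, g). dist f g < e})"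

definition open_l2 :: "l2 set \<Rightarrow> bool" where
  "open_l2 S \<longleftrightarrow> (\<forall>f\<in>S. \<forall>\<^sub>F (f', g) in uniformity. f' = f \<longrightarrow> g \<in> S)"

instance
proof
  fix f g h :: l2 and a b :: real and S :: "l2 set"
  show "f + g + h = f + (g + h)"
    by transfer (auto simp: l2_rel_def add.assoc intro!: square_integrable_add)
  show "f + g = g + f"
    by transfer (auto simp: l2_rel_def add.commute intro!: square_integrable_add)
  show "0 + f = f"
    by transfer (auto simp: l2_rel_def)
  show "- f + f = 0"
    by transfer (auto simp: l2_rel_def square_integrable_0)
  show "f - g = f + - g"
    by transfer (use square_integrable_add[OF _ square_integrable_mult[where c = "-1"]] in
      \<open>auto simp: l2_rel_def\<close>)
  show "a *\<^sub>R (f + g) = a *\<^sub>R f + a *\<^sub>R g"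
    by transfer (auto simp: l2_rel_def distrib_left intro!: square_integrable_add square_integrable_mult
      dest: square_integrable_mult[OF square_integrable_add, of _ _ "complex_of_real a"])
  show "(a + b) *\<^sub>R f = a *\<^sub>R f + b *\<^sub>R f"
    by transfer (auto simp: l2_rel_def distrib_right intro!: square_integrable_add square_integrable_mult)
  show "a *\<^sub>R b *\<^sub>R f = (a * b) *\<^sub>R f"
    by transfer (auto simp: l2_rel_def mult.assoc intro!: square_integrable_mult)
  show "1 *\<^sub>R f = f"
    by transfer (auto simp: l2_rel_def)
  show "dist f g = norm (f - g)" by (rule dist_l2_def)
  show "sgn f = scaleR (inverse (norm f)) f" by (rule sgn_l2_def)
  show "uniformity = (INF e\<in>{0<..}. principal {(f::l2, g). dist f g < e})"
    by (rule uniformity_l2_def)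
  show "open S \<longleftrightarrow> (\<forall>f\<in>S. \<forall>\<^sub>F (f', g) in uniformity. f' = f \<longrightarrow> g \<in> S)"
    by (rule open_l2_def)
  show "inner f g = inner g f"
    by transfer (simp add: inner_commute)
  show "inner (f + g) h = inner f h + inner g h"
    by transfer (simp add: l2_rel_def inner_add_left square_integrable_inner)
  show "inner (a *\<^sub>R f) g = a * inner f g"
    by transfer (simp add: l2_rel_def inner_mult_left flip: scaleR_conv_of_real)
  show "0 \<le> inner f f"
    by transfer (simp add: integral_nonneg_AE)
  show "inner f f = 0 \<longleftrightarrow> f = 0"
  proof transfer
    fix f :: "real \<Rightarrow> complex"
    assume "l2_rel f f"
    then have f: "square_integrable f" by (simp add: l2_rel_def)
    have "(\<integral>x. inner (f x) (f x) \<partial>lborel) = 0 \<longleftrightarrow> (AE x in lborel. inner (f x) (f x) = 0)"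
      by (rule integral_nonneg_eq_0_iff_AE) (auto intro: square_integrable_inner f)
    then show "(\<integral>x. inner (f x) (f x) \<partial>lborel) = 0 \<longleftrightarrow> l2_rel f (\<lambda>x. 0)"
      using f by (simp add: l2_rel_def square_integrable_0)
  qed
  show "norm f = sqrt (inner f f)" by (rule norm_l2_def)
qed

end

instantiation l2 :: complex_normed_vector
begin

lift_definition scaleC_l2 :: "complex \<Rightarrow> l2 \<Rightarrow> l2" is "\<lambda>c f x. c * f x"
  by (auto simp: l2_rel_def square_integrable_mult)

instance
proof
  fix f g :: l2 and c d :: complex and r :: real
  show "c *\<^sub>C (f + g) = c *\<^sub>C f + c *\<^sub>C g"
    by transfer (auto simp: l2_rel_def distrib_left intro!: square_integrable_add square_integrable_mult)
  show "(c + d) *\<^sub>C f = c *\<^sub>C f + d *\<^sub>C f"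
    by transfer (auto simp: l2_rel_def distrib_right intro!: square_integrable_add square_integrable_mult)
  show "c *\<^sub>C d *\<^sub>C f = (c * d) *\<^sub>C f"
    by transfer (auto simp: l2_rel_def mult.assoc intro!: square_integrable_mult)
  show "1 *\<^sub>C f = f"
    by transfer (auto simp: l2_rel_def)
  show "r *\<^sub>R f = complex_of_real r *\<^sub>C f"
    by transfer (auto simp: l2_rel_def intro!: square_integrable_mult)
  have "inner (c *\<^sub>C f) (c *\<^sub>C f) = (norm c)\<^sup>2 * inner f f"
    by transfer (simp add: l2_rel_def norm_mult power_mult_distrib flip: power2_norm_eq_inner)
  then show "norm (c *\<^sub>C f) = norm c * norm f"
    by (simp add: norm_eq_sqrt_inner real_sqrt_mult)
qed

end

definition smooth_on :: "real set \<Rightarrow> (real \<Rightarrow> real) \<Rightarrow> bool" where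
  "smooth_on S f \<longleftrightarrow> (\<forall>n. \<forall>x\<in>S. (deriv ^^ n) f differentiable (at x))"

definition test_function :: "(real \<Rightarrow> real) \<Rightarrow> bool" where
  "test_function \<phi> \<longleftrightarrow> smooth_on UNIV \<phi> \<and> compact (closure {x. \<phi> x \<noteq> 0})"

definition has_weak_deriv :: "l2 \<Rightarrow> l2 \<Rightarrow> bool" where
  "has_weak_deriv f g \<longleftrightarrow> (\<forall>\<phi>. test_function \<phi> \<longrightarrow>
     (\<integral>x. deriv \<phi> x *\<^sub>R rep_l2 f x \<partial>lborel) = - (\<integral>x. \<phi> x *\<^sub>R rep_l2 g x \<partial>lborel))"

text \<open>The weak derivative is unique if it exists, so the choice is only a totalisation.\<close>

definition weak_deriv :: "l2 \<Rightarrow> l2" where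
  "weak_deriv f = (SOME g. has_weak_deriv f g)"

primrec sobolev :: "nat \<Rightarrow> l2 set" where
  "sobolev 0 = UNIV"
| "sobolev (Suc m) = {f. \<exists>g\<in>sobolev m. has_weak_deriv f g}"

definition compressive_1_shock ::
  "(real \<Rightarrow> real) \<Rightarrow> real \<Rightarrow> real \<Rightarrow> real \<Rightarrow> real \<Rightarrow> real \<Rightarrow> bool" where
  "compressive_1_shock p Vm Um Vp Up s \<longleftrightarrow>
     Vm > 0 \<and> Vp > 0 \<and>
     s * (Vp - Vm) = Um - Up \<and>
     s * (Up - Um) = p Vp - p Vm \<and>
     - sqrt (- deriv p Vp) < s \<and> s < - sqrt (- deriv p Vm)"

definition shock_profile ::
  "(real \<Rightarrow> real) \<Rightarrow> (real \<Rightarrow> real) \<Rightarrow> (real \<Rightarrow> real) \<Rightarrow>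
   real \<Rightarrow> real \<Rightarrow> real \<Rightarrow> real \<Rightarrow> real \<Rightarrow> (real \<Rightarrow> real) \<Rightarrow> (real \<Rightarrow> real) \<Rightarrow> bool" where
  "shock_profile p \<mu> \<kappa> Vm Um Vp Up s V U \<longleftrightarrow>
     smooth_on UNIV V \<and> smooth_on UNIV U \<and> (\<forall>y. V y > 0) \<and>
     (\<forall>y. - s * deriv V y - deriv U y = 0) \<and>
     (\<forall>y. - s * deriv U y + deriv (\<lambda>z. p (V z)) y =
        deriv (\<lambda>z. \<mu> (V z) / V z * deriv U z) y -
        deriv (\<lambda>z. \<kappa> (V z) * deriv (deriv V) z + 1/2 * deriv \<kappa> (V z) * (deriv V z)\<^sup>2) y) \<and>
     (V \<longlongrightarrow> Vm) at_bot \<and> (U \<longlongrightarrow> Um) at_bot \<and>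
     (V \<longlongrightarrow> Vp) at_top \<and> (U \<longlongrightarrow> Up) at_top"

definition capillary_term ::
  "(real \<Rightarrow> real) \<Rightarrow> (real \<Rightarrow> real) \<Rightarrow> l2 \<Rightarrow> real \<Rightarrow> complex" where
  "capillary_term \<kappa> V v y =
     - \<kappa> (V y) *\<^sub>R rep_l2 ((weak_deriv ^^ 3) v) y
     - (deriv \<kappa> (V y) * deriv (deriv V) y) *\<^sub>R rep_l2 (weak_deriv v) y
     - (deriv \<kappa> (V y) * deriv V y) *\<^sub>R rep_l2 ((weak_deriv ^^ 2) v) y
     - (1/2 * deriv (deriv \<kappa>) (V y) * (deriv V y)\<^sup>2) *\<^sub>R rep_l2 (weak_deriv v) y"

text \<open>The graph formulation avoids multiplication by possibly unbounded coefficients as an operation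
  on \<^typ>\<open>l2\<close>. For a profile the coefficients are bounded, so a square-integrable \<open>g\<close> exists for
  all \<open>v\<close> and \<open>u\<close> and the domain is all of \<open>H\<^sup>3 \<times> H\<^sup>2\<close>.\<close>

definition integrated_operator ::
  "(real \<Rightarrow> real) \<Rightarrow> (real \<Rightarrow> real) \<Rightarrow> (real \<Rightarrow> real) \<Rightarrow> real \<Rightarrow> (real \<Rightarrow> real) \<Rightarrow> (real \<Rightarrow> real) \<Rightarrow>
   ((l2 \<times> l2) \<times> (l2 \<times> l2)) set" where
  "integrated_operator p \<mu> \<kappa> s V U =
     {((v, u), (f, g)). v \<in> sobolev 3 \<and> u \<in> sobolev 2 \<and>
        f = s *\<^sub>R weak_deriv v + weak_deriv u \<and>
        (AE y in lborel. rep_l2 g y =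
           s *\<^sub>R rep_l2 (weak_deriv u) y
           + (- deriv p (V y) + (deriv \<mu> (V y) * V y - \<mu> (V y)) / (V y)\<^sup>2 * deriv U y)
               *\<^sub>R rep_l2 (weak_deriv v) y
           + (\<mu> (V y) / V y) *\<^sub>R rep_l2 ((weak_deriv ^^ 2) u) y
           + capillary_term \<kappa> V v y)}"

end

theory Submission
  imports Defs
begin

text \<open>The kernel of \<open>\<L> - \<lambda>\<close> is trivial whenever \<open>Re \<lambda> \<ge> 0\<close>, so the Fredholm properties play no
  role. For a weak shock the profile is slow: \<open>V' < 0\<close>, and \<open>V'\<close>, \<open>V'' / V'\<close>, \<open>V''' / V'\<close> are uniformly
  small. Put \<open>w = 1 / (- p'(V) - s (\<mu>(V) / V)' V')\<close>, and test the second component of the eigenvalue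
  equation with \<open>w u\<close> and the first one with \<open>v\<close>. The capillary term is integrated by parts, with
  \<open>u'\<close> eliminated through \<open>u' = \<lambda> v - s v'\<close>; it produces \<open>s (w \<kappa>(V))' / 2\<close> as the coefficient of
  \<open>\<bar>v'\<bar>\<^sup>2\<close>, whose leading part is \<open>s M V' / (2 p'\<^sup>2)\<close>. This is positive since \<open>M > 0\<close>, \<open>s < 0\<close> and
  \<open>V' < 0\<close>, as is the leading part \<open>s p'' V' / (2 p'\<^sup>2)\<close> of the coefficient \<open>s w' / 2\<close> of \<open>\<bar>u\<bar>\<^sup>2\<close>.
  The diffusion \<open>w \<mu>(V) / V \<bar>u'\<bar>\<^sup>2\<close> and the smallness of \<open>V'' / V'\<close> absorb all other terms, leaving
  \<open>u = v' = 0\<close>.\<close>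

section \<open>Smooth functions and test functions\<close>

text \<open>The weight w makes w times the main coefficient of v' equal to 1, so that <v', u> from
  the second equation and <v, u'> from the first one merge into a total derivative. This matters
  because the gain is tiny: the coefficients of |u|^2 and |v'|^2 have only the size of |V'|, so no
  term <v', u> of size 1 could be absorbed. For the same reason smallness of V' alone is not enough.
  An error between v' and u contains V'' and must be small relative to V'; this is why V'' / V' and
  V''' / V' have to be controlled. Products of u' with u or v' are harmless: their coefficients are
  of size |V'|, so Young's inequality charges |V'|^2 against a diffusion coefficient bounded below.
  The positivity obtained is pointwise and not uniform on the line, but vanishing almost everywhere
  needs no more. The profile is any solution with the given limits. Capillarity might make it
  oscillate, so monotonicity and slowness are derived, from an energy bound that confines V near
  \<open>Vm\<close>. One constant B bounds all coefficients and the needed reciprocals there, and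
  every smallness condition becomes a power of B.\<close>

lemma smooth_on_has_derivative:
  assumes "smooth_on S f" "x \<in> S"
  shows "(f has_real_derivative deriv f x) (at x)"
  using assms unfolding smooth_on_def
  by (metis DERIV_deriv_iff_real_differentiable funpow_0)

lemma smooth_on_deriv: "smooth_on S f \<Longrightarrow> smooth_on S (deriv f)"
  unfolding smooth_on_def by (metis funpow_Suc_right o_apply)

lemma smooth_if_has_derivative_smooth:
  assumes "\<And>x. (f has_real_derivative g x) (at x)" "smooth_on UNIV g"
  shows "smooth_on UNIV f"
proof -
  have "deriv f = g" using assms(1) by (auto intro: DERIV_imp_deriv)
  have "(deriv ^^ n) f differentiable at x" for n x
  proof (cases n)
    case 0
    then show ?thesis using assms(1) by (auto simp: real_differentiable_def)
  next
    case (Suc k)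
    have "(deriv ^^ n) f = (deriv ^^ k) g"
      unfolding Suc funpow_Suc_right o_apply \<open>deriv f = g\<close> ..
    then show ?thesis using assms(2) by (simp add: smooth_on_def)
  qed
  then show ?thesis by (simp add: smooth_on_def)
qed

text \<open>No formula for the iterated derivatives is required, only a family closed under
  differentiation on S. Openness of S lets a derivative at a point of S ignore what the functions do
  outside S.\<close>

lemma smooth_on_coinduct:
  assumes "f \<in> F" and S: "open S"
    and closed: "\<And>f. f \<in> F \<Longrightarrow> \<exists>g\<in>F. \<forall>x\<in>S. (f has_real_derivative g x) (at x)"
  shows "smooth_on S f"
proof -
  have "\<exists>g\<in>F. \<forall>x\<in>S. (deriv ^^ n) f x = g x" for n
  proof (induction n)
    case 0
    then show ?case using assms(1) by auto
  next
    case (Suc n)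
    then obtain g where g: "g \<in> F" "\<And>x. x \<in> S \<Longrightarrow> (deriv ^^ n) f x = g x" by blast
    obtain h where h: "h \<in> F" "\<And>x. x \<in> S \<Longrightarrow> (g has_real_derivative h x) (at x)" using closed[OF g(1)] by blast
    have "(deriv ^^ Suc n) f x = h x" if "x \<in> S" for x
      using has_field_derivative_transform_within_open[OF h(2)[OF that] S that g(2)[symmetric]]
      by (simp add: DERIV_imp_deriv)
    then show ?case using h(1) by blast
  qed
  then have "\<exists>g\<in>F. \<forall>x\<in>S. ((deriv ^^ n) f has_real_derivative g x) (at x)" for n
    using closed has_field_derivative_transform_within_open[OF _ S] by (smt (verit, best))
  then show ?thesis
    unfolding smooth_on_def real_differentiable_def by blast
qed

text \<open>The sums of products of smooth functions form a family closed under differentiation by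
  the Leibniz rule, which replaces a formula for the higher derivatives of a product.\<close>

inductive_set smooth_ring :: "real set \<Rightarrow> (real \<Rightarrow> real) set" for S where
  base: "smooth_on S f \<Longrightarrow> f \<in> smooth_ring S"
| add: "f \<in> smooth_ring S \<Longrightarrow> g \<in> smooth_ring S \<Longrightarrow> (\<lambda>x. f x + g x) \<in> smooth_ring S"
| mult: "f \<in> smooth_ring S \<Longrightarrow> g \<in> smooth_ring S \<Longrightarrow> (\<lambda>x. f x * g x) \<in> smooth_ring S"

lemma smooth_ring_smooth:
  assumes "open S" "f \<in> smooth_ring S"
  shows "smooth_on S f"
proof (rule smooth_on_coinduct[OF assms(2,1)])
  fix f assume "f \<in> smooth_ring S"
  then show "\<exists>g\<in>smooth_ring S. \<forall>x\<in>S. (f has_real_derivative g x) (at x)"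
  proof induction
    case (base f)
    then show ?case using smooth_on_deriv smooth_on_has_derivative smooth_ring.base by blast
  next
    case (add f g)
    then obtain f' g' where "f' \<in> smooth_ring S" "g' \<in> smooth_ring S"
      "\<And>x. x \<in> S \<Longrightarrow> (f has_real_derivative f' x) (at x)" "\<And>x. x \<in> S \<Longrightarrow> (g has_real_derivative g' x) (at x)" by blast
    then show ?case by (intro bexI[of _ "\<lambda>x. f' x + g' x"]) (auto intro!: smooth_ring.add derivative_eq_intros)
  next
    case (mult f g)
    then obtain f' g' where *: "f' \<in> smooth_ring S" "g' \<in> smooth_ring S"
      "\<And>x. x \<in> S \<Longrightarrow> (f has_real_derivative f' x) (at x)" "\<And>x. x \<in> S \<Longrightarrow> (g has_real_derivative g' x) (at x)" by blast
    then have "\<forall>x\<in>S. ((\<lambda>x. f x * g x) has_real_derivative f' x * g x + f x * g' x) (at x)"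
      by (auto intro!: derivative_eq_intros)
    then show ?case
      using * mult.hyps by (intro bexI[of _ "\<lambda>x. f' x * g x + f x * g' x"]) (auto intro!: smooth_ring.intros(2,3))
  qed
qed

lemma smooth_on_add: "open S \<Longrightarrow> smooth_on S f \<Longrightarrow> smooth_on S g \<Longrightarrow> smooth_on S (\<lambda>x. f x + g x)"
  and smooth_on_mult: "open S \<Longrightarrow> smooth_on S f \<Longrightarrow> smooth_on S g \<Longrightarrow> smooth_on S (\<lambda>x. f x * g x)"
  by (simp_all add: smooth_ring.intros smooth_ring_smooth)

lemma smooth_on_const: "open S \<Longrightarrow> smooth_on S (\<lambda>x. c)"
  by (rule smooth_on_coinduct[where F = "range (\<lambda>c x. c)"]) (auto intro!: derivative_eq_intros)

text \<open>The polynomials in 1/x form a family closed under differentiation: the derivative of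
  q(1/x) is - q'(1/x) / x^2, which explains the factor \<open>[:0, 0, -1:]\<close>.\<close>

lemma smooth_on_inverse: "smooth_on {0<..} (\<lambda>x. 1 / x)"
proof (rule smooth_on_coinduct[where F = "range (\<lambda>q x. poly q (1 / x))"])
  show "(\<lambda>x::real. 1 / x) \<in> range (\<lambda>q x. poly q (1 / x))"
    by (rule range_eqI[of _ _ "[:0, 1:]"]) simp
  fix f :: "real \<Rightarrow> real" assume "f \<in> range (\<lambda>q x. poly q (1 / x))"
  then obtain q where f: "f = (\<lambda>x. poly q (1 / x))" by auto
  have "(f has_real_derivative poly (pderiv q) (1 / x) * (- (1 / x\<^sup>2))) (at x)" if "x > 0" for x
    unfolding f by (rule DERIV_chain2[OF poly_DERIV])
      (use that in \<open>auto intro!: derivative_eq_intros simp: power2_eq_square\<close>)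
  then have "\<forall>x\<in>{0<..}. (f has_real_derivative poly ([:0, 0, -1:] * pderiv q) (1 / x)) (at x)"
    by (simp add: power2_eq_square mult_ac)
  then show "\<exists>g\<in>range (\<lambda>q x. poly q (1 / x)). \<forall>x\<in>{0<..}. (f has_real_derivative g x) (at x)"
    by (rule bexI[where x = "\<lambda>x. poly ([:0, 0, -1:] * pderiv q) (1 / x)"]) (rule rangeI)
qed auto

text \<open>For q = 1 this is the classical smooth function that is flat at the origin. The
  polynomial factor is there because differentiation maps the family to itself: q becomes X^2 (q -
  q').\<close>

definition flat :: "real poly \<Rightarrow> real \<Rightarrow> real" where
  "flat q x = (if x \<le> 0 then 0 else poly q (1 / x) * exp (- (1 / x)))"

lemma poly_times_exp_minus: "((\<lambda>t. poly q t * exp (- t)) \<longlongrightarrow> (0::real)) at_top"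
proof -
  have "((\<lambda>t. \<Sum>i\<le>degree q. coeff q i * (t ^ i / exp t)) \<longlongrightarrow> (\<Sum>i\<le>degree q. coeff q i * 0)) at_top"
    by (intro tendsto_intros tendsto_power_div_exp_0)
  then show ?thesis
    by (simp add: poly_altdef sum_distrib_right exp_minus divide_inverse mult.assoc)
qed

lemma flat_has_derivative: "(flat q has_real_derivative flat ([:0, 0, 1:] * (q - pderiv q)) x) (at x)"
proof -
  let ?d = "[:0, 0, 1:] * (q - pderiv q)"
  consider "x < 0" | "x > 0" | "x = 0" by linarith
  then show ?thesis
  proof cases
    case 1
    have "((\<lambda>x. 0) has_real_derivative flat ?d x) (at x)" using 1 by (simp add: flat_def)
    then show ?thesis
      by (rule has_field_derivative_transform_within_open[where S = "{..<0}"])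
        (use 1 in \<open>auto simp: flat_def\<close>)
  next
    case 2
    have "((\<lambda>x. poly q (1 / x) * exp (- (1 / x))) has_real_derivative flat ?d x) (at x)"
    proof -
      have "((\<lambda>x. poly q (1 / x)) has_real_derivative poly (pderiv q) (1 / x) * (- (1 / x\<^sup>2))) (at x)"
        by (rule DERIV_chain2[OF poly_DERIV])
          (use 2 in \<open>auto intro!: derivative_eq_intros simp: power2_eq_square\<close>)
      moreover have "((\<lambda>x. exp (- (1 / x))) has_real_derivative exp (- (1 / x)) * (1 / x\<^sup>2)) (at x)"
        using 2 by (auto intro!: derivative_eq_intros simp: power2_eq_square)
      ultimately have "((\<lambda>x. poly q (1 / x) * exp (- (1 / x))) has_real_derivative
          poly (pderiv q) (1 / x) * (- (1 / x\<^sup>2)) * exp (- (1 / x))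
          + exp (- (1 / x)) * (1 / x\<^sup>2) * poly q (1 / x)) (at x)"
        by (rule DERIV_mult)
      moreover have "poly (pderiv q) (1 / x) * (- (1 / x\<^sup>2)) * exp (- (1 / x))
          + exp (- (1 / x)) * (1 / x\<^sup>2) * poly q (1 / x) = flat ?d x"
        using 2 by (simp add: flat_def power2_eq_square left_diff_distrib mult_ac right_diff_distrib)
      ultimately show ?thesis by simp
    qed
    then show ?thesis
      by (rule has_field_derivative_transform_within_open[where S = "{0<..}"])
        (use 2 in \<open>auto simp: flat_def\<close>)
  next
    case 3
    \<comment> \<open>This is the right difference quotient at 0; the factor \<open>[:0, 1:]\<close>
      is the division by h. With t = 1/h it is a polynomial in t times exp(-t).\<close>
    have "((\<lambda>h. poly [:0, 1:] (1 / h) * poly q (1 / h) * exp (- (1 / h))) \<longlongrightarrow> 0) (at_right 0)"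
      using filterlim_compose[OF poly_times_exp_minus[of "[:0, 1:] * q"] filterlim_inverse_at_top_right]
      by (simp add: field_simps inverse_eq_divide)
    then have "((\<lambda>h. flat q h / h) \<longlongrightarrow> 0) (at_right 0)"
      by (rule Lim_transform_eventually) (auto simp: eventually_at_filter flat_def)
    moreover have "((\<lambda>h. flat q h / h) \<longlongrightarrow> 0) (at_left 0)"
      by (rule tendsto_eventually) (auto simp: eventually_at_filter flat_def)
    ultimately have "((\<lambda>h. flat q h / h) \<longlongrightarrow> 0) (at 0)"
      using filterlim_split_at by blast
    then show ?thesis using 3 by (simp add: has_field_derivative_iff flat_def)
  qed
qed

lemma smooth_flat: "smooth_on UNIV (\<lambda>x. flat q (a * x + b))"
proof (rule smooth_on_coinduct[where F = "range (\<lambda>q x. flat q (a * x + b))"])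
  fix f assume "f \<in> range (\<lambda>q x. flat q (a * x + b))"
  then obtain q where f: "f = (\<lambda>x. flat q (a * x + b))" by blast
  have "(f has_real_derivative flat (smult a ([:0, 0, 1:] * (q - pderiv q))) (a * x + b)) (at x)" for x
  proof -
    have "((\<lambda>x. flat q (a * x + b)) has_real_derivative flat ([:0, 0, 1:] * (q - pderiv q)) (a * x + b) * a) (at x)"
      by (rule DERIV_chain2[OF flat_has_derivative]) (auto intro!: derivative_eq_intros)
    then show ?thesis by (simp add: f flat_def mult_ac split: if_splits)
  qed
  then show "\<exists>g\<in>range (\<lambda>q x. flat q (a * x + b)). \<forall>x\<in>UNIV. (f has_real_derivative g x) (at x)"
    by (intro bexI[of _ "\<lambda>x. flat (smult a ([:0, 0, 1:] * (q - pderiv q))) (a * x + b)"]) auto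
qed auto

text \<open>Since \<open>flat 1 (n t) = exp (- 1 / (n t))\<close> for \<open>t > 0\<close>, these functions tend to the indicator of
  \<open>(a, b)\<close> as \<open>n\<close> tends to infinity.\<close>

definition bump :: "real \<Rightarrow> real \<Rightarrow> real \<Rightarrow> real \<Rightarrow> real" where
  "bump n a b x = flat 1 (n * x + (- n * a)) * flat 1 (- n * x + n * b)"

lemma bump_nonneg: "0 \<le> bump n a b x" and bump_le_1: "bump n a b x \<le> 1"
  by (auto simp: bump_def flat_def mult_le_one)

lemma bump_pos: "n > 0 \<Longrightarrow> a < x \<Longrightarrow> x < b \<Longrightarrow> 0 < bump n a b x"
  using mult_pos_pos[of n "x - a"] mult_pos_pos[of n "b - x"]
  by (auto simp: bump_def flat_def right_diff_distrib not_le)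

lemma bump_eq_0: "n > 0 \<Longrightarrow> x \<notin> {a<..<b} \<Longrightarrow> bump n a b x = 0"
  by (auto simp: bump_def flat_def mult_le_cancel_left not_less)

lemma smooth_bump: "smooth_on UNIV (bump n a b)"
  unfolding bump_def by (intro smooth_on_mult smooth_flat open_UNIV)

lemma test_functionI:
  assumes "smooth_on UNIV f" "\<And>x. x \<notin> {a..b} \<Longrightarrow> f x = 0"
  shows "test_function f"
proof -
  have "closure {x. f x \<noteq> 0} \<subseteq> {a..b}" using assms(2) by (intro closure_minimal subsetI) (blast, simp)
  then have "compact (closure {x. f x \<noteq> 0})"
    using bounded_subset[OF bounded_closed_interval] compact_eq_bounded_closed by blast
  then show ?thesis using assms by (simp add: test_function_def)
qed

lemma test_function_support:
  assumes "test_function f"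
  obtains r where "r > 0" "\<And>x. \<bar>x\<bar> \<ge> r \<Longrightarrow> f x = 0"
proof -
  have "bounded {x. f x \<noteq> 0}"
    using assms bounded_subset[OF compact_imp_bounded closure_subset] by (auto simp: test_function_def)
  then obtain r where r: "\<And>x. f x \<noteq> 0 \<Longrightarrow> \<bar>x\<bar> \<le> r"
    by (auto simp: bounded_iff)
  have "f x = 0" if "\<bar>x\<bar> \<ge> \<bar>r\<bar> + 1" for x using r[of x] that by linarith
  then show ?thesis using that[of "\<bar>r\<bar> + 1"] by auto
qed

lemma test_function_bump: "n > 0 \<Longrightarrow> test_function (bump n a b)"
  by (rule test_functionI[where a = a and b = b]) (auto simp: smooth_bump intro!: bump_eq_0)

lemma continuous_on_smooth: "smooth_on UNIV f \<Longrightarrow> continuous_on A f"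
  by (rule DERIV_continuous_on[where D = "deriv f"])
    (auto intro: smooth_on_has_derivative has_field_derivative_at_within)

lemma bump_tendsto: "(\<lambda>n. bump (real (Suc n)) a b x) \<longlonglongrightarrow> indicator {a<..<b} x"
proof (cases "x \<in> {a<..<b}")
  case True
  have lim: "(\<lambda>n. exp (- (1 / (real (Suc n) * t)))) \<longlonglongrightarrow> exp (- 0)" for t
  proof (intro tendsto_intros)
    have "(\<lambda>n. (1 / real (Suc n)) * (1 / t)) \<longlonglongrightarrow> 0 * (1 / t)"
      by (intro tendsto_mult_right) (use LIMSEQ_inverse_real_of_nat in \<open>simp add: inverse_eq_divide\<close>)
    then show "(\<lambda>n. 1 / (real (Suc n) * t)) \<longlonglongrightarrow> 0" by simp
  qed
  have "bump (real (Suc n)) a b x =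
      exp (- (1 / (real (Suc n) * (x - a)))) * exp (- (1 / (real (Suc n) * (b - x))))" for n
    using True mult_strict_left_mono[of a x "real (Suc n)"] mult_strict_left_mono[of x b "real (Suc n)"]
    by (auto simp: bump_def flat_def right_diff_distrib simp del: of_nat_Suc)
  then show ?thesis using tendsto_mult[OF lim[of "x - a"] lim[of "b - x"]] True by simp
qed (simp add: bump_eq_0)

section \<open>Locally integrable functions determined by test functions\<close>

text \<open>The half-lines generate the Borel sets and are stable under intersection, so the
  vanishing of the integral extends to every Borel set. Complements need the integral over the whole
  line to vanish, which follows by exhausting it with half-lines. Then f and 0 are densities of the
  same measure.\<close>

lemma borel_AE_zero_if_integrals_zero:
  fixes f :: "real \<Rightarrow> real"
  assumes f: "integrable lborel f" and zero: "\<And>a. (LINT x:{..a}|lborel. f x) = 0"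
  shows "AE x in lborel. f x = 0"
proof -
  have [measurable]: "f \<in> borel_measurable lborel" using f by auto
  have int: "integrable lborel (\<lambda>x. indicator A x *\<^sub>R f x)" if "A \<in> sets borel" for A
    using integrable_mult_indicator[OF _ f] that by simp
  have "(\<lambda>n. LINT x|lborel. indicator {..real n} x *\<^sub>R f x) \<longlonglongrightarrow> integral\<^sup>L lborel f"
  proof (rule integral_dominated_convergence[where w = "\<lambda>x. norm (f x)"])
    show "AE x in lborel. (\<lambda>n. indicator {..real n} x *\<^sub>R f x) \<longlonglongrightarrow> f x"
    proof (rule AE_I2)
      fix x
      have "eventually (\<lambda>n. indicator {..real n} x *\<^sub>R f x = f x) sequentially"
        using eventually_ge_at_top[of "nat \<lceil>x\<rceil>"] by eventually_elim (simp add: nat_ceiling_le_eq)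
      then show "(\<lambda>n. indicator {..real n} x *\<^sub>R f x) \<longlonglongrightarrow> f x" by (rule tendsto_eventually)
    qed
  qed (use f in \<open>auto split: split_indicator\<close>)
  moreover have "(LINT x|lborel. indicator {..real n} x *\<^sub>R f x) = 0" for n
    using zero by (simp add: set_lebesgue_integral_def)
  ultimately have all: "integral\<^sup>L lborel f = 0"
    by (simp add: LIMSEQ_const_iff)
  have "(LINT x:A|lborel. f x) = 0" if "A \<in> sets borel" for A
  proof -
    have "Int_stable (range (\<lambda>a::real. {..a}))"
      by (auto simp: Int_stable_def)
    moreover have "range (\<lambda>a::real. {..a}) \<subseteq> Pow UNIV" by simp
    moreover have "A \<in> sigma_sets UNIV (range (\<lambda>a. {..a}))"
      using that by (simp add: borel_eq_atMost)
    ultimately show ?thesis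
    proof (induction rule: sigma_sets_induct_disjoint)
      case (basic A)
      then show ?case using zero by auto
    next
      case empty
      show ?case by (simp add: set_lebesgue_integral_def)
    next
      case (compl A)
      then have A: "A \<in> sets borel" by (simp add: borel_eq_atMost)
      have "(LINT x:UNIV - A|lborel. f x) = (LINT x|lborel. f x - indicator A x *\<^sub>R f x)"
        unfolding set_lebesgue_integral_def by (rule Bochner_Integration.integral_cong) (auto split: split_indicator)
      also have "\<dots> = 0"
        using int[OF A] f all compl by (simp add: set_lebesgue_integral_def)
      finally show ?case .
    next
      case (union A)
      then have A: "\<And>i. A i \<in> sets lborel" by (auto simp: borel_eq_atMost)
      have "(LINT x:(\<Union>i. A i)|lborel. f x) = (\<Sum>i. LINT x:A i|lborel. f x)"
      proof (rule lebesgue_integral_countable_add)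
        show "set_integrable lborel (\<Union>i. A i) f"
          unfolding set_integrable_def using A by (intro int) auto
      qed (use A union in \<open>auto simp: disjoint_family_on_def\<close>)
      then show ?case using union by simp
    qed
  qed
  then show ?thesis
    using density_unique_real[of lborel f "\<lambda>x. 0"] f by simp
qed

section \<open>Local integrability and the fundamental lemma of the calculus of variations\<close>

definition locally_integrable :: "(real \<Rightarrow> real) \<Rightarrow> bool" where
  "locally_integrable f \<longleftrightarrow> f \<in> borel_measurable lborel \<and> (\<forall>a b. set_integrable lborel {a..b} f)"

lemma locally_integrable_measurable [measurable_dest]: "locally_integrable f \<Longrightarrow> f \<in> borel_measurable lborel"
  by (simp add: locally_integrable_def)

lemma locally_integrable_bounded_mult:
  assumes f: "locally_integrable f" and [measurable]: "g \<in> borel_measurable lborel"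
    and bound: "\<And>a b. \<exists>B. \<forall>x\<in>{a..b}. \<bar>g x\<bar> \<le> B"
  shows "locally_integrable (\<lambda>x. g x * f x)"
proof -
  have [measurable]: "f \<in> borel_measurable lborel" using f by (rule locally_integrable_measurable)
  have "set_integrable lborel {a..b} (\<lambda>x. g x * f x)" for a b
  proof -
    obtain B where B: "\<And>x. x \<in> {a..b} \<Longrightarrow> \<bar>g x\<bar> \<le> B" using bound by blast
    have "integrable lborel (\<lambda>x. B * (indicator {a..b} x *\<^sub>R f x))"
      using f by (auto simp: locally_integrable_def set_integrable_def)
    then show ?thesis unfolding set_integrable_def
    proof (rule Bochner_Integration.integrable_bound)
      have "\<bar>g x\<bar> * \<bar>f x\<bar> \<le> \<bar>B\<bar> * \<bar>f x\<bar>" if "x \<in> {a..b}" for x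
        using B[OF that] by (intro mult_right_mono) auto
      then show "AE x in lborel. norm (indicator {a..b} x *\<^sub>R (g x * f x)) \<le> norm (B * (indicator {a..b} x *\<^sub>R f x))"
        by (auto simp: abs_mult split: split_indicator)
    qed measurable
  qed
  then show ?thesis by (auto simp: locally_integrable_def)
qed

lemma continuous_bounded_on_Icc:
  fixes g :: "real \<Rightarrow> real"
  assumes "continuous_on UNIV g"
  shows "\<exists>B. \<forall>x\<in>{a..b}. \<bar>g x\<bar> \<le> B"
proof -
  have "bounded (g ` {a..b})"
    using assms by (intro compact_imp_bounded compact_continuous_image continuous_on_subset[OF assms]) auto
  then show ?thesis by (auto simp: bounded_iff)
qed

lemma locally_integrable_continuous_mult:
  assumes "locally_integrable f" "continuous_on UNIV g"
  shows "locally_integrable (\<lambda>x. g x * f x)"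
  using assms continuous_bounded_on_Icc
  by (intro locally_integrable_bounded_mult) (auto intro: borel_measurable_continuous_onI)

lemma locally_integrable_const: "locally_integrable (\<lambda>x. c)"
  unfolding locally_integrable_def
  by (auto intro: borel_integrable_atLeastAtMost')

lemma locally_integrable_continuous: "continuous_on UNIV g \<Longrightarrow> locally_integrable g"
  using locally_integrable_continuous_mult[OF locally_integrable_const[of 1]] by simp

lemma locally_integrable_add:
  "locally_integrable f \<Longrightarrow> locally_integrable g \<Longrightarrow> locally_integrable (\<lambda>x. f x + g x)"
  by (auto simp: locally_integrable_def)

lemma locally_integrable_diff:
  "locally_integrable f \<Longrightarrow> locally_integrable g \<Longrightarrow> locally_integrable (\<lambda>x. f x - g x)"
  by (auto simp: locally_integrable_def)

lemma integrable_compact_support: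
  assumes "locally_integrable f" "\<And>x. \<bar>x\<bar> \<ge> r \<Longrightarrow> f x = 0"
  shows "integrable lborel f" "integral\<^sup>L lborel f = (LINT x:{-r..r}|lborel. f x)"
proof -
  have eq: "(\<lambda>x. indicator {-r..r} x *\<^sub>R f x) = f"
    using assms(2) by (auto simp: fun_eq_iff abs_le_iff not_le split: split_indicator)
  have "set_integrable lborel {-r..r} f"
    using assms by (auto simp: locally_integrable_def)
  then show "integrable lborel f" "integral\<^sup>L lborel f = (LINT x:{-r..r}|lborel. f x)"
    by (simp_all only: eq set_integrable_def set_lebesgue_integral_def)
qed

lemma test_function_continuous: "test_function \<phi> \<Longrightarrow> continuous_on A \<phi>"
  by (simp add: test_function_def continuous_on_smooth)

lemma integrable_test_mult:
  assumes "test_function \<phi>" "locally_integrable f"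
  shows "integrable lborel (\<lambda>x. \<phi> x * f x)"
proof -
  obtain r where "\<And>x. \<bar>x\<bar> \<ge> r \<Longrightarrow> \<phi> x = 0" using test_function_support[OF assms(1)] by blast
  then show ?thesis
    using integrable_compact_support[OF locally_integrable_continuous_mult[OF assms(2) test_function_continuous[OF assms(1)]], of r]
    by auto
qed

text \<open>Bumps converge to indicators of open intervals, so dominated convergence makes all
  integrals over bounded open intervals vanish. As w need not be integrable on the line, it is cut
  off to (-n, n) before the criterion with half-lines applies.\<close>

lemma AE_zero_if_test_integrals_zero:
  assumes w: "locally_integrable w" and zero: "\<And>\<phi>. test_function \<phi> \<Longrightarrow> (LINT x|lborel. \<phi> x * w x) = 0"
  shows "AE x in lborel. w x = 0"
proof -
  have [measurable]: "w \<in> borel_measurable lborel" using w by (rule locally_integrable_measurable)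
  have open_zero: "(LINT x|lborel. indicator {a<..<b} x * w x) = 0" for a b
  proof -
    have "(\<lambda>n. LINT x|lborel. bump (real (Suc n)) a b x * w x) \<longlonglongrightarrow> (LINT x|lborel. indicator {a<..<b} x * w x)"
    proof (rule integral_dominated_convergence[where w = "\<lambda>x. \<bar>indicator {a..b} x *\<^sub>R w x\<bar>"])
      have [measurable]: "bump n a b \<in> borel_measurable borel" for n
        using continuous_on_smooth[OF smooth_bump] by (rule borel_measurable_continuous_onI)
      then show "(\<lambda>x. bump (real (Suc n)) a b x * w x) \<in> borel_measurable lborel" for n by measurable
      show "integrable lborel (\<lambda>x. \<bar>indicator {a..b} x *\<^sub>R w x\<bar>)"
        using w unfolding locally_integrable_def set_integrable_def by (intro integrable_abs) blast
      show "AE x in lborel. (\<lambda>n. bump (real (Suc n)) a b x * w x) \<longlonglongrightarrow> indicator {a<..<b} x * w x"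
        by (intro AE_I2 tendsto_intros bump_tendsto)
      show "AE x in lborel. norm (bump (real (Suc n)) a b x * w x) \<le> \<bar>indicator {a..b} x *\<^sub>R w x\<bar>" for n
      proof (rule AE_I2)
        fix x
        show "norm (bump (real (Suc n)) a b x * w x) \<le> \<bar>indicator {a..b} x *\<^sub>R w x\<bar>"
        proof (cases "x \<in> {a<..<b}")
          case True
          then show ?thesis
            using mult_right_mono[OF bump_le_1 abs_ge_zero, of "real (Suc n)" a b x "w x"] bump_nonneg[of "real (Suc n)" a b x]
            by (simp add: abs_mult)
        qed (simp add: bump_eq_0)
      qed
    qed simp
    moreover have "(LINT x|lborel. bump (real (Suc n)) a b x * w x) = 0" for n
      by (rule zero) (simp add: test_function_bump)
    ultimately show ?thesis by (simp add: LIMSEQ_const_iff)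
  qed
  have "AE x in lborel. indicator {- real n<..<real n} x *\<^sub>R w x = 0" for n
  proof (rule borel_AE_zero_if_integrals_zero)
    have "set_integrable lborel {- real n<..<real n} w"
      by (rule set_integrable_subset[of _ "{- real n..real n}"]) (use w in \<open>auto simp: locally_integrable_def\<close>)
    then show "integrable lborel (\<lambda>x. indicator {- real n<..<real n} x *\<^sub>R w x)"
      by (simp add: set_integrable_def)
    fix a
    \<comment> \<open>The two integrands can differ only at the point a, which is closed off on the
      left and open on the right.\<close>
    have "(LINT x:{..a}|lborel. indicator {- real n<..<real n} x *\<^sub>R w x)
        = (LINT x|lborel. indicator {- real n<..<min a (real n)} x * w x)"
      unfolding set_lebesgue_integral_def
      by (rule integral_cong_AE) (use AE_lborel_singleton[of a] in \<open>auto split: split_indicator elim!: eventually_mono\<close>)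
    then show "(LINT x:{..a}|lborel. indicator {- real n<..<real n} x *\<^sub>R w x) = 0"
      by (simp add: open_zero)
  qed
  then have "AE x in lborel. \<forall>n. indicator {- real n<..<real n} x *\<^sub>R w x = 0"
    unfolding AE_all_countable by blast
  then show ?thesis
  proof eventually_elim
    case (elim x)
    obtain n where "\<bar>x\<bar> < real n" using reals_Archimedean2 by blast
    then show ?case using spec[OF elim, of n] by (auto simp: abs_less_iff split: split_indicator_asm)
  qed
qed

section \<open>Primitives of locally integrable functions\<close>

text \<open>This encodes local absolute continuity without differentiating pointwise: f is
  determined only almost everywhere, F everywhere up to a constant.\<close>

definition primitive :: "(real \<Rightarrow> real) \<Rightarrow> (real \<Rightarrow> real) \<Rightarrow> bool" where
  "primitive F f \<longleftrightarrow> locally_integrable f \<and> (\<forall>a b. a \<le> b \<longrightarrow> F b - F a = (LINT x:{a..b}|lborel. f x))"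

lemma primitive_eq: "primitive F f \<Longrightarrow> a \<le> b \<Longrightarrow> F b - F a = (LINT x:{a..b}|lborel. f x)"
  and primitive_locally_integrable: "primitive F f \<Longrightarrow> locally_integrable f"
  by (auto simp: primitive_def)

lemma locally_integrable_HK:
  assumes "locally_integrable f"
  shows "f integrable_on {a..b}" "(LINT x:{a..b}|lborel. f x) = integral {a..b} f"
  using assms set_borel_integral_eq_integral[of "{a..b}" f] by (auto simp: locally_integrable_def)

lemma primitive_continuous:
  assumes "primitive F f"
  shows "continuous_on A F"
proof -
  note f = primitive_locally_integrable[OF assms]
  have "isCont F x" for x
  proof -
    have "continuous_on {x - 1..x + 1} (\<lambda>y. F (x - 1) + integral {x - 1..y} f)"
      by (intro continuous_intros indefinite_integral_continuous_1 locally_integrable_HK f)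
    then have "continuous_on {x - 1..x + 1} F"
    proof (rule continuous_on_eq)
      fix y assume "y \<in> {x - 1..x + 1}"
      then show "F (x - 1) + integral {x - 1..y} f = F y"
        using primitive_eq[OF assms, of "x - 1" y] locally_integrable_HK(2)[OF f] by simp
    qed
    then show ?thesis by (rule continuous_on_interior) simp
  qed
  then show ?thesis by (simp add: continuous_at_imp_continuous_on)
qed

lemma primitive_exists:
  assumes f: "locally_integrable f"
  obtains F where "primitive F f"
proof -
  \<comment> \<open>The sign is put in by hand because \<open>integral {0..x} f\<close> is 0 for
    negative x.\<close>
  define F where "F x = (if 0 \<le> x then integral {0..x} f else - integral {x..0} f)" for x
  note int = locally_integrable_HK(1)[OF f]
  have "F b - F a = integral {a..b} f" if "a \<le> b" for a b
  proof -
    consider "0 \<le> a" | "a < 0" "0 \<le> b" | "b < 0" by linarith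
    then show ?thesis
    proof cases
      case 1
      then show ?thesis
        using that Henstock_Kurzweil_Integration.integral_combine[of 0 a b f] int by (simp add: F_def)
    next
      case 2
      then show ?thesis
        using that Henstock_Kurzweil_Integration.integral_combine[of a 0 b f] int by (simp add: F_def)
    next
      case 3
      then show ?thesis
        using that Henstock_Kurzweil_Integration.integral_combine[of a b 0 f] int by (simp add: F_def)
    qed
  qed
  then have "primitive F f"
    using f by (simp add: primitive_def locally_integrable_HK)
  then show ?thesis by (rule that)
qed

lemma primitive_C1:
  assumes "\<And>x. (F has_real_derivative f x) (at x)" "continuous_on UNIV f"
  shows "primitive F f"
proof -
  have "F b - F a = (LINT x:{a..b}|lborel. f x)" if "a \<le> b" for a b
    unfolding set_lebesgue_integral_def
    by (rule integral_FTC_Icc[symmetric])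
      (use that assms continuous_on_subset[OF assms(2)] in
        \<open>auto simp flip: has_real_derivative_iff_has_vector_derivative intro: has_field_derivative_at_within\<close>)
  then show ?thesis using assms by (simp add: primitive_def locally_integrable_continuous)
qed

lemma primitive_locally_integrable_mult:
  assumes "primitive F f" "primitive G g"
  shows "locally_integrable (\<lambda>x. f x * G x)" "locally_integrable (\<lambda>x. F x * g x)"
  using locally_integrable_continuous_mult[OF primitive_locally_integrable primitive_continuous] assms
  by (auto simp: mult.commute[of "f _"])

text \<open>Neither factor has to be differentiable at every point, so the product rule is proved by
  Fubini: f(x) g(t) is integrated over the triangle a <= t <= x <= b. Integrating in t first gives f
  (G - G a), in x first (F b - F) g.\<close>

lemma primitive_mult:
  assumes F: "primitive F f" and G: "primitive G g"
  shows "primitive (\<lambda>x. F x * G x) (\<lambda>x. f x * G x + F x * g x)"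
proof -
  note lf = primitive_locally_integrable[OF F] and lg = primitive_locally_integrable[OF G]
  note li = primitive_locally_integrable_mult[OF F G]
  have "F b * G b - F a * G a = (LINT x:{a..b}|lborel. f x * G x + F x * g x)" if "a \<le> b" for a b
  proof -
    have [measurable]: "f \<in> borel_measurable borel" "g \<in> borel_measurable borel"
      using lf lg by (auto dest: locally_integrable_measurable)
    define \<phi> where "\<phi> x = indicator {a..b} x * f x" for x
    define \<gamma> where "\<gamma> x = indicator {a..b} x * g x" for x
    have \<phi>: "integrable lborel \<phi>" and \<gamma>: "integrable lborel \<gamma>"
      using lf lg unfolding \<phi>_def \<gamma>_def locally_integrable_def set_integrable_def by auto
    then have [measurable]: "\<phi> \<in> borel_measurable borel" "\<gamma> \<in> borel_measurable borel" by auto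
    define K where "K x t = (if t \<le> x then \<phi> x * \<gamma> t else 0)" for x t
    have [measurable]: "(\<lambda>(x, t). K x t) \<in> borel_measurable (lborel \<Otimes>\<^sub>M lborel)"
      unfolding K_def by measurable
    have K: "integrable (lborel \<Otimes>\<^sub>M lborel) (\<lambda>(x, t). K x t)"
    proof (rule Bochner_Integration.integrable_bound)
      show "integrable (lborel \<Otimes>\<^sub>M lborel) (\<lambda>(x, t). \<phi> x * \<gamma> t)"
        by (rule lborel_pair.Fubini_integrable) (use \<phi> \<gamma> in \<open>auto simp: abs_mult\<close>)
    qed (auto simp: K_def)
    have inner1: "(LINT t|lborel. K x t) = indicator {a..b} x * (f x * (G x - G a))" for x
    proof (cases "x \<in> {a..b}")
      case True
      have "(LINT t|lborel. K x t) = (LINT t|lborel. f x * (indicator {a..x} t *\<^sub>R g t))"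
        by (rule Bochner_Integration.integral_cong) (use True in \<open>auto simp: K_def \<phi>_def \<gamma>_def split: split_indicator\<close>)
      then show ?thesis
        using True primitive_eq[OF G, of a x] by (simp add: set_lebesgue_integral_def)
    next
      case False
      then have "K x = (\<lambda>t. 0)" by (auto simp: K_def \<phi>_def fun_eq_iff)
      then show ?thesis using False by simp
    qed
    have inner2: "(LINT x|lborel. K x t) = indicator {a..b} t * ((F b - F t) * g t)" for t
    proof (cases "t \<in> {a..b}")
      case True
      have "(LINT x|lborel. K x t) = (LINT x|lborel. (indicator {t..b} x *\<^sub>R f x) * g t)"
        by (rule Bochner_Integration.integral_cong) (use True in \<open>auto simp: K_def \<phi>_def \<gamma>_def split: split_indicator\<close>)
      then show ?thesis
        using True primitive_eq[OF F, of t b] by (simp add: set_lebesgue_integral_def)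
    next
      case False
      then have "(\<lambda>x. K x t) = (\<lambda>x. 0)" by (auto simp: K_def \<gamma>_def fun_eq_iff)
      then show ?thesis using False by simp
    qed
    have fub: "(LINT x:{a..b}|lborel. f x * (G x - G a)) = (LINT x:{a..b}|lborel. (F b - F x) * g x)"
      using lborel_pair.Fubini_integral[OF K] by (simp add: inner1 inner2 set_lebesgue_integral_def)
    have si: "set_integrable lborel {a..b} (\<lambda>x. f x * G x)" "set_integrable lborel {a..b} (\<lambda>x. F x * g x)"
      "set_integrable lborel {a..b} f" "set_integrable lborel {a..b} g"
      using li lf lg by (auto simp: locally_integrable_def)
    have "(LINT x:{a..b}|lborel. f x * (G x - G a)) = (LINT x:{a..b}|lborel. f x * G x) - (F b - F a) * G a"
      using si primitive_eq[OF F that] by (simp add: right_diff_distrib set_integral_diff)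
    moreover have "(LINT x:{a..b}|lborel. (F b - F x) * g x) = F b * (G b - G a) - (LINT x:{a..b}|lborel. F x * g x)"
      using si primitive_eq[OF G that] by (simp add: left_diff_distrib set_integral_diff)
    ultimately show ?thesis
      using fub si by (simp add: set_integral_add algebra_simps)
  qed
  then show ?thesis using li by (simp add: primitive_def locally_integrable_add)
qed

text \<open>Integrability of h makes H converge; a nonzero limit would bound |H| below on a
  half-line, whose measure is infinite.\<close>

lemma primitive_tendsto_0_at_top:
  assumes H: "primitive H h" and intH: "integrable lborel H" and inth: "integrable lborel h"
  shows "(H \<longlongrightarrow> 0) at_top"
proof -
  define L where "L = H 0 + (LINT x:{0..}|lborel. h x)"
  have [measurable]: "H \<in> borel_measurable borel" using intH by auto
  have "((\<lambda>b. LINT x:{0..b}|lborel. h x) \<longlongrightarrow> (LINT x:{0..}|lborel. h x)) at_top"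
    by (rule tendsto_set_lebesgue_integral_at_top)
      (use inth integrable_mult_indicator[OF _ inth] in \<open>auto simp: set_integrable_def\<close>)
  then have "((\<lambda>b. H 0 + (LINT x:{0..b}|lborel. h x)) \<longlongrightarrow> L) at_top"
    unfolding L_def by (intro tendsto_intros)
  moreover have "eventually (\<lambda>b. H 0 + (LINT x:{0..b}|lborel. h x) = H b) at_top"
    using eventually_ge_at_top[of 0] by eventually_elim (use primitive_eq[OF H] in \<open>smt (verit)\<close>)
  ultimately have lim: "(H \<longlongrightarrow> L) at_top" by (rule Lim_transform_eventually)
  have "L = 0"
  proof (rule ccontr)
    assume "L \<noteq> 0"
    then have "eventually (\<lambda>x. dist (H x) L < \<bar>L\<bar> / 2) at_top"
      by (intro tendstoD[OF lim]) auto
    then obtain N where N: "\<And>x. x \<ge> N \<Longrightarrow> dist (H x) L < \<bar>L\<bar> / 2"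
      by (auto simp: eventually_at_top_linorder)
    have "integrable lborel (\<lambda>x. indicator {N..} x * (\<bar>L\<bar> / 2))"
    proof (rule Bochner_Integration.integrable_bound[OF intH])
      show "AE x in lborel. norm (indicator {N..} x * (\<bar>L\<bar> / 2)) \<le> norm (H x)"
      proof (rule AE_I2)
        fix x
        show "norm (indicator {N..} x * (\<bar>L\<bar> / 2)) \<le> norm (H x)"
          using N[of x] by (cases "x \<ge> N") (auto simp: dist_real_def abs_if split: if_splits)
      qed
    qed simp
    then have "integrable lborel (\<lambda>x. (indicator {N..} x * (\<bar>L\<bar> / 2)) * (2 / \<bar>L\<bar>))"
      by (rule integrable_mult_left)
    then have "integrable lborel (\<lambda>x. indicator {N..} x :: real)"
      using \<open>L \<noteq> 0\<close> by simp
    then have "emeasure lborel {N..} < \<infinity>"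
      by (simp add: integrable_indicator_iff)
    then obtain r where r: "r \<ge> 0" "emeasure lborel {N..} = ennreal r"
      by (auto simp: less_top_ennreal)
    have "emeasure lborel {N..N + (r + 1)} \<le> emeasure lborel {N..}" by (intro emeasure_mono) auto
    then show False using r by simp
  qed
  then show ?thesis using lim by simp
qed

lemma primitive_reflect:
  assumes H: "primitive H h"
  shows "primitive (\<lambda>x. H (- x)) (\<lambda>x. - h (- x))"
proof -
  note lh = primitive_locally_integrable[OF H]
  have refl: "(\<lambda>x. indicator {a..b} x *\<^sub>R h (- x)) = (\<lambda>x. indicator {- b..- a} (0 + -1 * x) *\<^sub>R h (0 + -1 * x))" for a b
    by (auto simp: fun_eq_iff split: split_indicator)
  have int: "set_integrable lborel {a..b} (\<lambda>x. h (- x))" for a b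
  proof -
    have "integrable lborel (\<lambda>x. indicator {- b..- a} x *\<^sub>R h x)"
      using lh by (simp add: locally_integrable_def set_integrable_def)
    from lborel_integrable_real_affine[OF this, of "-1" 0] show ?thesis
      unfolding set_integrable_def refl by simp
  qed
  have "H (- b) - H (- a) = (LINT x:{a..b}|lborel. - h (- x))" if "a \<le> b" for a b
  proof -
    have "(LINT x:{a..b}|lborel. h (- x)) = (LINT x:{- b..- a}|lborel. h x)"
      unfolding set_lebesgue_integral_def refl
      using lborel_integral_real_affine[of "-1" "\<lambda>x. indicator {- b..- a} x *\<^sub>R h x" 0] by simp
    then show ?thesis using primitive_eq[OF H, of "- b" "- a"] that int[of a b] by (simp add: set_lebesgue_integral_def)
  qed
  moreover have "locally_integrable (\<lambda>x. - h (- x))"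
    using lh int by (auto simp: locally_integrable_def set_integrable_def)
  ultimately show ?thesis by (simp add: primitive_def)
qed

text \<open>This is the vanishing of the boundary terms at both infinities. It applies to products
  of square integrable functions, for which no pointwise decay is given in advance.\<close>

lemma integral_derivative_eq_0:
  assumes H: "primitive H h" and intH: "integrable lborel H" and inth: "integrable lborel h"
  shows "integral\<^sup>L lborel h = 0"
proof -
  have top: "(H \<longlongrightarrow> 0) at_top" by (rule primitive_tendsto_0_at_top[OF assms])
  have "((\<lambda>x. H (- x)) \<longlongrightarrow> 0) at_top"
  proof (rule primitive_tendsto_0_at_top[OF primitive_reflect[OF H]])
    show "integrable lborel (\<lambda>x. H (- x))" "integrable lborel (\<lambda>x. - h (- x))"
      using lborel_integrable_real_affine[OF intH, of "-1" 0] lborel_integrable_real_affine[OF inth, of "-1" 0] by auto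
  qed
  then have "(\<lambda>n. H (real n) - H (- real n)) \<longlonglongrightarrow> 0 - 0"
    using top by (intro tendsto_diff) (auto intro: filterlim_compose filterlim_real_sequentially)
  moreover have "H (real n) - H (- real n) = (LINT x|lborel. indicator {- real n..real n} x *\<^sub>R h x)" for n
    using primitive_eq[OF H, of "- real n" "real n"] by (simp add: set_lebesgue_integral_def)
  moreover have "(\<lambda>n. LINT x|lborel. indicator {- real n..real n} x *\<^sub>R h x) \<longlonglongrightarrow> integral\<^sup>L lborel h"
  proof (rule integral_dominated_convergence[where w = "\<lambda>x. norm (h x)"])
    show "AE x in lborel. (\<lambda>n. indicator {- real n..real n} x *\<^sub>R h x) \<longlonglongrightarrow> h x"
    proof (rule AE_I2)
      fix x
      have "eventually (\<lambda>n. indicator {- real n..real n} x *\<^sub>R h x = h x) sequentially"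
        using eventually_ge_at_top[of "nat \<lceil>\<bar>x\<bar>\<rceil>"]
        by eventually_elim (auto simp: nat_ceiling_le_eq abs_le_iff split: split_indicator)
      then show "(\<lambda>n. indicator {- real n..real n} x *\<^sub>R h x) \<longlonglongrightarrow> h x" by (rule tendsto_eventually)
    qed
  qed (use inth in \<open>auto split: split_indicator\<close>)
  ultimately show ?thesis using LIMSEQ_unique by fastforce
qed

section \<open>Calculus of test functions and the du Bois-Reymond lemma\<close>

lemma test_function_deriv:
  assumes "test_function \<phi>"
  shows "test_function (deriv \<phi>)"
proof -
  obtain r where r: "r > 0" "\<And>x. \<bar>x\<bar> \<ge> r \<Longrightarrow> \<phi> x = 0" using test_function_support[OF assms] by blast
  have "deriv \<phi> x = 0" if "x \<notin> {-r..r}" for x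
  proof -
    have "((\<lambda>x. 0) has_real_derivative 0) (at x)" by simp
    then have "(\<phi> has_real_derivative 0) (at x)"
      by (rule has_field_derivative_transform_within_open[where S = "- {-r..r}"]) (use that r in auto)
    then show ?thesis by (rule DERIV_imp_deriv)
  qed
  then show ?thesis using assms by (intro test_functionI[where a = "-r" and b = r] smooth_on_deriv) (auto simp: test_function_def)
qed

lemma test_function_primitive: "test_function \<phi> \<Longrightarrow> primitive \<phi> (deriv \<phi>)"
  using test_function_continuous[OF test_function_deriv]
  by (intro primitive_C1 smooth_on_has_derivative[of UNIV]) (auto simp: test_function_def)

lemma primitive_weak_derivative:
  assumes F: "primitive F f" and \<phi>: "test_function \<phi>"
  shows "(LINT x|lborel. deriv \<phi> x * F x) = - (LINT x|lborel. \<phi> x * f x)"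
proof -
  have F': "locally_integrable F" by (rule locally_integrable_continuous[OF primitive_continuous[OF F]])
  note int = integrable_test_mult[OF \<phi> F'] integrable_test_mult[OF test_function_deriv[OF \<phi>] F']
    integrable_test_mult[OF \<phi> primitive_locally_integrable[OF F]]
  have "(LINT x|lborel. deriv \<phi> x * F x + \<phi> x * f x) = 0"
    by (rule integral_derivative_eq_0[OF primitive_mult[OF test_function_primitive[OF \<phi>] F]]) (use int in auto)
  then show ?thesis using int by simp
qed

lemma test_function_add: "test_function f \<Longrightarrow> test_function g \<Longrightarrow> test_function (\<lambda>x. f x + g x)"
proof -
  assume f: "test_function f" and g: "test_function g"
  obtain r where r: "r > 0" "\<And>x. \<bar>x\<bar> \<ge> r \<Longrightarrow> f x = 0" using test_function_support[OF f] by blast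
  obtain q where q: "q > 0" "\<And>x. \<bar>x\<bar> \<ge> q \<Longrightarrow> g x = 0" using test_function_support[OF g] by blast
  show "test_function (\<lambda>x. f x + g x)"
  proof (rule test_functionI[where a = "- max r q" and b = "max r q"])
    show "f x + g x = 0" if "x \<notin> {- max r q..max r q}" for x
      using that r(2)[of x] q(2)[of x] by auto
  qed (use f g in \<open>auto simp: test_function_def intro: smooth_on_add\<close>)
qed

lemma test_function_cmult: "test_function f \<Longrightarrow> test_function (\<lambda>x. c * f x)"
proof -
  assume f: "test_function f"
  obtain r where r: "r > 0" "\<And>x. \<bar>x\<bar> \<ge> r \<Longrightarrow> f x = 0" using test_function_support[OF f] by blast
  show ?thesis
    by (rule test_functionI[where a = "- r" and b = r])
      (use f r in \<open>auto simp: test_function_def intro!: smooth_on_mult smooth_on_const\<close>)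
qed

text \<open>The antiderivative that vanishes to the left of the support equals the total integral to
  the right of it, so zero mean is exactly what makes it compactly supported.\<close>

lemma test_function_antiderivative:
  assumes \<xi>: "test_function \<xi>" and zero: "integral\<^sup>L lborel \<xi> = 0"
  obtains \<phi> where "test_function \<phi>" "deriv \<phi> = \<xi>"
proof -
  obtain r where r: "r > 0" "\<And>x. \<bar>x\<bar> \<ge> r \<Longrightarrow> \<xi> x = 0" using test_function_support[OF \<xi>] by blast
  have cont: "continuous_on A \<xi>" for A by (rule test_function_continuous[OF \<xi>])
  note lx = locally_integrable_continuous[OF cont]
  obtain \<Phi> where \<Phi>: "primitive \<Phi> \<xi>" using primitive_exists[OF lx] .
  define \<phi> where "\<phi> x = \<Phi> x - \<Phi> (- r)" for x
  have der: "(\<phi> has_real_derivative \<xi> x) (at x)" for x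
  proof -
    have "((\<lambda>y. integral {x - 1..y} \<xi>) has_real_derivative \<xi> x) (at x within {x - 1..x + 1})"
      by (rule integral_has_real_derivative) (auto intro: cont)
    then have "((\<lambda>y. integral {x - 1..y} \<xi>) has_real_derivative \<xi> x) (at x)"
      by (subst (asm) at_within_interior) auto
    then have "((\<lambda>y. integral {x - 1..y} \<xi> + (\<Phi> (x - 1) - \<Phi> (- r))) has_real_derivative \<xi> x) (at x)"
      by (auto intro!: derivative_eq_intros)
    then show ?thesis
    proof (rule has_field_derivative_transform_within_open[where S = "{x - 1<..}"])
      show "integral {x - 1..y} \<xi> + (\<Phi> (x - 1) - \<Phi> (- r)) = \<phi> y" if "y \<in> {x - 1<..}" for y
        using primitive_eq[OF \<Phi>, of "x - 1" y] locally_integrable_HK(2)[OF lx, of "x - 1" y] that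
        by (simp add: \<phi>_def)
    qed auto
  qed
  have zero_int: "(LINT x:{a..b}|lborel. \<xi> x) = 0" if "\<And>x. x \<in> {a..b} \<Longrightarrow> \<xi> x = 0" for a b
    using that by (simp add: set_lebesgue_integral_def indicator_def if_distrib cong: if_cong) (auto intro!: integral_eq_zero_AE)
  have "\<phi> x = 0" if "x \<notin> {-r..r}" for x
  proof (cases "x < - r")
    case True
    then show ?thesis using primitive_eq[OF \<Phi>, of x "- r"] zero_int[of x "- r"] r by (auto simp: \<phi>_def)
  next
    case False
    then have "x > r" using that by auto
    then have "\<Phi> x - \<Phi> r = 0" using primitive_eq[OF \<Phi>, of r x] zero_int[of r x] r by simp
    moreover have "\<Phi> r - \<Phi> (- r) = 0"
      using primitive_eq[OF \<Phi>, of "- r" r] r(1) integrable_compact_support(2)[OF lx r(2)] zero by simp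
    ultimately show ?thesis by (simp add: \<phi>_def)
  qed
  moreover have "smooth_on UNIV \<phi>"
    using der \<xi> by (auto simp: test_function_def intro: smooth_if_has_derivative_smooth[of \<phi> \<xi>])
  ultimately have "test_function \<phi>" by (intro test_functionI[of \<phi> "- r" r]) assumption
  moreover have "deriv \<phi> = \<xi>" using der by (auto intro: DERIV_imp_deriv)
  ultimately show ?thesis by (rule that)
qed

text \<open>With G a primitive of g, w = f - G has weak derivative 0. Subtracting from a test
  function the multiple of a fixed bump \<rho> with the same integral leaves the derivative of a
  test function, which w annihilates. Hence w acts on test functions as the constant c, its mean
  weighted by \<rho>.\<close>

lemma du_Bois_Reymond:
  assumes f: "locally_integrable f" and g: "locally_integrable g"
    and weak: "\<And>\<phi>. test_function \<phi> \<Longrightarrow> (LINT x|lborel. deriv \<phi> x * f x) = - (LINT x|lborel. \<phi> x * g x)"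
  obtains F where "primitive F g" "AE x in lborel. f x = F x"
proof -
  obtain G where G: "primitive G g" using primitive_exists[OF g] .
  have lG: "locally_integrable G" by (rule locally_integrable_continuous[OF primitive_continuous[OF G]])
  define w where "w x = f x - G x" for x
  have lw: "locally_integrable w" unfolding w_def by (rule locally_integrable_diff[OF f lG])
  have w0: "(LINT x|lborel. deriv \<phi> x * w x) = 0" if "test_function \<phi>" for \<phi>
    using weak[OF that] primitive_weak_derivative[OF G that]
      integrable_test_mult[OF test_function_deriv[OF that] f] integrable_test_mult[OF test_function_deriv[OF that] lG]
    by (simp add: w_def right_diff_distrib)
  define \<rho> where "\<rho> = bump 1 0 1"
  have \<rho>: "test_function \<rho>" unfolding \<rho>_def by (rule test_function_bump) simp
  have int_test: "integrable lborel \<psi>" if "test_function \<psi>" for \<psi>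
    using integrable_test_mult[OF that locally_integrable_const[of 1]] by simp
  have I: "integral\<^sup>L lborel \<rho> \<noteq> 0"
  proof
    assume "integral\<^sup>L lborel \<rho> = 0"
    then have "AE x in lborel. \<rho> x = 0"
      using integral_nonneg_eq_0_iff_AE[OF int_test[OF \<rho>]] by (simp add: \<rho>_def bump_nonneg)
    then have "AE x in lborel. x \<notin> {0<..<1::real}"
      by eventually_elim (use bump_pos[of 1 0 _ 1] in \<open>force simp: \<rho>_def\<close>)
    then have "emeasure lborel {0<..<1::real} = 0"
      by (subst (asm) AE_iff_measurable[of "{0<..<1}"]) auto
    then show False by simp
  qed
  define c where "c = (LINT x|lborel. \<rho> x * w x) / integral\<^sup>L lborel \<rho>"
  have "AE x in lborel. w x - c = 0"
  proof (rule AE_zero_if_test_integrals_zero)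
    show "locally_integrable (\<lambda>x. w x - c)"
      by (rule locally_integrable_diff[OF lw locally_integrable_const])
    fix \<psi> assume \<psi>: "test_function \<psi>"
    define d where "d = integral\<^sup>L lborel \<psi> / integral\<^sup>L lborel \<rho>"
    define \<xi> where "\<xi> x = \<psi> x + (- d) * \<rho> x" for x
    have \<xi>: "test_function \<xi>"
      unfolding \<xi>_def by (rule test_function_add[OF \<psi> test_function_cmult[OF \<rho>]])
    have "integral\<^sup>L lborel \<xi> = 0"
      using int_test[OF \<psi>] int_test[OF \<rho>] I by (simp add: \<xi>_def[abs_def] d_def)
    then obtain \<phi> where "test_function \<phi>" "deriv \<phi> = \<xi>" using test_function_antiderivative[OF \<xi>] by blast
    then have "(LINT x|lborel. \<xi> x * w x) = 0" using w0 by blast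
    moreover have "(LINT x|lborel. \<xi> x * w x) = (LINT x|lborel. \<psi> x * w x) - d * (LINT x|lborel. \<rho> x * w x)"
      using integrable_test_mult[OF \<psi> lw] integrable_test_mult[OF \<rho> lw]
      by (simp add: \<xi>_def left_diff_distrib mult.assoc)
    ultimately have "(LINT x|lborel. \<psi> x * w x) = integral\<^sup>L lborel \<psi> * c"
      by (simp add: d_def c_def)
    then show "(LINT x|lborel. \<psi> x * (w x - c)) = 0"
      using integrable_test_mult[OF \<psi> lw] int_test[OF \<psi>] by (simp add: right_diff_distrib)
  qed
  then have "AE x in lborel. f x = G x + c" by eventually_elim (simp add: w_def)
  moreover have "primitive (\<lambda>x. G x + c) g" using G by (simp add: primitive_def)
  ultimately show ?thesis using that by blast
qed

section \<open>Weak derivatives on the line\<close>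

text \<open>The relation \<open>has_weak_deriv\<close> transferred from classes to functions, so
  that the analysis below can work with representatives.\<close>

definition weakly_differentiable :: "(real \<Rightarrow> complex) \<Rightarrow> (real \<Rightarrow> complex) \<Rightarrow> bool" where
  "weakly_differentiable f g \<longleftrightarrow> square_integrable f \<and> square_integrable g \<and>
     (\<forall>\<phi>. test_function \<phi> \<longrightarrow>
       (LINT x|lborel. deriv \<phi> x *\<^sub>R f x) = - (LINT x|lborel. \<phi> x *\<^sub>R g x))"

lemma weakly_differentiable_square_integrable:
  "weakly_differentiable f g \<Longrightarrow> square_integrable f" "weakly_differentiable f g \<Longrightarrow> square_integrable g"
  by (simp_all add: weakly_differentiable_def)

lemma square_integrable_measurable: "square_integrable f \<Longrightarrow> f \<in> borel_measurable borel"
  by (simp add: square_integrable_def)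

text \<open>On a bounded interval |f| is dominated by 1 + |f|^2.\<close>

lemma square_integrable_locally_integrable:
  assumes "square_integrable f"
  shows "locally_integrable (\<lambda>x. Re (f x))" "locally_integrable (\<lambda>x. Im (f x))"
proof -
  have [measurable]: "f \<in> borel_measurable borel" using assms by (rule square_integrable_measurable)
  have *: "set_integrable lborel {a..b} g"
    if [measurable]: "g \<in> borel_measurable borel" and le: "\<And>x. \<bar>g x\<bar> \<le> norm (f x)" for a b and g :: "real \<Rightarrow> real"
    unfolding set_integrable_def
  proof (rule Bochner_Integration.integrable_bound)
    show "integrable lborel (\<lambda>x. indicator {a..b} x + (norm (f x))\<^sup>2 :: real)"
      using assms emeasure_compact_finite[of "{a..b}"]
      by (intro Bochner_Integration.integrable_add integrable_real_indicator) (auto simp: square_integrable_def)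
    show "AE x in lborel. norm (indicator {a..b} x *\<^sub>R g x) \<le> norm (indicator {a..b} x + (norm (f x))\<^sup>2)"
    proof (rule AE_I2)
      fix x
      have "\<bar>g x\<bar> \<le> 1 + (norm (f x))\<^sup>2"
        using le[of x] sum_squares_bound[of "norm (f x)" 1] norm_ge_zero[of "f x"]
        unfolding mult_1_right power_one by linarith
      then show "norm (indicator {a..b} x *\<^sub>R g x) \<le> norm (indicator {a..b} x + (norm (f x))\<^sup>2)"
        by (auto split: split_indicator)
    qed
  qed measurable
  show "locally_integrable (\<lambda>x. Re (f x))" "locally_integrable (\<lambda>x. Im (f x))"
    using abs_Re_le_cmod abs_Im_le_cmod by (auto simp: locally_integrable_def intro!: *)
qed

lemma integrable_test_scaleR:
  assumes "test_function \<phi>" "square_integrable f"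
  shows "integrable lborel (\<lambda>x. \<phi> x *\<^sub>R f x)"
proof -
  have "integrable lborel (\<lambda>x. complex_of_real (\<phi> x * Re (f x)) + \<i> * complex_of_real (\<phi> x * Im (f x)))"
    using assms square_integrable_locally_integrable[OF assms(2)]
    by (intro Bochner_Integration.integrable_add integrable_mult_right integrable_of_real integrable_test_mult)
  moreover have "(\<lambda>x. complex_of_real (\<phi> x * Re (f x)) + \<i> * complex_of_real (\<phi> x * Im (f x))) = (\<lambda>x. \<phi> x *\<^sub>R f x)"
    by (auto simp: fun_eq_iff complex_eq_iff)
  ultimately show ?thesis by simp
qed

lemma primitive_add:
  assumes "primitive F f" "primitive G g"
  shows "primitive (\<lambda>x. F x + G x) (\<lambda>x. f x + g x)"
proof -
  have "(LINT x:{a..b}|lborel. f x + g x) = (LINT x:{a..b}|lborel. f x) + (LINT x:{a..b}|lborel. g x)" for a b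
    using assms by (intro set_integral_add) (auto simp: primitive_def locally_integrable_def)
  then show ?thesis
    using assms by (simp add: primitive_def locally_integrable_add add_diff_add)
qed

lemma weakly_differentiable_primitives:
  assumes "weakly_differentiable f g"
  obtains P Q where "primitive P (\<lambda>x. Re (g x))" "primitive Q (\<lambda>x. Im (g x))"
    "AE x in lborel. f x = Complex (P x) (Q x)"
proof -
  have f: "square_integrable f" and g: "square_integrable g"
    and weak: "\<And>\<phi>. test_function \<phi> \<Longrightarrow> (LINT x|lborel. deriv \<phi> x *\<^sub>R f x) = - (LINT x|lborel. \<phi> x *\<^sub>R g x)"
    using assms by (auto simp: weakly_differentiable_def)
  note lf = square_integrable_locally_integrable[OF f] and lg = square_integrable_locally_integrable[OF g]
  have Re: "(LINT x|lborel. deriv \<phi> x * Re (f x)) = - (LINT x|lborel. \<phi> x * Re (g x))"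
    and Im: "(LINT x|lborel. deriv \<phi> x * Im (f x)) = - (LINT x|lborel. \<phi> x * Im (g x))"
    if "test_function \<phi>" for \<phi>
    using arg_cong[OF weak[OF that], of Re] arg_cong[OF weak[OF that], of Im]
      integrable_test_scaleR[OF that g] integrable_test_scaleR[OF test_function_deriv[OF that] f]
    by (simp_all flip: integral_Re integral_Im)
  obtain P where P: "primitive P (\<lambda>x. Re (g x))" "AE x in lborel. Re (f x) = P x"
    using du_Bois_Reymond[OF lf(1) lg(1) Re] by blast
  obtain Q where Q: "primitive Q (\<lambda>x. Im (g x))" "AE x in lborel. Im (f x) = Q x"
    using du_Bois_Reymond[OF lf(2) lg(2) Im] by blast
  from P(2) Q(2) have "AE x in lborel. f x = Complex (P x) (Q x)"
    by eventually_elim (simp add: complex_eq_iff)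
  then show ?thesis using that P(1) Q(1) by blast
qed

lemma integrable_weighted_inner:
  fixes w :: "real \<Rightarrow> real"
  assumes "square_integrable f" "square_integrable g"
    and "continuous_on UNIV w" and bound: "\<And>x. \<bar>w x\<bar> \<le> B"
  shows "integrable lborel (\<lambda>x. w x * inner (f x) (g x))"
proof -
  have [measurable]: "f \<in> borel_measurable borel" "g \<in> borel_measurable borel" "w \<in> borel_measurable borel"
    using assms by (auto intro: square_integrable_measurable borel_measurable_continuous_onI)
  have "integrable lborel (\<lambda>x. B * inner (f x) (g x))"
    using square_integrable_inner[OF assms(1,2)] by simp
  then show ?thesis
  proof (rule Bochner_Integration.integrable_bound)
    show "AE x in lborel. norm (w x * inner (f x) (g x)) \<le> norm (B * inner (f x) (g x))"
    proof (rule AE_I2)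
      fix x
      have "\<bar>w x\<bar> \<le> \<bar>B\<bar>" using bound[of x] by linarith
      then show "norm (w x * inner (f x) (g x)) \<le> norm (B * inner (f x) (g x))"
        by (simp add: abs_mult mult_right_mono)
    qed
  qed measurable
qed

text \<open>The integrand is the derivative of w <f, g>. The real inner product is the sum of the
  products of real and of imaginary parts, and each part has an absolutely continuous
  representative, so the product rule for primitives applies. Bounded w and w' keep both the product
  and its derivative integrable.\<close>

lemma weak_integration_by_parts:
  assumes f: "weakly_differentiable f f'" and g: "weakly_differentiable g g'"
    and w: "\<And>x. (w has_real_derivative w' x) (at x)" "continuous_on UNIV w'"
    and bound: "\<And>x. \<bar>w x\<bar> \<le> B" "\<And>x. \<bar>w' x\<bar> \<le> B'"
  shows "has_bochner_integral lborel
    (\<lambda>x. w' x * inner (f x) (g x) + (w x * inner (f' x) (g x) + w x * inner (f x) (g' x))) 0"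
proof -
  note sq = weakly_differentiable_square_integrable[OF f] weakly_differentiable_square_integrable[OF g]
  have [measurable]: "f \<in> borel_measurable borel" "g \<in> borel_measurable borel"
    "f' \<in> borel_measurable borel" "g' \<in> borel_measurable borel"
    using sq by (auto intro: square_integrable_measurable)
  have cw: "continuous_on UNIV w" using w(1) by (auto intro: DERIV_continuous_on has_field_derivative_at_within)
  then have [measurable]: "w \<in> borel_measurable borel" "w' \<in> borel_measurable borel"
    using w(2) by (auto intro: borel_measurable_continuous_onI)
  obtain P Q where PQ: "primitive P (\<lambda>x. Re (f' x))" "primitive Q (\<lambda>x. Im (f' x))"
    "AE x in lborel. f x = Complex (P x) (Q x)" using weakly_differentiable_primitives[OF f] .
  obtain R S where RS: "primitive R (\<lambda>x. Re (g' x))" "primitive S (\<lambda>x. Im (g' x))"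
    "AE x in lborel. g x = Complex (R x) (S x)" using weakly_differentiable_primitives[OF g] .
  have [measurable]: "P \<in> borel_measurable borel" "Q \<in> borel_measurable borel"
    "R \<in> borel_measurable borel" "S \<in> borel_measurable borel"
    using PQ RS by (auto intro: borel_measurable_continuous_onI primitive_continuous)
  let ?h1 = "\<lambda>x. w' x * (P x * R x) + w x * (Re (f' x) * R x + P x * Re (g' x))"
  let ?h2 = "\<lambda>x. w' x * (Q x * S x) + w x * (Im (f' x) * S x + Q x * Im (g' x))"
  note H1 = primitive_mult[OF primitive_C1[OF w] primitive_mult[OF PQ(1) RS(1)]]
  note H2 = primitive_mult[OF primitive_C1[OF w] primitive_mult[OF PQ(2) RS(2)]]
  let ?H = "\<lambda>x. w x * (P x * R x) + w x * (Q x * S x)"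
  have H: "primitive ?H (\<lambda>x. ?h1 x + ?h2 x)"
    by (rule primitive_add[OF H1 H2])
  note int = integrable_weighted_inner[OF sq(1,3) cw bound(1)] integrable_weighted_inner[OF sq(2,3) cw bound(1)]
    integrable_weighted_inner[OF sq(1,4) cw bound(1)] integrable_weighted_inner[OF sq(1,3) w(2) bound(2)]
  have intH: "integrable lborel ?H"
    by (rule integrable_cong_AE_imp[OF int(1)])
      (measurable, use PQ(3) RS(3) in \<open>eventually_elim, simp add: inner_complex_def algebra_simps\<close>)
  let ?h = "\<lambda>x. w' x * inner (f x) (g x) + (w x * inner (f' x) (g x) + w x * inner (f x) (g' x))"
  have AE_h: "AE x in lborel. ?h1 x + ?h2 x = ?h x"
    using PQ(3) RS(3) by eventually_elim (simp add: inner_complex_def algebra_simps)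
  have inth: "integrable lborel ?h" using int by auto
  then have "integrable lborel (\<lambda>x. ?h1 x + ?h2 x)"
    by (rule integrable_cong_AE_imp) (measurable, use AE_h in \<open>eventually_elim, simp\<close>)
  from integral_derivative_eq_0[OF H intH this] have "integral\<^sup>L lborel ?h = 0"
    using integral_cong_AE[OF _ _ AE_h] by (simp add: borel_measurable_integrable[OF inth])
  then show ?thesis using inth by (simp add: has_bochner_integral_iff)
qed

lemma weakly_differentiable_unique:
  assumes "weakly_differentiable f g" "weakly_differentiable f h"
  shows "AE x in lborel. g x = h x"
proof -
  have g: "square_integrable g" and h: "square_integrable h" using assms by (auto simp: weakly_differentiable_def)
  note lg = square_integrable_locally_integrable[OF g] and lh = square_integrable_locally_integrable[OF h]
  have eq: "(LINT x|lborel. \<phi> x *\<^sub>R g x) = (LINT x|lborel. \<phi> x *\<^sub>R h x)" if "test_function \<phi>" for \<phi>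
    using assms that by (auto simp: weakly_differentiable_def)
  have "AE x in lborel. Re (g x) - Re (h x) = 0"
  proof (rule AE_zero_if_test_integrals_zero[OF locally_integrable_diff[OF lg(1) lh(1)]])
    fix \<phi> assume \<phi>: "test_function \<phi>"
    show "(LINT x|lborel. \<phi> x * (Re (g x) - Re (h x))) = 0"
      using arg_cong[OF eq[OF \<phi>], of Re] integrable_test_scaleR[OF \<phi> g] integrable_test_scaleR[OF \<phi> h]
        integrable_test_mult[OF \<phi> lg(1)] integrable_test_mult[OF \<phi> lh(1)]
      by (simp add: right_diff_distrib flip: integral_Re)
  qed
  moreover have "AE x in lborel. Im (g x) - Im (h x) = 0"
  proof (rule AE_zero_if_test_integrals_zero[OF locally_integrable_diff[OF lg(2) lh(2)]])
    fix \<phi> assume \<phi>: "test_function \<phi>"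
    show "(LINT x|lborel. \<phi> x * (Im (g x) - Im (h x))) = 0"
      using arg_cong[OF eq[OF \<phi>], of Im] integrable_test_scaleR[OF \<phi> g] integrable_test_scaleR[OF \<phi> h]
        integrable_test_mult[OF \<phi> lg(2)] integrable_test_mult[OF \<phi> lh(2)]
      by (simp add: right_diff_distrib flip: integral_Im)
  qed
  ultimately show ?thesis by eventually_elim (simp add: complex_eq_iff)
qed

text \<open>A function with zero derivative is constant, and the only integrable constant |f|^2 on
  the line is 0. The energy estimate only yields v' = 0; this recovers v = 0.\<close>

lemma weakly_differentiable_zero:
  assumes f: "weakly_differentiable f g" and zero: "AE x in lborel. g x = 0"
  shows "AE x in lborel. f x = 0"
proof -
  note sq = weakly_differentiable_square_integrable[OF f]
  obtain P Q where PQ: "primitive P (\<lambda>x. Re (g x))" "primitive Q (\<lambda>x. Im (g x))"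
    "AE x in lborel. f x = Complex (P x) (Q x)" using weakly_differentiable_primitives[OF f] .
  have mP: "P \<in> borel_measurable borel" and mQ: "Q \<in> borel_measurable borel"
    using PQ by (auto intro: borel_measurable_continuous_onI primitive_continuous)
  have mg: "g \<in> borel_measurable borel" using sq by (auto intro: square_integrable_measurable)
  have zero_prim: "primitive F (\<lambda>x. 0)" if "primitive F h" "AE x in lborel. h x = 0" for F h
  proof -
    have [measurable]: "h \<in> borel_measurable borel"
      using primitive_locally_integrable[OF that(1)] by (simp add: locally_integrable_def)
    have "(LINT x:{a..b}|lborel. h x) = (LINT x:{a..b}|lborel. 0)" for a b
      unfolding set_lebesgue_integral_def
      by (rule integral_cong_AE) (measurable, use that(2) in \<open>eventually_elim, simp\<close>)
    then show ?thesis using that(1) locally_integrable_const[of 0] by (simp add: primitive_def set_lebesgue_integral_def)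
  qed
  have P: "primitive P (\<lambda>x. 0)" and Q: "primitive Q (\<lambda>x. 0)"
    using zero by (auto intro!: zero_prim[OF PQ(1)] zero_prim[OF PQ(2)] elim: eventually_mono)
  have H: "primitive (\<lambda>x. P x * P x + Q x * Q x) (\<lambda>x. 0)"
    using primitive_mult[OF P P] primitive_mult[OF Q Q] by (simp add: primitive_def set_lebesgue_integral_def)
  have "integrable lborel (\<lambda>x. P x * P x + Q x * Q x)"
  proof (rule integrable_cong_AE_imp[OF square_integrable_inner[OF sq(1) sq(1)]])
    show "(\<lambda>x. P x * P x + Q x * Q x) \<in> borel_measurable lborel" using mP mQ by measurable
    show "AE x in lborel. inner (f x) (f x) = P x * P x + Q x * Q x"
      using PQ(3) by eventually_elim (simp add: inner_complex_def)
  qed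
  then have lim: "((\<lambda>x. P x * P x + Q x * Q x) \<longlongrightarrow> 0) at_top"
    by (rule primitive_tendsto_0_at_top[OF H]) simp
  have const: "P x * P x + Q x * Q x = P 0 * P 0 + Q 0 * Q 0" for x
    using primitive_eq[OF H, of 0 x] primitive_eq[OF H, of x 0] by (cases "x \<le> 0") (auto simp: set_lebesgue_integral_def)
  have "P 0 * P 0 + Q 0 * Q 0 = 0"
  proof -
    have "(\<lambda>x. P x * P x + Q x * Q x) = (\<lambda>x. P 0 * P 0 + Q 0 * Q 0)" by (rule ext) (rule const)
    with lim show ?thesis by (simp add: tendsto_const_iff)
  qed
  then have "P x = 0 \<and> Q x = 0" for x
    using const[of x] by (simp add: sum_squares_eq_zero_iff)
  then show ?thesis using PQ(3) by (simp add: complex_eq_iff)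
qed

lemma weakly_differentiable_cmult:
  assumes "weakly_differentiable f g"
  shows "weakly_differentiable (\<lambda>x. c * f x) (\<lambda>x. c * g x)"
proof -
  have "(LINT x|lborel. \<phi> x *\<^sub>R (c * h x)) = c * (LINT x|lborel. \<phi> x *\<^sub>R h x)" for \<phi> :: "real \<Rightarrow> real" and h
    by (simp flip: integral_mult_right_zero)
  then show ?thesis using assms by (auto simp: weakly_differentiable_def square_integrable_mult)
qed

section \<open>Representatives of classes in L^2 and of Sobolev functions\<close>

lemma l2_rel_rep: "l2_rel (rep_l2 f) (rep_l2 f)"
  by (rule Quotient3_rep_reflp[OF Quotient3_l2])

lemma square_integrable_rep: "square_integrable (rep_l2 f)"
  using l2_rel_rep by (simp add: l2_rel_def)

lemma l2_eq_iff: "f = g \<longleftrightarrow> (AE x in lborel. rep_l2 f x = rep_l2 g x)"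
  using Quotient3_rel_rep[OF Quotient3_l2, of f g] by (simp add: l2_rel_def square_integrable_rep)

lemma rep_abs_l2: "square_integrable f \<Longrightarrow> AE x in lborel. rep_l2 (abs_l2 f) x = f x"
  using Quotient3_rep_abs[OF Quotient3_l2, of f] by (simp add: l2_rel_def)

text \<open>Representatives are chosen class by class, so they respect the vector space operations
  only almost everywhere.\<close>

lemma rep_l2_add: "AE x in lborel. rep_l2 (f + g) x = rep_l2 f x + rep_l2 g x"
  and rep_l2_scaleR: "AE x in lborel. rep_l2 (r *\<^sub>R f) x = complex_of_real r * rep_l2 f x"
  and rep_l2_scaleC: "AE x in lborel. rep_l2 (c *\<^sub>C f) x = c * rep_l2 f x"
  and rep_l2_zero: "AE x in lborel. rep_l2 0 x = 0"
  unfolding plus_l2_def scaleR_l2_def scaleC_l2_def zero_l2_def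
  by (auto intro!: rep_abs_l2 square_integrable_add square_integrable_mult square_integrable_rep square_integrable_0)

lemma has_weak_deriv_iff: "has_weak_deriv f g \<longleftrightarrow> weakly_differentiable (rep_l2 f) (rep_l2 g)"
  by (simp add: has_weak_deriv_def weakly_differentiable_def square_integrable_rep)

lemma weak_deriv_eq: "has_weak_deriv f g \<Longrightarrow> weak_deriv f = g"
  unfolding weak_deriv_def using weakly_differentiable_unique
  by (intro some_equality) (auto simp: has_weak_deriv_iff l2_eq_iff)

lemma sobolev_SucD:
  assumes "f \<in> sobolev (Suc m)"
  shows "weakly_differentiable (rep_l2 f) (rep_l2 (weak_deriv f))" "weak_deriv f \<in> sobolev m"
  using assms weak_deriv_eq by (auto simp flip: has_weak_deriv_iff)

section \<open>The energy identity\<close>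

lemma inner_mult_self: "inner (z * a) (a :: complex) = Re z * inner a a"
  by (simp add: inner_complex_def algebra_simps)

lemma abs_mult_bound: "\<bar>a\<bar> \<le> B \<Longrightarrow> \<bar>b\<bar> \<le> C \<Longrightarrow> \<bar>a * b\<bar> \<le> B * (C::real)"
  by (simp add: abs_mult mult_mono')

text \<open>In the application a is the weightable part of the coefficient of v', c the zeroth-order
  capillary remainder, b the diffusion and k the capillarity. In \<open>form\<close> the variables
  \<alpha>, \<beta>, \<gamma> stand for u, u', v'. The lower bound r is a function since it
  degenerates together with V'.\<close>

lemma energy_estimate:
  fixes v v1 v2 v3 u u1 u2 :: "real \<Rightarrow> complex" and z :: complex and s B :: real
    and a b c k w b' k' w' w'' r :: "real \<Rightarrow> real"
  assumes v: "weakly_differentiable v v1" "weakly_differentiable v1 v2" "weakly_differentiable v2 v3"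
    and u: "weakly_differentiable u u1" "weakly_differentiable u1 u2"
    and eq1: "AE x in lborel. z * v x = s *\<^sub>R v1 x + u1 x"
    and eq2: "AE x in lborel. z * u x = s *\<^sub>R u1 x + (a x - c x) *\<^sub>R v1 x + b x *\<^sub>R u2 x
      - k x *\<^sub>R v3 x - k' x *\<^sub>R v2 x"
    and wa: "\<And>x. w x * a x = 1"
    and w: "\<And>x. (w has_real_derivative w' x) (at x)" "\<And>x. (w' has_real_derivative w'' x) (at x)"
      "continuous_on UNIV w''"
    and b: "\<And>x. (b has_real_derivative b' x) (at x)" "continuous_on UNIV b'"
    and k: "\<And>x. (k has_real_derivative k' x) (at x)" "continuous_on UNIV k'"
    and bound: "\<And>x. \<bar>w x\<bar> \<le> B" "\<And>x. \<bar>w' x\<bar> \<le> B" "\<And>x. \<bar>w'' x\<bar> \<le> B"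
      "\<And>x. \<bar>b x\<bar> \<le> B" "\<And>x. \<bar>b' x\<bar> \<le> B" "\<And>x. \<bar>k x\<bar> \<le> B" "\<And>x. \<bar>k' x\<bar> \<le> B"
    and pos: "\<And>x. w x > 0" "\<And>x. k x > 0" "\<And>x. r x > 0" "Re z \<ge> 0"
    and form: "\<And>x (\<alpha>::complex) \<beta> \<gamma>.
      r x * (inner \<alpha> \<alpha> + inner \<gamma> \<gamma>) \<le>
        s / 2 * w' x * inner \<alpha> \<alpha> + w x * b x * inner \<beta> \<beta> + s / 2 * (w' x * k x + w x * k' x) * inner \<gamma> \<gamma>
        + (w' x * b x + w x * b' x) * inner \<beta> \<alpha> + (2 * w' x * k x + w x * k' x) * inner \<gamma> \<beta>
        + (w'' x * k x + w' x * k' x + w x * c x) * inner \<gamma> \<alpha>"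
  shows "(AE x in lborel. v x = 0) \<and> (AE x in lborel. u x = 0)"
proof -
  have cont: "continuous_on UNIV w" "continuous_on UNIV w'" "continuous_on UNIV b" "continuous_on UNIV k"
    using w b k by (blast intro: continuous_at_imp_continuous_on DERIV_isCont)+
  define D where "D W W' f f' g g' x = W' x * inner (f x) (g x) + (W x * inner (f' x) (g x) + W x * inner (f x) (g' x))"
    for W W' :: "real \<Rightarrow> real" and f f' g g' :: "real \<Rightarrow> complex" and x
  have D: "has_bochner_integral lborel (D W W' f f' g g') 0"
    if "weakly_differentiable f f'" "weakly_differentiable g g'"
      "\<And>x. (W has_real_derivative W' x) (at x)" "continuous_on UNIV W'"
      "\<And>x. \<bar>W x\<bar> \<le> C" "\<And>x. \<bar>W' x\<bar> \<le> C'" for f f' g g' W W' C C'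
    unfolding D_def[abs_def] by (rule weak_integration_by_parts[OF that])
  define wb where "wb x = w x * b x" for x
  define wb' where "wb' x = w' x * b x + w x * b' x" for x
  define wk where "wk x = w x * k x" for x
  define wk' where "wk' x = w' x * k x + w x * k' x" for x
  define w'k where "w'k x = w' x * k x" for x
  define w'k' where "w'k' x = w'' x * k x + w' x * k' x" for x
  have der: "(wb has_real_derivative wb' x) (at x)" "(wk has_real_derivative wk' x) (at x)"
    "(w'k has_real_derivative w'k' x) (at x)" for x
    unfolding wb_def[abs_def] wb'_def wk_def[abs_def] wk'_def w'k_def[abs_def] w'k'_def
    using w b k by (auto intro!: derivative_eq_intros)
  have contd: "continuous_on UNIV wb'" "continuous_on UNIV wk'" "continuous_on UNIV w'k'"
    unfolding wb'_def[abs_def] wk'_def[abs_def] w'k'_def[abs_def]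
    using cont w b k by (auto intro!: continuous_intros)
  have bd: "\<bar>wb x\<bar> \<le> B * B" "\<bar>wk x\<bar> \<le> B * B" "\<bar>w'k x\<bar> \<le> B * B" for x
    unfolding wb_def wk_def w'k_def by (intro abs_mult_bound bound)+
  have bd': "\<bar>wb' x\<bar> \<le> B * B + B * B" "\<bar>wk' x\<bar> \<le> B * B + B * B" "\<bar>w'k' x\<bar> \<le> B * B + B * B" for x
    unfolding wb'_def wk'_def w'k'_def
    by (intro order.trans[OF abs_triangle_ineq] add_mono abs_mult_bound bound)+
  let ?zv = "\<lambda>x. z * v x" and ?zv1 = "\<lambda>x. z * v1 x"
  note zv = weakly_differentiable_cmult[OF v(1), of z]
  have one: "((\<lambda>x. 1) has_real_derivative 0) (at x)" for x :: real by simp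
  have contw: "continuous_on UNIV w'" by (rule cont)
  note D1 = D[OF u(1) u(1) w(1) contw bound(1,2)]
  note D2 = D[OF v(1) u(1) one, of 1 0]
  note D3 = D[OF v(1) v(1) one, of 1 0]
  note D4 = D[OF u(2) u(1) der(1) contd(1) bd(1) bd'(1)]
  \<comment> \<open>Moving one derivative off v''' leaves two products with v''. The first, (wk)'
    <v'', u>, exceeds the term wk' <v'', u> of the equation by w'k <v'', u>, which \<open>D6\<close>
    integrates once more. The second, wk <v'', u'>, is treated by u' = z v - s v': \<open>D7\<close>
    handles the part with z v and produces Re z wk |v'|^2, and \<open>D8\<close> handles <v'', v'>.
    No v'' survives.\<close>
  note D5 = D[OF v(3) u(1) der(2) contd(2) bd(2) bd'(2)]
  note D6 = D[OF v(2) u(1) der(3) contd(3) bd(3) bd'(3)]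
  note D7 = D[OF v(2) zv der(2) contd(2) bd(2) bd'(2)]
  note D8 = D[OF v(2) v(2) der(2) contd(2) bd(2) bd'(2)]
  \<comment> \<open>The combination of derivatives of products that equals the energy density \<open>N + Q\<close> by the
    eigenvalue equations.\<close>
  define S where "S x = s / 2 * D w w' u u1 u u1 x + D (\<lambda>x. 1) (\<lambda>x. 0) v v1 u u1 x
    + s / 2 * D (\<lambda>x. 1) (\<lambda>x. 0) v v1 v v1 x + D wb wb' u1 u2 u u1 x - D wk wk' v2 v3 u u1 x
    + D w'k w'k' v1 v2 u u1 x + D wk wk' v1 v2 ?zv ?zv1 x - s / 2 * D wk wk' v1 v2 v1 v2 x" for x
  have S: "has_bochner_integral lborel S (s / 2 * 0 + 0 + s / 2 * 0 + 0 - 0 + 0 + 0 - s / 2 * 0)"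
    unfolding S_def[abs_def]
    by (intro has_bochner_integral_add has_bochner_integral_diff has_bochner_integral_mult_right
        D1 D2 D3 D4 D5 D6 D7 D8) auto
  define N where "N x = Re z * (w x * inner (u x) (u x) + inner (v x) (v x) + wk x * inner (v1 x) (v1 x))" for x
  define Q where "Q x = s / 2 * w' x * inner (u x) (u x) + wb x * inner (u1 x) (u1 x)
      + s / 2 * wk' x * inner (v1 x) (v1 x) + wb' x * inner (u1 x) (u x)
      + (wk' x + w'k x) * inner (v1 x) (u1 x) + (w'k' x + w x * c x) * inner (v1 x) (u x)" for x
  have "AE x in lborel. S x = N x + Q x"
    using eq1 eq2
  proof eventually_elim
    case (elim x)
    have e1: "w x * (Re z * inner (u x) (u x)) = w x * (s * inner (u1 x) (u x)
        + (a x - c x) * inner (v1 x) (u x) + b x * inner (u2 x) (u x) - k x * inner (v3 x) (u x) - k' x * inner (v2 x) (u x))"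
      using arg_cong[OF elim(2), of "\<lambda>y. inner y (u x)"]
      by (simp add: inner_mult_self inner_add_left inner_diff_left)
    have e2: "Re z * inner (v x) (v x) = s * inner (v1 x) (v x) + inner (v x) (u1 x)"
      using arg_cong[OF elim(1), of "\<lambda>y. inner y (v x)"]
      by (simp add: inner_mult_self inner_add_left inner_commute[of "v x" "u1 x"])
    have e3: "inner (v1 x) (z * v x) = s * inner (v1 x) (v1 x) + inner (v1 x) (u1 x)"
      and e4: "inner (v2 x) (z * v x) = s * inner (v1 x) (v2 x) + inner (v2 x) (u1 x)"
      unfolding elim(1) by (simp_all add: inner_add_right inner_commute)
    have e5: "inner (v1 x) (z * v1 x) = Re z * inner (v1 x) (v1 x)"
      using inner_mult_self[of z "v1 x"] by (simp add: inner_commute)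
    have e6: "w x * (a x * y) = y" for y using wa[of x] by (metis mult.assoc mult_1)
    \<comment> \<open>The difference is a combination of three residuals: the second equation tested
      with w u, the first one tested with v, and w a = 1.\<close>
    have "S x - (N x + Q x) =
      - (w x * (Re z * inner (u x) (u x)) - w x * (s * inner (u1 x) (u x)
        + (a x - c x) * inner (v1 x) (u x) + b x * inner (u2 x) (u x) - k x * inner (v3 x) (u x) - k' x * inner (v2 x) (u x)))
      - (Re z * inner (v x) (v x) - (s * inner (v1 x) (v x) + inner (v x) (u1 x)))
      - (w x * (a x * inner (v1 x) (u x)) - inner (v1 x) (u x))"
      unfolding S_def N_def Q_def D_def e3 e4 e5
      by (simp add: wb_def wb'_def wk_def wk'_def w'k_def w'k'_def inner_commute algebra_simps)
    also have "\<dots> = 0" unfolding e1 e2 e6 by simp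
    finally show ?case by simp
  qed
  then have AE_S: "AE x in lborel. N x + Q x = S x" by (auto elim: eventually_mono)
  have Npos: "N x \<ge> 0" for x
    unfolding N_def wk_def using pos(1,2)[of x] pos(4)
    by (intro mult_nonneg_nonneg add_nonneg_nonneg) (auto intro: less_imp_le)
  have Qpos: "Q x \<ge> r x * (inner (u x) (u x) + inner (v1 x) (v1 x))" for x
    using form[of x "u x" "v1 x" "u1 x"]
    unfolding Q_def wb_def wb'_def wk_def wk'_def w'k_def w'k'_def by (simp add: algebra_simps)
  have Qpos': "r x * (inner (u x) (u x) + inner (v1 x) (v1 x)) \<ge> 0" for x
    using pos(3)[of x] by (intro mult_nonneg_nonneg add_nonneg_nonneg) auto
  have S0: "integral\<^sup>L lborel S = 0" "integrable lborel S" using S by (auto simp: has_bochner_integral_iff)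
  have "AE x in lborel. 0 \<le> S x"
    using AE_S by eventually_elim (use Npos Qpos Qpos' in \<open>smt (verit)\<close>)
  then have "AE x in lborel. S x = 0"
    using integral_nonneg_eq_0_iff_AE[OF S0(2)] S0(1) by simp
  then have zero: "AE x in lborel. u x = 0 \<and> v1 x = 0"
    using AE_S
  proof eventually_elim
    case (elim x)
    then have "r x * (inner (u x) (u x) + inner (v1 x) (v1 x)) = 0"
      using Npos[of x] Qpos[of x] Qpos'[of x] by linarith
    then show ?case using pos(3)[of x] by (simp add: add_nonneg_eq_0_iff)
  qed
  then have "AE x in lborel. v x = 0"
    by (intro weakly_differentiable_zero[OF v(1)]) (auto elim: eventually_mono)
  then show ?thesis using zero by (auto elim: eventually_mono)
qed

section \<open>The profile of a weak shock\<close>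

text \<open>A positive value at y can never be undercut later, so from y on the slope is at least c
  g(y), and g would exceed its bound C.\<close>

lemma nonpos_if_growing:
  fixes g :: "real \<Rightarrow> real"
  assumes der: "\<And>y. (g has_real_derivative g' y) (at y)"
    and bound: "\<And>y. g y \<le> C" and "c > 0" and grow: "\<And>y. g y > 0 \<Longrightarrow> g' y \<ge> c * g y"
  shows "g y \<le> 0"
proof (rule ccontr)
  assume pos: "\<not> g y \<le> 0"
  have cont: "continuous_on A g" for A
    using der by (blast intro: continuous_at_imp_continuous_on DERIV_isCont)
  have mono: "g y \<le> g t" if "y \<le> t" for t
  proof (rule ccontr)
    assume less: "\<not> g y \<le> g t"
    \<comment> \<open>The last time in the interval at which g is at least g(y). There g is
      increasing, so it stays above g(y) a little longer unless this time is the right end.\<close>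
    let ?T = "{y..t} \<inter> g -` {g y..}"
    have "closed ?T" by (rule continuous_closed_preimage[OF cont]) auto
    then have "compact ?T" by (simp add: compact_eq_bounded_closed bounded_Int)
    moreover have "y \<in> ?T" using that by simp
    ultimately obtain m where m: "m \<in> ?T" "\<And>t'. t' \<in> ?T \<Longrightarrow> t' \<le> m"
      using compact_attains_sup[of ?T] by blast
    have "g m > 0" using m(1) pos by auto
    then have "c * g m > 0" using \<open>c > 0\<close> by simp
    then have "g' m > 0" using grow[OF \<open>g m > 0\<close>] by linarith
    then obtain d where d: "d > 0" "\<And>h. 0 < h \<Longrightarrow> h < d \<Longrightarrow> g m < g (m + h)"
      using DERIV_pos_inc_right[OF der] by blast
    have "m \<noteq> t" using m(1) less by auto
    then have "m < t" using m(1) by auto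
    define h where "h = min (d / 2) (t - m)"
    have h: "0 < h" "h < d" "m + h \<le> t" using d(1) \<open>m < t\<close> by (auto simp: h_def)
    have "m + h \<in> ?T" using d(2)[OF h(1,2)] m(1) h by auto
    then show False using m(2) h(1) by fastforce
  qed
  \<comment> \<open>After this time, growth at slope c g(y) has carried g to C + 1.\<close>
  define t where "t = y + (C - g y + 1) / (c * g y)"
  have cg: "c * g y > 0" using pos \<open>c > 0\<close> by simp
  then have t: "y < t" using bound[of y] unfolding t_def by (simp add: add_pos_nonneg)
  obtain m where m: "y < m" "m < t" "g t - g y = (t - y) * g' m"
    using MVT2[OF t, of g g'] der by blast
  have "g' m \<ge> c * g m" using grow[of m] mono[of m] m(1) pos by simp
  also have "c * g m \<ge> c * g y" using mono[of m] m(1) \<open>c > 0\<close> by simp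
  finally have "(t - y) * g' m \<ge> (t - y) * (c * g y)" using t by simp
  also have "(t - y) * (c * g y) = C - g y + 1"
    using cg unfolding t_def by (metis add_diff_cancel_left' less_irrefl nonzero_eq_divide_eq)
  finally show False using m(3) bound[of t] by linarith
qed

text \<open>Convergence of f does not force its derivative to converge, but the mean value theorem
  on [n, n + 1] gives a sequence along which it does.\<close>

lemma critical_sequence:
  fixes f :: "real \<Rightarrow> real"
  assumes der: "\<And>y. (f has_real_derivative g y) (at y)" and lim: "(f \<longlongrightarrow> L) at_top"
  obtains \<xi> where "filterlim \<xi> at_top sequentially" "(\<lambda>n. g (\<xi> n)) \<longlonglongrightarrow> 0"
proof -
  have "\<exists>t. real n < t \<and> g t = f (real n + 1) - f (real n)" for n
    using MVT2[of "real n" "real n + 1" f g] der by auto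
  then obtain \<xi> where \<xi>: "\<And>n. real n < \<xi> n" "\<And>n. g (\<xi> n) = f (real n + 1) - f (real n)" by metis
  have "filterlim \<xi> at_top sequentially"
    by (rule filterlim_at_top_mono[OF filterlim_real_sequentially])
      (intro always_eventually allI less_imp_le \<xi>(1))
  moreover have "(\<lambda>n. f (real n + 1) - f (real n)) \<longlonglongrightarrow> L - L"
    by (intro tendsto_diff filterlim_compose[OF lim] filterlim_real_sequentially)
      (auto intro: filterlim_at_top_mono[OF filterlim_real_sequentially])
  ultimately show ?thesis using that \<xi>(2) by simp
qed

lemma antiderivative_exists:
  fixes f :: "real \<Rightarrow> real"
  assumes "continuous_on {0<..} f"
  shows "\<exists>F. \<forall>v>0. (F has_real_derivative f v) (at v)"
  using einterval_antiderivative[of 0 \<infinity> f] assms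
  by (force simp: has_real_derivative_iff_has_vector_derivative continuous_on_eq_continuous_at)

text \<open>Here \<open>n\<close> stands for \<open>\<mu>(v) / v\<close>. The profile equation has been integrated once, with
  constant of integration \<open>C\<close>, and \<open>U\<close> has been eliminated.\<close>

locale travelling_wave =
  fixes p n \<kappa> V :: "real \<Rightarrow> real" and s Vm Vp C :: real
  assumes smooth: "smooth_on {0<..} p" "smooth_on {0<..} n" "smooth_on {0<..} \<kappa>" "smooth_on UNIV V"
    and V_pos: "V y > 0"
    and n_pos: "v > 0 \<Longrightarrow> n v > 0" and \<kappa>_pos: "v > 0 \<Longrightarrow> \<kappa> v > 0"
    and p_convex: "v > 0 \<Longrightarrow> deriv (deriv p) v > 0"
    and first_integral: "\<kappa> (V y) * deriv (deriv V) y + 1/2 * deriv \<kappa> (V y) * (deriv V y)\<^sup>2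
      + s * n (V y) * deriv V y + s\<^sup>2 * V y + p (V y) = C"
    and lim: "(V \<longlongrightarrow> Vm) at_bot" "(V \<longlongrightarrow> Vp) at_top"
    and shock: "0 < Vp" "Vp < Vm" "s < 0" "s\<^sup>2 * (Vm - Vp) = p Vp - p Vm" "- deriv p Vm < s\<^sup>2"
begin

section \<open>The energy of the profile\<close>

abbreviation "z \<equiv> deriv V"
abbreviation "x \<equiv> deriv (deriv V)"
abbreviation "x' \<equiv> deriv (deriv (deriv V))"

lemma der:
  "(V has_real_derivative z y) (at y)" "(z has_real_derivative x y) (at y)" "(x has_real_derivative x' y) (at y)"
  using smooth(4) by (auto intro!: smooth_on_has_derivative[of UNIV] smooth_on_deriv)

lemma coeff_der:
  "v > 0 \<Longrightarrow> (p has_real_derivative deriv p v) (at v)"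
  "v > 0 \<Longrightarrow> (deriv p has_real_derivative deriv (deriv p) v) (at v)"
  "v > 0 \<Longrightarrow> (n has_real_derivative deriv n v) (at v)"
  "v > 0 \<Longrightarrow> (\<kappa> has_real_derivative deriv \<kappa> v) (at v)"
  "v > 0 \<Longrightarrow> (deriv \<kappa> has_real_derivative deriv (deriv \<kappa>) v) (at v)"
  using smooth by (auto intro!: smooth_on_has_derivative[of "{0<..}"] smooth_on_deriv)

lemma comp_der:
  assumes "\<And>v. v > 0 \<Longrightarrow> (f has_real_derivative f' v) (at v)"
  shows "((\<lambda>y. f (V y)) has_real_derivative f' (V y) * z y) (at y)"
  by (rule DERIV_chain2[OF assms der(1)]) (rule V_pos)

text \<open>With y as time, \<open>first_integral\<close> is the equation of an oscillator with
  position-dependent mass \<kappa>, restoring force q and friction s n. The friction is negative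
  because s < 0. The potential \<open>P\<close> is fixed up to a constant, and only its differences
  matter.\<close>

definition q :: "real \<Rightarrow> real" where "q v = s\<^sup>2 * v + p v - C"

definition P :: "real \<Rightarrow> real" where
  "P = (SOME P. \<forall>v>0. (P has_real_derivative q v) (at v))"

lemma q_der: "v > 0 \<Longrightarrow> (q has_real_derivative s\<^sup>2 + deriv p v) (at v)"
  unfolding q_def[abs_def] by (auto intro!: derivative_eq_intros coeff_der)

lemma P_der: "v > 0 \<Longrightarrow> (P has_real_derivative q v) (at v)"
proof -
  have "continuous_on {0<..} q"
    using q_der by (auto intro!: continuous_at_imp_continuous_on DERIV_isCont)
  from antiderivative_exists[OF this] show "v > 0 \<Longrightarrow> (P has_real_derivative q v) (at v)"
    unfolding P_def by (rule someI2_ex) blast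
qed

lemma P_tendsto: "(g \<longlongrightarrow> v) F \<Longrightarrow> v > 0 \<Longrightarrow> ((\<lambda>y. P (g y)) \<longlongrightarrow> P v) F"
  using DERIV_isCont[OF P_der] isCont_tendsto_compose by blast

text \<open>Kinetic plus potential energy; negative friction makes it nondecreasing in y.\<close>

definition energy :: "real \<Rightarrow> real" where "energy y = 1/2 * \<kappa> (V y) * (z y)\<^sup>2 + P (V y)"

lemma energy_der: "(energy has_real_derivative - s * n (V y) * (z y)\<^sup>2) (at y)"
proof -
  have "(energy has_real_derivative
      1/2 * (deriv \<kappa> (V y) * z y) * (z y)\<^sup>2 + 1/2 * \<kappa> (V y) * (2 * z y * x y) + q (V y) * z y) (at y)"
    unfolding energy_def[abs_def]
    by (auto intro!: derivative_eq_intros comp_der[of \<kappa> "deriv \<kappa>"] comp_der[of P q] coeff_der P_der der)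
  moreover have "1/2 * (deriv \<kappa> (V y) * z y) * (z y)\<^sup>2 + 1/2 * \<kappa> (V y) * (2 * z y * x y) + q (V y) * z y
      = z y * (\<kappa> (V y) * x y + 1/2 * deriv \<kappa> (V y) * (z y)\<^sup>2 + q (V y))"
    by (simp add: algebra_simps)
  moreover have "\<kappa> (V y) * x y + 1/2 * deriv \<kappa> (V y) * (z y)\<^sup>2 + q (V y) = - s * n (V y) * z y"
    using first_integral[of y] by (simp add: q_def)
  moreover have "z y * (- s * n (V y) * z y) = - s * n (V y) * (z y)\<^sup>2"
    by (simp add: power2_eq_square)
  ultimately show ?thesis by metis
qed

lemma energy_mono:
  assumes "a \<le> b"
  shows "energy a \<le> energy b"
proof -
  have "0 \<le> - s * n (V y) * (z y)\<^sup>2" for y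
    using n_pos[OF V_pos[of y]] shock(3) by (intro mult_nonneg_nonneg) auto
  then have "\<exists>D. (energy has_real_derivative D) (at y) \<and> 0 \<le> D" for y using energy_der by blast
  then show ?thesis using assms by (intro DERIV_nonneg_imp_nondecreasing[of a b energy])
qed

lemma coeff_tendsto:
  "(V \<longlongrightarrow> v) F \<Longrightarrow> v > 0 \<Longrightarrow> ((\<lambda>y. \<kappa> (V y)) \<longlongrightarrow> \<kappa> v) F"
  "(V \<longlongrightarrow> v) F \<Longrightarrow> v > 0 \<Longrightarrow> ((\<lambda>y. deriv \<kappa> (V y)) \<longlongrightarrow> deriv \<kappa> v) F"
  "(V \<longlongrightarrow> v) F \<Longrightarrow> v > 0 \<Longrightarrow> ((\<lambda>y. n (V y)) \<longlongrightarrow> n v) F"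
  "(V \<longlongrightarrow> v) F \<Longrightarrow> v > 0 \<Longrightarrow> ((\<lambda>y. q (V y)) \<longlongrightarrow> q v) F"
  using DERIV_isCont[OF coeff_der(4)] DERIV_isCont[OF coeff_der(5)] DERIV_isCont[OF coeff_der(3)]
    DERIV_isCont[OF q_der] isCont_tendsto_compose by blast+

text \<open>By monotonicity the energy is bounded by its limit at +\<infinity>, which is read off
  along a sequence where V' tends to 0. This also bounds V' by a potential difference.\<close>

lemma energy_le: "energy y \<le> P Vp"
proof -
  obtain \<xi> where \<xi>: "filterlim \<xi> at_top sequentially" "(\<lambda>n. z (\<xi> n)) \<longlonglongrightarrow> 0"
    using critical_sequence[OF der(1) lim(2)] .
  have V\<xi>: "(\<lambda>n. V (\<xi> n)) \<longlonglongrightarrow> Vp" using filterlim_compose[OF lim(2) \<xi>(1)] .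
  have "(\<lambda>n. 1/2 * \<kappa> (V (\<xi> n)) * (z (\<xi> n))\<^sup>2 + P (V (\<xi> n))) \<longlonglongrightarrow> 1/2 * \<kappa> Vp * 0\<^sup>2 + P Vp"
    using filterlim_compose[OF coeff_tendsto(1)[OF lim(2) shock(1)] \<xi>(1)]
      filterlim_compose[OF P_tendsto[OF lim(2) shock(1)] \<xi>(1)] \<xi>(2)
    by (intro tendsto_intros)
  then have "(\<lambda>n. energy (\<xi> n)) \<longlonglongrightarrow> P Vp" by (simp add: energy_def)
  then show ?thesis
  proof (rule tendsto_lowerbound)
    have "eventually (\<lambda>n. y \<le> \<xi> n) sequentially" using \<xi>(1) by (auto simp: filterlim_at_top)
    then show "eventually (\<lambda>n. energy y \<le> energy (\<xi> n)) sequentially"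
      by eventually_elim (rule energy_mono)
  qed simp
qed

lemma z_square_le: "1/2 * \<kappa> (V y) * (z y)\<^sup>2 \<le> P Vp - P (V y)"
  using energy_le[of y] by (simp add: energy_def)

lemma z_tendsto_0: "(z \<longlongrightarrow> 0) at_top"
proof -
  have "((\<lambda>y. 2 * (P Vp - P (V y)) / \<kappa> (V y)) \<longlongrightarrow> 2 * (P Vp - P Vp) / \<kappa> Vp) at_top"
    using \<kappa>_pos[OF shock(1)]
    by (intro tendsto_intros P_tendsto coeff_tendsto lim shock(1)) auto
  then have lim0: "((\<lambda>y. 2 * (P Vp - P (V y)) / \<kappa> (V y)) \<longlongrightarrow> 0) at_top" by simp
  have "(z y)\<^sup>2 \<le> 2 * (P Vp - P (V y)) / \<kappa> (V y)" for y
    using z_square_le[of y] \<kappa>_pos[OF V_pos[of y]] by (simp add: field_simps)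
  then have "((\<lambda>y. (z y)\<^sup>2) \<longlongrightarrow> 0) at_top"
    by (intro tendsto_sandwich[OF _ _ tendsto_const lim0]) auto
  then have "((\<lambda>y. sqrt ((z y)\<^sup>2)) \<longlongrightarrow> sqrt 0) at_top" by (rule tendsto_real_sqrt)
  then show ?thesis by (simp add: tendsto_rabs_zero_iff)
qed

text \<open>At +\<infinity> the equation makes V'' converge to - q(Vp) / \<kappa>(Vp), and
  convergence of V' leaves 0 as the only possible limit. The Rankine-Hugoniot condition carries this
  over to \<open>Vm\<close>, so nothing about derivatives at -\<infinity> has to be known.\<close>

lemma q_endpoints: "q Vp = 0" "q Vm = 0"
proof -
  have x_eq: "x y = (- s * n (V y) * z y - q (V y) - 1/2 * deriv \<kappa> (V y) * (z y)\<^sup>2) / \<kappa> (V y)" for y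
    using first_integral[of y] \<kappa>_pos[OF V_pos[of y]] by (simp add: q_def field_simps)
  have "((\<lambda>y. (- s * n (V y) * z y - q (V y) - 1/2 * deriv \<kappa> (V y) * (z y)\<^sup>2) / \<kappa> (V y)) \<longlongrightarrow>
      (- s * n Vp * 0 - q Vp - 1/2 * deriv \<kappa> Vp * 0\<^sup>2) / \<kappa> Vp) at_top"
    using \<kappa>_pos[OF shock(1)]
    by (intro tendsto_intros coeff_tendsto z_tendsto_0 lim shock(1)) auto
  moreover have "x = (\<lambda>y. (- s * n (V y) * z y - q (V y) - 1/2 * deriv \<kappa> (V y) * (z y)\<^sup>2) / \<kappa> (V y))"
    by (rule ext) (rule x_eq)
  ultimately have x_lim: "(x \<longlongrightarrow> - q Vp / \<kappa> Vp) at_top" by simp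
  obtain \<xi> where \<xi>: "filterlim \<xi> at_top sequentially" "(\<lambda>n. x (\<xi> n)) \<longlonglongrightarrow> 0"
    using critical_sequence[OF der(2) z_tendsto_0] .
  have "- q Vp / \<kappa> Vp = 0"
    by (rule LIMSEQ_unique[OF filterlim_compose[OF x_lim \<xi>(1)] \<xi>(2)])
  then show "q Vp = 0" using \<kappa>_pos[OF shock(1)] by simp
  then show "q Vm = 0" using shock(4) by (simp add: q_def algebra_simps)
qed

section \<open>Confinement of the profile near the left end state\<close>

lemma deriv_p_mono:
  assumes "0 < a" "a \<le> b"
  shows "deriv p a \<le> deriv p b"
  using assms(2)
proof (rule DERIV_nonneg_imp_nondecreasing)
  fix v assume "a \<le> v"
  then have "v > 0" using assms(1) by simp
  then show "\<exists>D. (deriv p has_real_derivative D) (at v) \<and> 0 \<le> D"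
    using coeff_der(2) p_convex less_imp_le by blast
qed

lemma q_diff:
  assumes "0 < a" "a < b"
  obtains m where "a < m" "m < b" "q b - q a = (b - a) * (s\<^sup>2 + deriv p m)"
proof -
  have "(q has_real_derivative s\<^sup>2 + deriv p v) (at v)" if "a \<le> v" for v
    using that assms(1) by (intro q_der) simp
  then show ?thesis using MVT2[OF assms(2), of q "\<lambda>v. s\<^sup>2 + deriv p v"] that by blast
qed

text \<open>If \<open>V\<close> fell below \<open>Vp\<close>, it would have reached \<open>Vp\<close> before; there the energy is already at least its
  upper bound \<open>P Vp\<close>, hence stays constant, and \<open>V\<close> comes to rest.\<close>

lemma V_ge: "Vp \<le> V y"
proof (rule ccontr)
  assume less: "\<not> Vp \<le> V y"
  have "eventually (\<lambda>t. Vp < V t) at_bot" using order_tendstoD(1)[OF lim(1) shock(2)] .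
  then obtain a where a: "a \<le> y" "Vp < V a"
    by (metis (mono_tags, lifting) eventually_at_bot_linorder min.cobounded1 min.cobounded2)
  have "\<exists>t\<ge>a. t \<le> y \<and> V t = Vp"
    by (rule IVT2) (use a less der(1) DERIV_isCont in auto)
  then obtain t where t: "t \<le> y" "V t = Vp" by blast
  have en: "energy t' = P Vp" if "t \<le> t'" for t'
  proof -
    have "0 \<le> 1/2 * \<kappa> (V t) * (z t)\<^sup>2" using \<kappa>_pos[OF V_pos[of t]] by simp
    then have "P Vp \<le> energy t" by (simp add: energy_def t(2))
    also have "\<dots> \<le> energy t'" using that by (rule energy_mono)
    finally show ?thesis using energy_le[of t'] by simp
  qed
  have "z t' = 0" if "t < t'" for t'
  proof -
    have "((\<lambda>_. P Vp) has_real_derivative 0) (at t')" by simp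
    then have "(energy has_real_derivative 0) (at t')"
      by (rule has_field_derivative_transform_within_open[where S = "{t<..}"]) (use that en in auto)
    then have "- s * n (V t') * (z t')\<^sup>2 = 0" using energy_der DERIV_unique by blast
    then show ?thesis using shock(3) n_pos[OF V_pos[of t']] by simp
  qed
  then have "V y = V t"
  proof (cases "t < y")
    case True
    then obtain m where "t < m" "V y - V t = (y - t) * z m" using MVT2[OF True, of V z] der by blast
    then show ?thesis using \<open>\<And>t'. t < t' \<Longrightarrow> z t' = 0\<close> by simp
  qed (use t in simp)
  then show False using t(2) less by simp
qed

text \<open>By convexity of \<open>p\<close>, the potential minus its second-order Taylor polynomial at \<open>Vm\<close> is monotone,
  so \<open>P v \<le> P Vp\<close> confines \<open>v\<close> to the reflection of \<open>Vp\<close> at \<open>Vm\<close>.\<close>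

lemma V_le: "V y \<le> Vm + (Vm - Vp)"
proof (rule ccontr)
  assume gt: "\<not> V y \<le> Vm + (Vm - Vp)"
  define \<rho> where "\<rho> = s\<^sup>2 + deriv p Vm"
  have \<rho>: "\<rho> > 0" using shock(5) by (simp add: \<rho>_def)
  define R where "R v = P v - \<rho> / 2 * (v - Vm)\<^sup>2" for v
  have R_der: "(R has_real_derivative q v - \<rho> * (v - Vm)) (at v)" if "v > 0" for v
    unfolding R_def[abs_def] using that by (auto intro!: derivative_eq_intros P_der simp: field_simps)
  have q_ge: "q v - \<rho> * (v - Vm) \<ge> 0" if v: "v > 0" for v
  proof -
    consider "v < Vm" | "v = Vm" | "v > Vm" by linarith
    then show ?thesis
    proof cases
      case 1
      obtain m where m: "v < m" "m < Vm" "q Vm - q v = (Vm - v) * (s\<^sup>2 + deriv p m)"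
        using q_diff[OF v 1] .
      have "deriv p m \<le> deriv p Vm" using m v by (intro deriv_p_mono) auto
      then have "(Vm - v) * (s\<^sup>2 + deriv p m) \<le> (Vm - v) * \<rho>"
        using 1 by (intro mult_left_mono) (auto simp: \<rho>_def)
      then show ?thesis using m(3) q_endpoints by (simp add: algebra_simps)
    next
      case 3
      obtain m where m: "Vm < m" "m < v" "q v - q Vm = (v - Vm) * (s\<^sup>2 + deriv p m)"
        using q_diff[OF less_trans[OF shock(1,2)] 3] .
      have "deriv p Vm \<le> deriv p m" using m shock by (intro deriv_p_mono) auto
      then have "(v - Vm) * \<rho> \<le> (v - Vm) * (s\<^sup>2 + deriv p m)"
        using 3 by (intro mult_left_mono) (auto simp: \<rho>_def)
      then show ?thesis using m(3) q_endpoints by (simp add: algebra_simps)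
    qed (simp add: q_endpoints)
  qed
  have "Vp \<le> V y" using gt shock by auto
  then have "R Vp \<le> R (V y)"
  proof (rule DERIV_nonneg_imp_nondecreasing)
    fix v assume "Vp \<le> v"
    then have "v > 0" using shock(1) by simp
    then show "\<exists>D. (R has_real_derivative D) (at v) \<and> 0 \<le> D" using R_der q_ge by blast
  qed
  moreover have "P (V y) \<le> P Vp"
  proof -
    have "0 \<le> 1/2 * \<kappa> (V y) * (z y)\<^sup>2" using \<kappa>_pos[OF V_pos[of y]] by simp
    then show ?thesis using z_square_le[of y] by simp
  qed
  ultimately have "\<rho> / 2 * (V y - Vm)\<^sup>2 \<le> \<rho> / 2 * (Vp - Vm)\<^sup>2"
    by (simp add: R_def)
  then have "(V y - Vm)\<^sup>2 \<le> (Vm - Vp)\<^sup>2" using \<rho> by (simp add: power2_commute)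
  then have "V y - Vm \<le> Vm - Vp" using shock by (intro power2_le_imp_le[of "V y - Vm"]) auto
  then show False using gt by simp
qed

text \<open>Monotonicity is not yet available to place V between the end states. This two-sided
  bound is what allows constants valid near \<open>Vm\<close> to be used along the whole
  profile.\<close>

lemma V_near: "\<bar>V y - Vm\<bar> \<le> Vm - Vp"
  using V_ge[of y] V_le[of y] by linarith

end

text \<open>A single B serves as upper bound and, through conditions 1 <= B f, as reciprocal of the
  lower bounds. The last condition is positivity of the quantity M, taken at v instead of
  \<open>Vm\<close>.\<close>

definition admissible :: "(real \<Rightarrow> real) \<Rightarrow> (real \<Rightarrow> real) \<Rightarrow> (real \<Rightarrow> real) \<Rightarrow> real \<Rightarrow> real \<Rightarrow> bool" where
  "admissible p n \<kappa> B v \<longleftrightarrow> v > 0 \<and>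
     (\<forall>f \<in> {deriv p, deriv (deriv p), deriv (deriv (deriv p)), n, deriv n, deriv (deriv n),
         deriv (deriv (deriv n)), \<kappa>, deriv \<kappa>, deriv (deriv \<kappa>)}. \<bar>f v\<bar> \<le> B) \<and>
     1 \<le> B * n v \<and> 1 \<le> B * \<kappa> v \<and> 1 \<le> - B * deriv p v \<and> 1 \<le> B * deriv (deriv p) v \<and>
     1 \<le> B * (\<kappa> v * deriv (deriv p) v - deriv \<kappa> v * deriv p v)"

section \<open>Slowness of the profile\<close>

lemma le_mult_ge_one: "1 \<le> c \<Longrightarrow> 0 \<le> a \<Longrightarrow> a \<le> c * (a::real)"
  using mult_right_mono[of 1 c a] by simp

text \<open>Here m stands for s^2 + p'(V) and \<open>ode\<close> is the differentiated profile
  equation. Where |x| >= \<eta> |z|, the term \<Theta> x dominates and x^2 - \<eta>^2 z^2 grows at a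
  fixed rate. The condition 12 B^4 D <= \<eta> pays for \<Gamma>, as 4 B^2 * 3 B^2 D, and 8 B^3
  \<eta> <= 1 pays for the derivative of \<eta>^2 z^2. Elsewhere both terms of the equation are of
  order \<eta> |z|, hence so is x'.\<close>

lemma growth_arith:
  fixes B D \<eta> z x x' m s n n' k k' k'' :: real
  assumes B: "B \<ge> 1" and D: "D \<ge> 0" "12 * B^4 * D \<le> \<eta>" and \<eta>: "\<eta> > 0" "8 * B^3 * \<eta> \<le> 1"
    and z: "\<bar>z\<bar> \<le> D" and m: "\<bar>m\<bar> \<le> D"
    and s: "\<bar>s\<bar> \<le> B" "1 \<le> - B * s" and n: "\<bar>n\<bar> \<le> B" "1 \<le> B * n" "\<bar>n'\<bar> \<le> B"
    and k: "\<bar>k\<bar> \<le> B" "1 \<le> B * k" "\<bar>k'\<bar> \<le> B" "\<bar>k''\<bar> \<le> B"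
    and ode: "k * x' = (- s * n - 2 * k' * z) * x - (s * n' * z + m + 1/2 * k'' * z\<^sup>2) * z"
  shows "\<eta> * \<bar>z\<bar> \<le> \<bar>x\<bar> \<Longrightarrow> x\<^sup>2 \<le> 4 * B^3 * (2 * x * x' - 2 * \<eta>\<^sup>2 * z * x)"
    and "\<bar>x\<bar> \<le> \<eta> * \<bar>z\<bar> \<Longrightarrow> \<bar>x'\<bar> \<le> 6 * B^3 * \<eta> * \<bar>z\<bar>"
proof -
  define \<Theta> where "\<Theta> = - s * n - 2 * k' * z"
  define \<Gamma> where "\<Gamma> = s * n' * z + m + 1/2 * k'' * z\<^sup>2"
  have Bpow: "1 \<le> B ^ i" for i using B by simp
  have \<eta>1: "\<eta> \<le> 1" using \<eta> le_mult_ge_one[of "8 * B^3" \<eta>] Bpow[of 3] by linarith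
  have B3D: "8 * B^3 * D \<le> 1"
  proof -
    have "8 * B^3 * D \<le> 12 * B^4 * D"
      using D(1) B Bpow[of 3] by (intro mult_right_mono mult_mono) (auto simp: power_Suc eval_nat_numeral)
    then show ?thesis using D(2) \<eta>1 by linarith
  qed
  have B2D: "D \<le> B^2 * D" "B * D \<le> B^2 * D"
    using le_mult_ge_one[OF Bpow[of 2] D(1)] mult_right_mono[of B "B^2" D] le_mult_ge_one[of B B] B D(1)
    by (simp_all add: power2_eq_square)
  have "8 * D \<le> 8 * B^3 * D" using le_mult_ge_one[OF Bpow[of 3] D(1)] by simp
  then have D1: "D \<le> 1" using B3D by linarith
  have kpos: "k > 0" using k(2) B by (smt (verit) mult_nonneg_nonpos)
  have \<Gamma>: "\<bar>\<Gamma>\<bar> \<le> 3 * B^2 * D"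
  proof -
    have "\<bar>s * n' * z\<bar> \<le> B * B * D" by (intro abs_mult_bound s n z)
    moreover have "\<bar>1/2 * k'' * z\<^sup>2\<bar> \<le> B^2 * D"
    proof -
      have "z\<^sup>2 \<le> D * 1" using abs_mult_bound[OF z order.trans[OF z D1]] by (simp add: power2_eq_square abs_mult)
      then have "\<bar>k'' * z\<^sup>2\<bar> \<le> B * D" by (intro abs_mult_bound k) simp
      then show ?thesis using B2D D(1) by (simp add: abs_mult)
    qed
    ultimately show ?thesis using m B2D unfolding \<Gamma>_def by (simp add: power2_eq_square)
  qed
  have kz: "\<bar>2 * k' * z\<bar> \<le> 2 * B * D" using abs_mult_bound[OF k(3) z] by (simp add: abs_mult)
  \<comment> \<open>The bounds -s >= 1/B and n >= 1/B contribute 4; the perturbation 2 k' z costs at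
    most 8 B^3 D <= 1.\<close>
  have \<Theta>_ge: "3 \<le> 4 * B^2 * \<Theta>"
  proof -
    have "1 * 1 \<le> (- B * s) * (B * n)" using s(2) n(2) by (intro mult_mono) auto
    moreover have "4 * B^2 * (2 * k' * z) \<le> 4 * B^2 * (2 * B * D)"
      using kz B by (intro mult_left_mono) auto
    ultimately show ?thesis using B3D unfolding \<Theta>_def
      by (simp add: power2_eq_square power3_eq_cube algebra_simps)
  qed
  have \<Theta>_le: "\<bar>\<Theta>\<bar> \<le> 3 * B^2"
  proof -
    have "\<bar>s * n\<bar> \<le> B * B" by (intro abs_mult_bound s n)
    moreover have "2 * B * D \<le> 2 * B * B" using B D1 by (intro mult_left_mono) auto
    ultimately show ?thesis using kz unfolding \<Theta>_def by (simp add: power2_eq_square)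
  qed
  have ode': "k * x' = \<Theta> * x - \<Gamma> * z" using ode unfolding \<Theta>_def \<Gamma>_def .
  show "x\<^sup>2 \<le> 4 * B^3 * (2 * x * x' - 2 * \<eta>\<^sup>2 * z * x)" if big: "\<eta> * \<bar>z\<bar> \<le> \<bar>x\<bar>"
  proof -
    have zx: "\<eta> * \<bar>z * x\<bar> \<le> x\<^sup>2"
      using mult_right_mono[OF big abs_ge_zero[of x]] by (simp add: abs_mult power2_eq_square mult.assoc)
    have "4 * B^2 * \<Theta> * x\<^sup>2 \<ge> 3 * x\<^sup>2" using \<Theta>_ge by (intro mult_right_mono) auto
    moreover have "4 * B^2 * (\<Gamma> * (z * x)) \<le> x\<^sup>2"
    proof -
      have "\<Gamma> * (z * x) \<le> 3 * B^2 * D * \<bar>z * x\<bar>"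
        using abs_mult_bound[OF \<Gamma> order.refl[of "\<bar>z * x\<bar>"]] by linarith
      then have "4 * B^2 * (\<Gamma> * (z * x)) \<le> 4 * B^2 * (3 * B^2 * D * \<bar>z * x\<bar>)"
        using B by (intro mult_left_mono) auto
      also have "\<dots> = 12 * B^4 * D * \<bar>z * x\<bar>" by (simp add: eval_nat_numeral algebra_simps)
      also have "\<dots> \<le> \<eta> * \<bar>z * x\<bar>" using D(2) by (intro mult_right_mono) auto
      finally show ?thesis using zx by linarith
    qed
    ultimately have "2 * x\<^sup>2 \<le> 4 * B^2 * (\<Theta> * x\<^sup>2 - \<Gamma> * (z * x))" by (simp add: algebra_simps)
    also have "\<Theta> * x\<^sup>2 - \<Gamma> * (z * x) = k * (x * x')"
      using arg_cong[OF ode', of "\<lambda>t. x * t"] by (simp add: power2_eq_square algebra_simps)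
    finally have kx: "2 * x\<^sup>2 \<le> 4 * B^2 * (k * (x * x'))" .
    \<comment> \<open>The sign is needed before k can be replaced by its upper bound B.\<close>
    have xx: "x * x' \<ge> 0"
    proof (rule ccontr)
      assume "\<not> x * x' \<ge> 0"
      then have "4 * B^2 * (k * (x * x')) < 0" using kpos B by (simp add: mult_pos_neg not_le)
      then show False using kx zero_le_power2[of x] by linarith
    qed
    have "k * (x * x') \<le> B * (x * x')" using k(1) xx by (intro mult_right_mono) auto
    then have "4 * B^2 * (k * (x * x')) \<le> 4 * B^2 * (B * (x * x'))" using B by (intro mult_left_mono) auto
    then have 1: "2 * x\<^sup>2 \<le> 4 * B^3 * (x * x')"
      using kx by (simp add: power2_eq_square power3_eq_cube mult.assoc)
    have "8 * B^3 * \<eta> * (\<eta> * (z * x)) \<le> 8 * B^3 * \<eta> * (x\<^sup>2)"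
      using zx B \<eta>(1) abs_ge_self[of "z * x"] by (intro mult_left_mono) (auto intro: order.trans[OF mult_left_mono])
    also have "\<dots> \<le> 1 * x\<^sup>2" using \<eta>(2) by (intro mult_right_mono) auto
    finally have "8 * B^3 * \<eta> * (\<eta> * (z * x)) \<le> 1 * x\<^sup>2" .
    moreover have "4 * B^3 * (2 * x * x' - 2 * \<eta>\<^sup>2 * z * x)
        = 2 * (4 * B^3 * (x * x')) - 8 * B^3 * \<eta> * (\<eta> * (z * x))"
      by (simp add: power2_eq_square algebra_simps)
    ultimately show ?thesis using 1 zero_le_power2[of x] by linarith
  qed
  show "\<bar>x'\<bar> \<le> 6 * B^3 * \<eta> * \<bar>z\<bar>" if small: "\<bar>x\<bar> \<le> \<eta> * \<bar>z\<bar>"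
  proof -
    have "\<bar>\<Theta> * x\<bar> \<le> 3 * B^2 * (\<eta> * \<bar>z\<bar>)" by (rule abs_mult_bound[OF \<Theta>_le small])
    moreover have "\<bar>\<Gamma> * z\<bar> \<le> 3 * B^2 * (\<eta> * \<bar>z\<bar>)"
    proof -
      have "D \<le> 12 * B^4 * D" using le_mult_ge_one[of "12 * B^4" D] Bpow[of 4] D(1) by simp
      then have "3 * B^2 * D \<le> 3 * B^2 * \<eta>" using D(2) B by (intro mult_left_mono) auto
      from abs_mult_bound[OF order.trans[OF \<Gamma> this] order.refl[of "\<bar>z\<bar>"]]
      show ?thesis by (simp add: mult.assoc)
    qed
    ultimately have "\<bar>k * x'\<bar> \<le> 6 * B^2 * (\<eta> * \<bar>z\<bar>)" unfolding ode' by linarith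
    then have "k * \<bar>x'\<bar> \<le> 6 * B^2 * (\<eta> * \<bar>z\<bar>)" using kpos by (simp add: abs_mult)
    then have "B * (k * \<bar>x'\<bar>) \<le> B * (6 * B^2 * (\<eta> * \<bar>z\<bar>))" using B by (intro mult_left_mono) auto
    moreover have "\<bar>x'\<bar> \<le> B * k * \<bar>x'\<bar>" using k(2) by (intro le_mult_ge_one) auto
    ultimately show ?thesis by (simp add: power2_eq_square power3_eq_cube mult.assoc)
  qed
qed

context travelling_wave
begin

lemma x_ode:
  "\<kappa> (V y) * x' y = (- s * n (V y) - 2 * deriv \<kappa> (V y) * z y) * x y
    - (s * deriv n (V y) * z y + (s\<^sup>2 + deriv p (V y)) + 1/2 * deriv (deriv \<kappa>) (V y) * (z y)\<^sup>2) * z y"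
proof -
  let ?\<Phi> = "\<lambda>y. \<kappa> (V y) * x y + 1/2 * deriv \<kappa> (V y) * (z y)\<^sup>2 + s * n (V y) * z y + s\<^sup>2 * V y + p (V y)"
  have d: "(?\<Phi> has_real_derivative
      (deriv \<kappa> (V y) * z y * x y + \<kappa> (V y) * x' y)
      + (1/2 * (deriv (deriv \<kappa>) (V y) * z y) * (z y)\<^sup>2 + 1/2 * deriv \<kappa> (V y) * (2 * z y * x y))
      + (s * (deriv n (V y) * z y) * z y + s * n (V y) * x y) + s\<^sup>2 * z y + deriv p (V y) * z y) (at y)"
    by (auto intro!: derivative_eq_intros comp_der[of \<kappa> "deriv \<kappa>"] comp_der[of "deriv \<kappa>" "deriv (deriv \<kappa>)"]
        comp_der[of n "deriv n"] comp_der[of p "deriv p"] coeff_der der)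
  have \<Phi>: "?\<Phi> = (\<lambda>_. C)" using first_integral by auto
  from d[unfolded \<Phi>] DERIV_const have "(deriv \<kappa> (V y) * z y * x y + \<kappa> (V y) * x' y)
      + (1/2 * (deriv (deriv \<kappa>) (V y) * z y) * (z y)\<^sup>2 + 1/2 * deriv \<kappa> (V y) * (2 * z y * x y))
      + (s * (deriv n (V y) * z y) * z y + s * n (V y) * x y) + s\<^sup>2 * z y + deriv p (V y) * z y = 0"
    by (rule DERIV_unique)
  then show ?thesis by (simp add: power2_eq_square algebra_simps)
qed

text \<open>Under the hypothesis z^2 exp(2y) is nondecreasing and z^2 exp(-2y) nonincreasing, so a
  single zero of z would spread to the whole line. But V has to fall somewhere, so z is negative at
  one point and, having no zeros, everywhere.\<close>

lemma z_neg:
  assumes le: "\<And>y. \<bar>x y\<bar> \<le> \<bar>z y\<bar>"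
  shows "z y < 0"
proof -
  have zx: "\<bar>2 * z y * x y\<bar> \<le> 2 * (z y)\<^sup>2" for y
    using mult_left_mono[OF le[of y] abs_ge_zero[of "z y"]] by (simp add: abs_mult power2_eq_square)
  have up: "z a = 0" if "z b = 0" "a \<le> b" for a b
  proof -
    have "(z a)\<^sup>2 * exp (2 * a) \<le> (z b)\<^sup>2 * exp (2 * b)"
    proof (rule DERIV_nonneg_imp_nondecreasing[OF that(2)])
      fix y
      have "((\<lambda>y. (z y)\<^sup>2 * exp (2 * y)) has_real_derivative (2 * z y * x y + 2 * (z y)\<^sup>2) * exp (2 * y)) (at y)"
        by (auto intro!: derivative_eq_intros der simp: algebra_simps)
      moreover have "(2 * z y * x y + 2 * (z y)\<^sup>2) * exp (2 * y) \<ge> 0"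
        using zx[of y] by (intro mult_nonneg_nonneg) auto
      ultimately show "\<exists>D. ((\<lambda>y. (z y)\<^sup>2 * exp (2 * y)) has_real_derivative D) (at y) \<and> 0 \<le> D" by blast
    qed
    then show ?thesis using that(1) by (simp add: mult_le_0_iff)
  qed
  have down: "z b = 0" if "z a = 0" "a \<le> b" for a b
  proof -
    have "(z b)\<^sup>2 * exp (- 2 * b) \<le> (z a)\<^sup>2 * exp (- 2 * a)"
    proof (rule DERIV_nonpos_imp_nonincreasing[OF that(2)])
      fix y
      have "((\<lambda>y. (z y)\<^sup>2 * exp (- 2 * y)) has_real_derivative (2 * z y * x y - 2 * (z y)\<^sup>2) * exp (- 2 * y)) (at y)"
        by (auto intro!: derivative_eq_intros der simp: algebra_simps)
      moreover have "(2 * z y * x y - 2 * (z y)\<^sup>2) * exp (- 2 * y) \<le> 0"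
        using zx[of y] by (intro mult_nonpos_nonneg) auto
      ultimately show "\<exists>D. ((\<lambda>y. (z y)\<^sup>2 * exp (- 2 * y)) has_real_derivative D) (at y) \<and> D \<le> 0" by blast
    qed
    then show ?thesis using that(1) by (simp add: mult_le_0_iff)
  qed
  have "eventually (\<lambda>t. (Vm + Vp) / 2 < V t) at_bot" by (rule order_tendstoD(1)[OF lim(1)]) (use shock in simp)
  then obtain a where a: "\<And>t. t \<le> a \<Longrightarrow> (Vm + Vp) / 2 < V t" by (auto simp: eventually_at_bot_linorder)
  have "eventually (\<lambda>t. V t < (Vm + Vp) / 2) at_top" by (rule order_tendstoD(2)[OF lim(2)]) (use shock in simp)
  then obtain b where b: "\<And>t. t \<ge> b \<Longrightarrow> V t < (Vm + Vp) / 2" by (auto simp: eventually_at_top_linorder)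
  have ab: "min a b < b + 1" by simp
  obtain c where c: "V (b + 1) - V (min a b) = (b + 1 - min a b) * z c"
    using MVT2[OF ab, of V z] der(1) by blast
  have "V (b + 1) - V (min a b) < 0" using a[of "min a b"] b[of "b + 1"] by simp
  then have zc: "z c < 0" using c by (simp add: mult_less_0_iff)
  have nz: "z t \<noteq> 0" for t using up[of t c] down[of t c] zc by (cases "t \<le> c") auto
  show ?thesis
  proof (rule ccontr)
    assume "\<not> z y < 0"
    then have y: "z y \<ge> 0" by simp
    have cont: "isCont z t" for t using der(2) by (rule DERIV_isCont)
    consider "c \<le> y" | "y \<le> c" by linarith
    then have "\<exists>t. z t = 0"
    proof cases
      case 1
      then show ?thesis using IVT[of z c 0 y] zc y cont by auto
    next
      case 2
      then show ?thesis using IVT2[of z c 0 y] zc y cont by auto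
    qed
    then show False using nz by blast
  qed
qed

text \<open>The differentiated profile equation has the form \<open>\<kappa> x' = \<Theta> x - \<Gamma> z\<close> with \<open>\<Theta>\<close> bounded below and \<open>\<Gamma>\<close>
  small. Hence \<open>x\<^sup>2 - \<eta>\<^sup>2 z\<^sup>2\<close> grows exponentially where it is positive; being bounded, it is nowhere
  positive.\<close>

lemma slow_profile:
  assumes B: "B \<ge> 1" and adm: "\<And>v. \<bar>v - Vm\<bar> \<le> Vm - Vp \<Longrightarrow> admissible p n \<kappa> B v"
    and \<delta>: "\<delta> > 0" "\<delta> \<le> 1" and small: "288 * B^8 * (Vm - Vp) \<le> \<delta>"
  shows "\<bar>s\<bar> \<le> B" "1 \<le> - B * s" "z y < 0" "\<bar>z y\<bar> \<le> \<delta>" "\<bar>x y\<bar> \<le> \<delta> * \<bar>z y\<bar>" "\<bar>x' y\<bar> \<le> \<delta> * \<bar>z y\<bar>"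
proof -
  define \<epsilon> where "\<epsilon> = Vm - Vp"
  have \<epsilon>: "\<epsilon> > 0" using shock by (simp add: \<epsilon>_def)
  have Bpow: "1 \<le> B ^ i" for i using B by simp
  let ?I = "{Vm - \<epsilon>..Vm + \<epsilon>}"
  have I: "admissible p n \<kappa> B v" if "v \<in> ?I" for v
    using that by (intro adm) (auto simp: \<epsilon>_def)
  have Ipos: "v > 0" if "v \<in> ?I" for v using I[OF that] by (simp add: admissible_def)
  have V_in: "V y \<in> ?I" for y using V_near[of y] by (auto simp: \<epsilon>_def)
  \<comment> \<open>The mean value theorem turns the Rankine-Hugoniot condition into s^2 = - p'(v)
    for an intermediate point v, so that \<open>admissible\<close> bounds s from both sides.\<close>
  have "\<And>v. Vp \<le> v \<Longrightarrow> (p has_real_derivative deriv p v) (at v)"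
    using shock(1) by (intro coeff_der) simp
  then obtain v\<^sub>0 where v\<^sub>0: "Vp < v\<^sub>0" "v\<^sub>0 < Vm" "p Vm - p Vp = (Vm - Vp) * deriv p v\<^sub>0"
    using MVT2[OF shock(2), of p "deriv p"] by blast
  have v\<^sub>0_in: "v\<^sub>0 \<in> ?I" using v\<^sub>0 by (auto simp: \<epsilon>_def)
  have "(s\<^sup>2 + deriv p v\<^sub>0) * (Vm - Vp) = 0" using v\<^sub>0(3) shock(4) by (simp add: algebra_simps)
  then have s2: "s\<^sup>2 = - deriv p v\<^sub>0" using shock(2) by simp
  show s_le: "\<bar>s\<bar> \<le> B"
  proof (rule power2_le_imp_le)
    have "\<bar>deriv p v\<^sub>0\<bar> \<le> B" using I[OF v\<^sub>0_in] by (simp add: admissible_def)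
    then have "s\<^sup>2 \<le> B" unfolding s2 by linarith
    also have "B \<le> B\<^sup>2" using B by (simp add: power2_eq_square)
    finally show "\<bar>s\<bar>\<^sup>2 \<le> B\<^sup>2" by simp
  qed (use B in simp)
  show s_ge: "1 \<le> - B * s"
  proof (rule power2_le_imp_le)
    have "1 \<le> B * s\<^sup>2" using I[OF v\<^sub>0_in] by (auto simp: s2 admissible_def)
    also have "\<dots> \<le> B * (B * s\<^sup>2)" using B by (intro le_mult_ge_one) auto
    finally show "1\<^sup>2 \<le> (- B * s)\<^sup>2" by (simp add: power2_eq_square mult_ac)
  qed (use B shock(3) in \<open>simp add: mult_nonneg_nonpos\<close>)
  have m_le: "\<bar>s\<^sup>2 + deriv p v\<bar> \<le> 2 * B * \<epsilon>" if v: "v \<in> ?I" for v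
  proof -
    have "norm (deriv p v - deriv p v\<^sub>0) \<le> B * norm (v - v\<^sub>0)"
    proof (rule field_differentiable_bound[of ?I _ "deriv (deriv p)"])
      show "(deriv p has_field_derivative deriv (deriv p) v) (at v within ?I)" if "v \<in> ?I" for v
        using coeff_der(2)[OF Ipos[OF that]] by (rule has_field_derivative_at_within)
      show "norm (deriv (deriv p) v) \<le> B" if "v \<in> ?I" for v using I[OF that] by (simp add: admissible_def)
    qed (use v v\<^sub>0_in in auto)
    also have "\<dots> \<le> B * (2 * \<epsilon>)" using v v\<^sub>0_in B by (intro mult_left_mono) auto
    finally show ?thesis by (simp add: s2 mult_ac)
  qed
  have q_le: "\<bar>q v\<bar> \<le> 2 * B * \<epsilon> * \<epsilon>" if v: "v \<in> ?I" for v
  proof -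
    have "norm (q v - q Vm) \<le> 2 * B * \<epsilon> * norm (v - Vm)"
    proof (rule field_differentiable_bound[of ?I _ "\<lambda>v. s\<^sup>2 + deriv p v"])
      show "(q has_field_derivative s\<^sup>2 + deriv p v) (at v within ?I)" if "v \<in> ?I" for v
        using q_der[OF Ipos[OF that]] by (rule has_field_derivative_at_within)
    qed (use v \<epsilon> m_le in auto)
    also have "\<dots> \<le> 2 * B * \<epsilon> * \<epsilon>" using v B \<epsilon> by (intro mult_left_mono) auto
    finally show ?thesis by (simp add: q_endpoints)
  qed
  have P_le: "P Vp - P v \<le> 2 * B * \<epsilon> * \<epsilon> * (2 * \<epsilon>)" if v: "v \<in> ?I" for v
  proof -
    have "norm (P Vp - P v) \<le> 2 * B * \<epsilon> * \<epsilon> * norm (Vp - v)"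
    proof (rule field_differentiable_bound[of ?I _ q])
      show "(P has_field_derivative q v) (at v within ?I)" if "v \<in> ?I" for v
        using P_der[OF Ipos[OF that]] by (rule has_field_derivative_at_within)
    qed (use v \<epsilon> q_le in \<open>auto simp: \<epsilon>_def\<close>)
    also have "\<dots> \<le> 2 * B * \<epsilon> * \<epsilon> * (2 * \<epsilon>)"
      using v B \<epsilon> by (intro mult_left_mono) (auto simp: \<epsilon>_def)
    finally show ?thesis by simp
  qed
  have "288 * \<epsilon> \<le> 288 * B^8 * \<epsilon>" using le_mult_ge_one[OF Bpow[of 8], of \<epsilon>] \<epsilon> by simp
  then have \<epsilon>1: "\<epsilon> \<le> 1" using small \<delta> by (simp add: \<epsilon>_def)
  \<comment> \<open>The potential drop is at most 4 B \<epsilon>^3, hence z^2 <= 8 B^2 \<epsilon>^3,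
    and \<epsilon> <= 1 with 8 <= 9 gives |z| <= 3 B \<epsilon>. The same D exceeds the bound 2 B
    \<epsilon> for s^2 + p'(V).\<close>
  define D where "D = 3 * B * \<epsilon>"
  have D0: "D \<ge> 0" using B \<epsilon> by (simp add: D_def)
  have z_le: "\<bar>z y\<bar> \<le> D" for y
  proof (rule power2_le_imp_le)
    have Bk: "1 \<le> B * \<kappa> (V y)" using I[OF V_in[of y]] by (simp add: admissible_def)
    have "1/2 * \<kappa> (V y) * (z y)\<^sup>2 \<le> 2 * B * \<epsilon> * \<epsilon> * (2 * \<epsilon>)"
      using z_square_le[of y] P_le[OF V_in[of y]] by linarith
    then have "2 * B * (1/2 * \<kappa> (V y) * (z y)\<^sup>2) \<le> 2 * B * (2 * B * \<epsilon> * \<epsilon> * (2 * \<epsilon>))"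
      using B by (intro mult_left_mono) auto
    then have "B * \<kappa> (V y) * (z y)\<^sup>2 \<le> 8 * (B^2 * \<epsilon>^2) * \<epsilon>"
      by (simp add: power2_eq_square algebra_simps)
    moreover have "(z y)\<^sup>2 \<le> B * \<kappa> (V y) * (z y)\<^sup>2" using Bk by (intro le_mult_ge_one) auto
    moreover have "8 * (B^2 * \<epsilon>^2) * \<epsilon> \<le> 8 * (B^2 * \<epsilon>^2) * 1" using \<epsilon>1 by (intro mult_left_mono) auto
    moreover have "8 * (B^2 * \<epsilon>^2) \<le> D\<^sup>2" unfolding D_def by (simp add: power_mult_distrib)
    ultimately show "\<bar>z y\<bar>\<^sup>2 \<le> D\<^sup>2" by simp
  qed (rule D0)
  have m_D: "\<bar>s\<^sup>2 + deriv p (V y)\<bar> \<le> D" for y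
    using m_le[OF V_in[of y]] B \<epsilon> by (simp add: D_def)
  \<comment> \<open>With 8 B^3 \<eta> = \<delta> the bound 6 B^3 \<eta> |z| for x' lies below
    \<delta> |z|. The condition 12 B^4 D <= \<eta> then becomes the hypothesis \<open>small\<close>,
    because 8 B^3 * 12 B^4 * 3 B = 288 B^8.\<close>
  define \<eta> where "\<eta> = \<delta> / (8 * B^3)"
  have B3: "8 * B^3 > 0" using B by simp
  have \<eta>: "\<eta> > 0" "8 * B^3 * \<eta> = \<delta>" using \<delta> B by (auto simp: \<eta>_def)
  have "8 * B^3 * (12 * B^4 * D) = 288 * B^8 * \<epsilon>" by (simp add: D_def eval_nat_numeral)
  then have "8 * B^3 * (12 * B^4 * D) \<le> 8 * B^3 * \<eta>" unfolding \<eta>(2) using small by (simp only: \<epsilon>_def)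
  then have D\<eta>: "12 * B^4 * D \<le> \<eta>" using B3 by (simp only: mult_le_cancel_left_pos)
  have D_le: "D \<le> \<eta>" using D\<eta> le_mult_ge_one[of "12 * B^4" D] Bpow[of 4] D0 by linarith
  have \<eta>_le: "\<eta> \<le> \<delta>" using \<eta> le_mult_ge_one[of "8 * B^3" \<eta>] Bpow[of 3] by linarith
  have \<eta>8: "8 * B^3 * \<eta> \<le> 1" using \<eta> \<delta> by simp
  note arith = growth_arith[OF B D0 D\<eta> \<eta>(1) \<eta>8 z_le m_D s_le s_ge _ _ _ _ _ _ _ x_ode]
  have coef: "\<bar>n (V y)\<bar> \<le> B" "1 \<le> B * n (V y)" "\<bar>deriv n (V y)\<bar> \<le> B" "\<bar>\<kappa> (V y)\<bar> \<le> B" "1 \<le> B * \<kappa> (V y)"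
    "\<bar>deriv \<kappa> (V y)\<bar> \<le> B" "\<bar>deriv (deriv \<kappa>) (V y)\<bar> \<le> B" for y
    using I[OF V_in[of y]] by (auto simp: admissible_def)
  \<comment> \<open>Any finite bound for V'' will do: it only supplies the boundedness that
    contradicts growth.\<close>
  define K where "K = B * (B * B * D + 2 * B * \<epsilon> * \<epsilon> + 1/2 * B * (D * D))"
  have x_K: "\<bar>x y\<bar> \<le> K" for y
  proof -
    have "\<kappa> (V y) * x y = - (s * n (V y) * z y) - q (V y) - 1/2 * (deriv \<kappa> (V y) * (z y * z y))"
      using first_integral[of y] by (simp add: q_def power2_eq_square)
    moreover have "\<bar>s * n (V y) * z y\<bar> \<le> B * B * D" by (intro abs_mult_bound s_le coef z_le)
    moreover have "\<bar>deriv \<kappa> (V y) * (z y * z y)\<bar> \<le> B * (D * D)" by (intro abs_mult_bound coef z_le)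
    ultimately have "\<bar>\<kappa> (V y) * x y\<bar> \<le> B * B * D + 2 * B * \<epsilon> * \<epsilon> + 1/2 * B * (D * D)"
      using q_le[OF V_in[of y]] by linarith
    then have "B * \<bar>\<kappa> (V y) * x y\<bar> \<le> K" unfolding K_def using B by (intro mult_left_mono) auto
    moreover have "B * \<bar>\<kappa> (V y) * x y\<bar> = B * \<kappa> (V y) * \<bar>x y\<bar>"
      using \<kappa>_pos[OF V_pos[of y]] by (simp add: abs_mult)
    moreover have "\<bar>x y\<bar> \<le> B * \<kappa> (V y) * \<bar>x y\<bar>" using coef(5) by (intro le_mult_ge_one) auto
    ultimately show ?thesis by linarith
  qed
  have "(x y)\<^sup>2 - \<eta>\<^sup>2 * (z y)\<^sup>2 \<le> 0" for y
  proof (rule nonpos_if_growing[where C = "K * K" and c = "1 / (4 * B^3)"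
        and g = "\<lambda>y. (x y)\<^sup>2 - \<eta>\<^sup>2 * (z y)\<^sup>2"
        and g' = "\<lambda>y. 2 * x y * x' y - 2 * \<eta>\<^sup>2 * z y * x y"])
    show "((\<lambda>y. (x y)\<^sup>2 - \<eta>\<^sup>2 * (z y)\<^sup>2) has_real_derivative 2 * x y * x' y - 2 * \<eta>\<^sup>2 * z y * x y) (at y)" for y
      by (auto intro!: derivative_eq_intros der)
    have "(x y)\<^sup>2 \<le> K * K" for y
      using x_K[of y] abs_mult_bound[of "x y" K "x y" K] by (simp add: power2_eq_square)
    then show "(x y)\<^sup>2 - \<eta>\<^sup>2 * (z y)\<^sup>2 \<le> K * K" for y
      using mult_nonneg_nonneg[OF zero_le_power2[of \<eta>] zero_le_power2[of "z y"]] by (smt (verit))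
    show "1 / (4 * B^3) > 0" using B by simp
    fix y assume "(x y)\<^sup>2 - \<eta>\<^sup>2 * (z y)\<^sup>2 > 0"
    then have "(\<eta> * \<bar>z y\<bar>)\<^sup>2 \<le> \<bar>x y\<bar>\<^sup>2" by (simp add: power_mult_distrib)
    then have "\<eta> * \<bar>z y\<bar> \<le> \<bar>x y\<bar>" by (rule power2_le_imp_le) simp
    from arith(1)[OF coef this]
    have "1 / (4 * B^3) * (x y)\<^sup>2 \<le> 2 * x y * x' y - 2 * \<eta>\<^sup>2 * z y * x y"
      using B by (simp add: field_simps)
    moreover have "1 / (4 * B^3) * ((x y)\<^sup>2 - \<eta>\<^sup>2 * (z y)\<^sup>2) \<le> 1 / (4 * B^3) * (x y)\<^sup>2"
      using B by (intro mult_left_mono) auto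
    ultimately show "1 / (4 * B^3) * ((x y)\<^sup>2 - \<eta>\<^sup>2 * (z y)\<^sup>2) \<le> 2 * x y * x' y - 2 * \<eta>\<^sup>2 * z y * x y"
      by linarith
  qed
  then have x_\<eta>: "\<bar>x y\<bar> \<le> \<eta> * \<bar>z y\<bar>" for y
    using power2_le_imp_le[of "\<bar>x y\<bar>" "\<eta> * \<bar>z y\<bar>"] \<eta>(1) by (simp add: power_mult_distrib)
  show "\<bar>z y\<bar> \<le> \<delta>" using z_le[of y] D_le \<eta>_le by linarith
  show "\<bar>x y\<bar> \<le> \<delta> * \<bar>z y\<bar>"
    using x_\<eta>[of y] mult_right_mono[OF \<eta>_le abs_ge_zero[of "z y"]] by linarith
  have "6 * B^3 * \<eta> * \<bar>z y\<bar> \<le> \<delta> * \<bar>z y\<bar>"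
    using \<eta> B3 by (intro mult_right_mono) (auto simp flip: \<eta>(2) intro!: mult_right_mono)
  then show "\<bar>x' y\<bar> \<le> \<delta> * \<bar>z y\<bar>" using arith(2)[OF coef x_\<eta>[of y]] by linarith
  have "\<eta> \<le> 1" using \<eta>_le \<delta> by linarith
  then have "\<bar>x y\<bar> \<le> \<bar>z y\<bar>" for y
    using x_\<eta>[of y] mult_right_mono[of \<eta> 1 "\<bar>z y\<bar>"] by simp
  then show "z y < 0" by (rule z_neg)
qed

end

section \<open>Positivity of the energy\<close>

text \<open>In the application t is |V'|. By Young's inequality and \<open>small\<close>, each
  product with \<beta> costs c t / 2 of one of the squares of \<alpha>, \<gamma> and g / 8 of that
  of \<beta>. The product of \<gamma> and \<alpha> costs a further c t / 8 of each, which leaves 3 c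
  t / 8.\<close>

lemma quadratic_form_bound:
  fixes \<alpha> \<beta> \<gamma> :: "'a::real_inner" and c t g K X\<^sub>1 X\<^sub>2 X\<^sub>3 E\<^sub>1 E\<^sub>2 E\<^sub>3 :: real
  assumes c: "c > 0" and t: "t \<ge> 0" and X: "c * t \<le> X\<^sub>1" "c * t \<le> X\<^sub>2" "g \<le> X\<^sub>3"
    and E: "\<bar>E\<^sub>1\<bar> \<le> K * t" "\<bar>E\<^sub>2\<bar> \<le> K * t" "\<bar>E\<^sub>3\<bar> \<le> c / 4 * t" and small: "4 * K\<^sup>2 * t \<le> c * g"
  shows "c / 4 * t * (inner \<alpha> \<alpha> + inner \<gamma> \<gamma>) \<le>
    X\<^sub>1 * inner \<alpha> \<alpha> + X\<^sub>3 * inner \<beta> \<beta> + X\<^sub>2 * inner \<gamma> \<gamma> + E\<^sub>1 * inner \<beta> \<alpha> + E\<^sub>2 * inner \<gamma> \<beta> + E\<^sub>3 * inner \<gamma> \<alpha>"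
proof -
  have cross: "\<bar>E * inner y x\<bar> \<le> c / 2 * t * (norm x)\<^sup>2 + g / 8 * (norm y)\<^sup>2" if "\<bar>E\<bar> \<le> K * t" for E and x y :: 'a
  proof -
    have "\<bar>E * inner y x\<bar> \<le> K * t * (norm y * norm x)"
      by (rule abs_mult_bound[OF that Cauchy_Schwarz_ineq2])
    moreover have "2 * c * (K * t * (norm y * norm x)) \<le> 2 * c * (c / 2 * t * (norm x)\<^sup>2 + g / 8 * (norm y)\<^sup>2)"
    proof -
      have "0 \<le> t * (c * norm x - K * norm y)\<^sup>2" using t by simp
      moreover have "K\<^sup>2 * t * (norm y)\<^sup>2 \<le> c * g / 4 * (norm y)\<^sup>2" using small by (intro mult_right_mono) auto
      ultimately show ?thesis by (simp add: power2_eq_square algebra_simps)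
    qed
    then have "K * t * (norm y * norm x) \<le> c / 2 * t * (norm x)\<^sup>2 + g / 8 * (norm y)\<^sup>2"
      using c by (simp only: mult_le_cancel_left_pos)
    ultimately show ?thesis by linarith
  qed
  have "\<bar>E\<^sub>3 * inner \<gamma> \<alpha>\<bar> \<le> c / 8 * t * ((norm \<alpha>)\<^sup>2 + (norm \<gamma>)\<^sup>2)"
  proof -
    have "\<bar>E\<^sub>3 * inner \<gamma> \<alpha>\<bar> \<le> c / 4 * t * (norm \<gamma> * norm \<alpha>)"
      by (rule abs_mult_bound[OF E(3) Cauchy_Schwarz_ineq2])
    also have "\<dots> \<le> c / 4 * t * (((norm \<alpha>)\<^sup>2 + (norm \<gamma>)\<^sup>2) / 2)"
      using c t sum_squares_bound[of "norm \<gamma>" "norm \<alpha>"] by (intro mult_left_mono) auto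
    finally show ?thesis by simp
  qed
  moreover note cross[OF E(1), of \<beta> \<alpha>]
  moreover have "\<bar>E\<^sub>2 * inner \<gamma> \<beta>\<bar> \<le> c / 2 * t * (norm \<gamma>)\<^sup>2 + g / 8 * (norm \<beta>)\<^sup>2"
    using cross[OF E(2), of \<beta> \<gamma>] by (simp add: inner_commute)
  moreover have "c * t * (norm \<alpha>)\<^sup>2 \<le> X\<^sub>1 * (norm \<alpha>)\<^sup>2" "c * t * (norm \<gamma>)\<^sup>2 \<le> X\<^sub>2 * (norm \<gamma>)\<^sup>2"
    "g * (norm \<beta>)\<^sup>2 \<le> X\<^sub>3 * (norm \<beta>)\<^sup>2"
    using X by (auto intro: mult_right_mono)
  moreover have "0 \<le> c * t * (norm \<alpha>)\<^sup>2" "0 \<le> c * t * (norm \<gamma>)\<^sup>2" using c t by auto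
  moreover have "0 \<le> g * (norm \<beta>)\<^sup>2"
  proof -
    have "0 \<le> c * g" using small t by (smt (verit) mult_nonneg_nonneg zero_le_power2)
    then show ?thesis using c by (simp add: zero_le_mult_iff)
  qed
  ultimately show ?thesis
    by (simp add: distrib_left flip: power2_norm_eq_inner)
qed

text \<open>The factors -s >= 1/B, w^2 >= 1/(4 B^2) and Y >= t/(2B) combine to the constant. It is
  used for the coefficients of both |u|^2 and |v'|^2, with different Y.\<close>

lemma weighted_coefficient_bound:
  fixes B s w t Y :: real
  assumes B: "B \<ge> 1" and s: "1 \<le> - B * s" and w: "1 \<le> 2 * B * w" and t: "t \<ge> 0" and Y: "t \<le> 2 * B * Y"
  shows "1 / (16 * B^4) * t \<le> - s / 2 * (w\<^sup>2 * Y)"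
proof -
  have "1 \<le> (2 * B * w)\<^sup>2" using w by simp
  then have "1 * 1 \<le> (- B * s) * (2 * B * w)\<^sup>2" using s by (intro mult_mono) auto
  then have "1 * t \<le> ((- B * s) * (2 * B * w)\<^sup>2) * (2 * B * Y)" using t Y by (intro mult_mono) auto
  also have "\<dots> = 16 * B^4 * (- s / 2 * (w\<^sup>2 * Y))" by (simp add: eval_nat_numeral)
  finally show ?thesis using B by (simp add: field_simps)
qed

text \<open>All functions are frozen at one point: indices count derivatives of p, n, \<kappa> at V,
  and z, x, x' are the derivatives of V. \<open>a\<^sub>1\<close>, \<open>a\<^sub>2\<close>,
  \<open>w\<^sub>1\<close>, \<open>w\<^sub>2\<close> are the first two derivatives of a and w in y.
  The conclusions from the fifth on are the hypotheses of
  \<open>quadratic_form_bound\<close>.\<close>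

lemma coefficient_bounds:
  fixes B \<delta> s z x x' p\<^sub>1 p\<^sub>2 p\<^sub>3 n\<^sub>0 n\<^sub>1 n\<^sub>2 n\<^sub>3 k\<^sub>0 k\<^sub>1 k\<^sub>2 :: real
  defines "a \<equiv> - p\<^sub>1 - s * n\<^sub>1 * z"
    and "a\<^sub>1 \<equiv> - p\<^sub>2 * z - s * n\<^sub>2 * z\<^sup>2 - s * n\<^sub>1 * x"
    and "a\<^sub>2 \<equiv> - p\<^sub>3 * z\<^sup>2 - p\<^sub>2 * x - s * n\<^sub>3 * z^3 - 3 * s * n\<^sub>2 * z * x - s * n\<^sub>1 * x'"
  defines "w \<equiv> 1 / a"
  defines "w\<^sub>1 \<equiv> - a\<^sub>1 * w\<^sup>2" and "w\<^sub>2 \<equiv> - a\<^sub>2 * w\<^sup>2 + 2 * a\<^sub>1\<^sup>2 * w^3"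
  assumes B: "B \<ge> 1" and \<delta>: "\<delta> \<ge> 0" "50000 * B^14 * \<delta> \<le> 1"
    and z: "z \<le> 0" "\<bar>z\<bar> \<le> \<delta>" and x: "\<bar>x\<bar> \<le> \<delta> * \<bar>z\<bar>" "\<bar>x'\<bar> \<le> \<delta> * \<bar>z\<bar>"
    and s: "\<bar>s\<bar> \<le> B" "1 \<le> - B * s"
    and p: "\<bar>p\<^sub>1\<bar> \<le> B" "\<bar>p\<^sub>2\<bar> \<le> B" "\<bar>p\<^sub>3\<bar> \<le> B" "1 \<le> - B * p\<^sub>1" "1 \<le> B * p\<^sub>2"
    and n: "\<bar>n\<^sub>0\<bar> \<le> B" "\<bar>n\<^sub>1\<bar> \<le> B" "\<bar>n\<^sub>2\<bar> \<le> B" "\<bar>n\<^sub>3\<bar> \<le> B" "1 \<le> B * n\<^sub>0"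
    and k: "\<bar>k\<^sub>0\<bar> \<le> B" "\<bar>k\<^sub>1\<bar> \<le> B" "\<bar>k\<^sub>2\<bar> \<le> B" "1 \<le> B * (k\<^sub>0 * p\<^sub>2 - k\<^sub>1 * p\<^sub>1)"
  shows "a > 0" "\<bar>w\<bar> \<le> 2 * B" "\<bar>w\<^sub>1\<bar> \<le> 8 * B^3 * \<bar>z\<bar>" "\<bar>w\<^sub>2\<bar> \<le> 96 * B^5 * \<delta> * \<bar>z\<bar>"
    "1 / (16 * B^4) * \<bar>z\<bar> \<le> s / 2 * w\<^sub>1"
    "1 / (16 * B^4) * \<bar>z\<bar> \<le> s / 2 * (w\<^sub>1 * k\<^sub>0 + w * (k\<^sub>1 * z))"
    "1 / (2 * B\<^sup>2) \<le> w * n\<^sub>0"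
    "\<bar>w\<^sub>1 * n\<^sub>0 + w * (n\<^sub>1 * z)\<bar> \<le> 18 * B^4 * \<bar>z\<bar>"
    "\<bar>2 * w\<^sub>1 * k\<^sub>0 + w * (k\<^sub>1 * z)\<bar> \<le> 18 * B^4 * \<bar>z\<bar>"
    "\<bar>w\<^sub>2 * k\<^sub>0 + w\<^sub>1 * (k\<^sub>1 * z) + w * (k\<^sub>1 * x + 1/2 * k\<^sub>2 * z\<^sup>2)\<bar> \<le> 1 / (16 * B^4) / 4 * \<bar>z\<bar>"
proof -
  define t where "t = \<bar>z\<bar>"
  have t: "t \<ge> 0" "t \<le> \<delta>" "z = - t" using z by (auto simp: t_def)
  have pow: "B ^ i \<le> B ^ j" if "i \<le> j" for i j :: nat using B that by (rule power_increasing[rotated])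
  have Bpow: "1 \<le> B ^ i" for i using B by simp
  have small: "50000 * (B ^ i * \<delta>) \<le> 1" if "i \<le> 14" for i
    using mult_right_mono[OF pow[OF that] \<delta>(1)] \<delta>(2) by linarith
  have absx: "\<bar>x\<bar> \<le> \<delta> * t" "\<bar>x'\<bar> \<le> \<delta> * t" "\<bar>z\<bar> \<le> t" "\<bar>z\<bar> \<le> \<delta>" using x z by (auto simp: t_def)
  have z2: "\<bar>z * z\<bar> \<le> \<delta> * t" by (rule abs_mult_bound[OF absx(4,3)])
  have lift: "B ^ i * y \<le> B ^ j * y" if "i \<le> j" "0 \<le> y" for i j :: nat and y
    by (rule mult_right_mono[OF pow[OF that(1)] that(2)])
  have \<delta>t: "0 \<le> \<delta> * t" using \<delta> t by simp
  have \<delta>1: "\<delta> \<le> 1" using small[of 0] \<delta> by simp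
  have \<delta>\<delta>t: "\<delta> * (\<delta> * t) \<le> \<delta> * t" using mult_right_mono[OF \<delta>1 \<delta>t] by simp
  have ap: "\<bar>a + p\<^sub>1\<bar> \<le> B^2 * t"
    using abs_mult_bound[OF abs_mult_bound[OF s(1) n(2)] absx(3)] by (simp add: a_def power2_eq_square)
  have B2t: "B ^ i * t \<le> B ^ i * \<delta>" for i using t B by (intro mult_left_mono) auto
  have a_ge: "1 \<le> 2 * B * a"
  proof -
    have "\<bar>B * (a + p\<^sub>1)\<bar> \<le> B * (B^2 * t)" by (rule abs_mult_bound[OF _ ap]) (use B in simp)
    also have "\<dots> = B^3 * t" by (simp add: power2_eq_square power3_eq_cube)
    also have "\<dots> \<le> 1 / 2" using B2t[of 3] small[of 3] by simp
    finally have "- (1/2) \<le> B * (a + p\<^sub>1)" by linarith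
    then show ?thesis using p(4) by (simp add: algebra_simps)
  qed
  show apos: "a > 0" using a_ge B by (smt (verit) mult_nonneg_nonpos)
  have a_le: "a \<le> 2 * B"
  proof -
    have "B^2 * t \<le> 1" using B2t[of 2] small[of 2] by simp
    then show ?thesis using ap p(1) B by linarith
  qed
  have wa: "w * a = 1" using apos by (simp add: w_def)
  have wpos: "w > 0" using apos by (simp add: w_def)
  have w_ge: "1 \<le> 2 * B * w" using a_le apos by (simp add: w_def field_simps)
  show w_le: "\<bar>w\<bar> \<le> 2 * B" using a_ge apos by (simp add: w_def field_simps)
  have w2: "\<bar>w\<^sup>2\<bar> \<le> 4 * B^2" using abs_mult_bound[OF w_le w_le] by (simp add: power2_eq_square)
  have w3: "\<bar>w^3\<bar> \<le> 8 * B^3" using abs_mult_bound[OF w2 w_le] by (simp add: power2_eq_square power3_eq_cube)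
  \<comment> \<open>The part of \<open>a\<^sub>1\<close> that is small relative to z; the rest is
    p'' |z|, which gives the sign.\<close>
  define e where "e = - s * n\<^sub>2 * z\<^sup>2 - s * n\<^sub>1 * x"
  have a1: "a\<^sub>1 = p\<^sub>2 * t + e" by (simp add: a\<^sub>1_def e_def t(3))
  have e: "\<bar>e\<bar> \<le> 2 * B^2 * (\<delta> * t)"
    using abs_mult_bound[OF abs_mult_bound[OF s(1) n(3)] z2] abs_mult_bound[OF abs_mult_bound[OF s(1) n(2)] absx(1)]
    unfolding e_def by (simp add: power2_eq_square)
  have a1_le: "\<bar>a\<^sub>1\<bar> \<le> 2 * B * t"
  proof -
    have "2 * B^2 * \<delta> * t \<le> 1 * t" using small[of 2] t(1) by (intro mult_right_mono) auto
    also have "\<dots> \<le> B * t" using B t(1) by (intro mult_right_mono) auto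
    finally have "2 * B^2 * (\<delta> * t) \<le> B * t" by (simp add: mult.assoc)
    moreover have "\<bar>p\<^sub>2 * t\<bar> \<le> B * t" by (rule abs_mult_bound[OF p(2)]) (use t in simp)
    ultimately show ?thesis using e unfolding a1 by linarith
  qed
  have a1_ge: "t \<le> 2 * B * a\<^sub>1"
  proof -
    have "\<bar>B * e\<bar> \<le> B * (2 * B^2 * (\<delta> * t))" by (rule abs_mult_bound[OF _ e]) (use B in simp)
    also have "\<dots> = 2 * (B^3 * \<delta>) * t" by (simp add: power2_eq_square power3_eq_cube)
    also have "\<dots> \<le> 1 / 2 * t" using small[of 3] t(1) by (intro mult_right_mono) auto
    finally have "- (1 / 2 * t) \<le> B * e" by linarith
    moreover have "1 * t \<le> B * p\<^sub>2 * t" using p(5) t(1) by (intro mult_right_mono) auto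
    ultimately show ?thesis unfolding a1 by (simp add: algebra_simps)
  qed
  have a2_le: "\<bar>a\<^sub>2\<bar> \<le> 8 * B^2 * (\<delta> * t)"
  proof -
    have "\<bar>p\<^sub>3 * (z * z)\<bar> \<le> B * (\<delta> * t)" "\<bar>p\<^sub>2 * x\<bar> \<le> B * (\<delta> * t)"
      by (intro abs_mult_bound p z2 absx)+
    moreover have "\<bar>s * n\<^sub>3 * (z * (z * z))\<bar> \<le> B * B * (\<delta> * (\<delta> * t))" "\<bar>s * n\<^sub>2 * (z * x)\<bar> \<le> B * B * (\<delta> * (\<delta> * t))"
      "\<bar>s * n\<^sub>1 * x'\<bar> \<le> B * B * (\<delta> * t)"
      by (intro abs_mult_bound s n z2 absx)+
    moreover have "B * (\<delta> * t) \<le> B * B * (\<delta> * t)" using lift[of 1 2 "\<delta> * t"] \<delta>t by (simp add: power2_eq_square)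
    moreover have "B * B * (\<delta> * (\<delta> * t)) \<le> B * B * (\<delta> * t)" by (rule mult_left_mono[OF \<delta>\<delta>t]) (use B in simp)
    moreover have "a\<^sub>2 = - (p\<^sub>3 * (z * z)) - p\<^sub>2 * x - s * n\<^sub>3 * (z * (z * z)) - 3 * (s * n\<^sub>2 * (z * x)) - s * n\<^sub>1 * x'"
      by (simp add: a\<^sub>2_def power2_eq_square power3_eq_cube)
    ultimately show ?thesis using \<delta>t by (simp add: power2_eq_square)
  qed
  have w1_le: "\<bar>w\<^sub>1\<bar> \<le> 8 * B^3 * t"
    using abs_mult_bound[OF a1_le w2] by (simp add: w\<^sub>1_def abs_mult power2_eq_square power3_eq_cube mult_ac)
  then show "\<bar>w\<^sub>1\<bar> \<le> 8 * B^3 * \<bar>z\<bar>" by (simp add: t_def)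
  have w2_le: "\<bar>w\<^sub>2\<bar> \<le> 96 * (B^5 * (\<delta> * t))"
  proof -
    have "\<bar>a\<^sub>2 * w\<^sup>2\<bar> \<le> 8 * B^2 * (\<delta> * t) * (4 * B^2)" by (rule abs_mult_bound[OF a2_le w2])
    also have "\<dots> = 32 * (B^4 * (\<delta> * t))" by (simp add: eval_nat_numeral)
    also have "\<dots> \<le> 32 * (B^5 * (\<delta> * t))" using lift[of 4 5 "\<delta> * t"] \<delta>t by simp
    finally have "\<bar>a\<^sub>2 * w\<^sup>2\<bar> \<le> 32 * (B^5 * (\<delta> * t))" .
    moreover have "\<bar>a\<^sub>1 * a\<^sub>1 * w^3\<bar> \<le> 32 * (B^5 * (\<delta> * t))"
    proof -
      have "\<bar>a\<^sub>1 * a\<^sub>1 * w^3\<bar> \<le> 2 * B * t * (2 * B * t) * (8 * B^3)"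
        by (intro abs_mult_bound a1_le w3)
      also have "\<dots> = 32 * (B^5 * (t * t))" by (simp add: eval_nat_numeral)
      also have "\<dots> \<le> 32 * (B^5 * (\<delta> * t))"
        using t B by (intro mult_left_mono mult_right_mono) auto
      finally show ?thesis .
    qed
    moreover have "w\<^sub>2 = - (a\<^sub>2 * w\<^sup>2) + 2 * (a\<^sub>1 * a\<^sub>1 * w^3)"
      unfolding w\<^sub>2_def by (simp add: power2_eq_square)
    ultimately show ?thesis by linarith
  qed
  then show "\<bar>w\<^sub>2\<bar> \<le> 96 * B^5 * \<delta> * \<bar>z\<bar>" by (simp add: t_def mult.assoc)
  show "1 / (16 * B^4) * \<bar>z\<bar> \<le> s / 2 * w\<^sub>1"
    using weighted_coefficient_bound[OF B s(2) w_ge t(1) a1_ge] by (simp add: w\<^sub>1_def t_def mult_ac)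
  show "1 / (16 * B^4) * \<bar>z\<bar> \<le> s / 2 * (w\<^sub>1 * k\<^sub>0 + w * (k\<^sub>1 * z))"
  proof -
    \<comment> \<open>Since w^2 a = w, the derivative of the product of w and \<kappa> is - w^2 Y.
      The leading part of Y is |z| times the quantity M at V, so this is where M > 0 enters.\<close>
    define Y where "Y = a\<^sub>1 * k\<^sub>0 - a * (k\<^sub>1 * z)"
    have Y: "Y = t * (k\<^sub>0 * p\<^sub>2 - k\<^sub>1 * p\<^sub>1) + (e * k\<^sub>0 + (a + p\<^sub>1) * k\<^sub>1 * t)"
      by (simp add: Y_def a1 t(3) algebra_simps)
    have "\<bar>e * k\<^sub>0\<bar> \<le> 2 * B^2 * (\<delta> * t) * B" by (rule abs_mult_bound[OF e k(1)])
    moreover have "\<bar>(a + p\<^sub>1) * k\<^sub>1 * t\<bar> \<le> B^2 * t * B * \<delta>"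
      by (intro abs_mult_bound ap k) (use t in simp)
    ultimately have "\<bar>e * k\<^sub>0 + (a + p\<^sub>1) * k\<^sub>1 * t\<bar> \<le> 3 * B^3 * (\<delta> * t)"
      by (simp add: power2_eq_square power3_eq_cube mult_ac)
    then have "\<bar>B * (e * k\<^sub>0 + (a + p\<^sub>1) * k\<^sub>1 * t)\<bar> \<le> B * (3 * B^3 * (\<delta> * t))"
      by (intro abs_mult_bound) (use B in simp_all)
    also have "\<dots> = 3 * (B^4 * \<delta>) * t" by (simp add: eval_nat_numeral)
    also have "\<dots> \<le> 1 / 2 * t" using small[of 4] t(1) by (intro mult_right_mono) auto
    finally have "- (1 / 2 * t) \<le> B * (e * k\<^sub>0 + (a + p\<^sub>1) * k\<^sub>1 * t)" by linarith
    moreover have "1 * t \<le> B * (k\<^sub>0 * p\<^sub>2 - k\<^sub>1 * p\<^sub>1) * t" using k(4) t(1) by (intro mult_right_mono) auto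
    ultimately have "t \<le> 2 * B * Y" unfolding Y by (simp add: algebra_simps)
    from weighted_coefficient_bound[OF B s(2) w_ge t(1) this]
    have "1 / (16 * B^4) * t \<le> - s / 2 * (w\<^sup>2 * Y)" .
    moreover have "w\<^sup>2 * a = w" using wa by (simp add: power2_eq_square mult.assoc)
    then have "w\<^sup>2 * Y = - (w\<^sub>1 * k\<^sub>0 + w * (k\<^sub>1 * z))"
      by (simp add: Y_def w\<^sub>1_def right_diff_distrib mult.assoc[symmetric])
    moreover have "- s / 2 * - S = s / 2 * S" for S by simp
    ultimately show ?thesis unfolding t_def by metis
  qed
  show "1 / (2 * B\<^sup>2) \<le> w * n\<^sub>0"
  proof -
    have "1 * 1 \<le> (2 * B * w) * (B * n\<^sub>0)" using w_ge n(5) by (intro mult_mono) auto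
    then show ?thesis using B by (simp add: field_simps power2_eq_square)
  qed
  have B34: "B^2 * t \<le> B^4 * t" using lift[of 2 4 t] t by simp
  have cross: "\<bar>w\<^sub>1 * c\<bar> \<le> 8 * (B^4 * t)" "\<bar>w * (c * z)\<bar> \<le> 2 * (B^4 * t)" if "\<bar>c\<bar> \<le> B" for c
  proof -
    show "\<bar>w\<^sub>1 * c\<bar> \<le> 8 * (B^4 * t)"
      using abs_mult_bound[OF w1_le that] by (simp add: eval_nat_numeral mult_ac)
    have "\<bar>w * (c * z)\<bar> \<le> 2 * B * (B * t)" by (intro abs_mult_bound w_le that absx)
    then show "\<bar>w * (c * z)\<bar> \<le> 2 * (B^4 * t)" using B34 by (simp add: power2_eq_square mult.assoc)
  qed
  have B4t: "0 \<le> B^4 * t" using B t by simp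
  show "\<bar>w\<^sub>1 * n\<^sub>0 + w * (n\<^sub>1 * z)\<bar> \<le> 18 * B^4 * \<bar>z\<bar>"
    using cross(1)[OF n(1)] cross(2)[OF n(2)] B4t unfolding t_def by (simp add: mult.assoc)
  show "\<bar>2 * w\<^sub>1 * k\<^sub>0 + w * (k\<^sub>1 * z)\<bar> \<le> 18 * B^4 * \<bar>z\<bar>"
    using cross(1)[OF k(1)] cross(2)[OF k(2)] B4t unfolding t_def by (simp add: mult.assoc)
  show "\<bar>w\<^sub>2 * k\<^sub>0 + w\<^sub>1 * (k\<^sub>1 * z) + w * (k\<^sub>1 * x + 1/2 * k\<^sub>2 * z\<^sup>2)\<bar> \<le> 1 / (16 * B^4) / 4 * \<bar>z\<bar>"
  proof -
    have "\<bar>w\<^sub>2 * k\<^sub>0\<bar> \<le> 96 * (B^5 * (\<delta> * t)) * B" by (rule abs_mult_bound[OF w2_le k(1)])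
    then have 1: "\<bar>w\<^sub>2 * k\<^sub>0\<bar> \<le> 96 * (B^6 * (\<delta> * t))" by (simp add: eval_nat_numeral mult_ac)
    have "\<bar>w\<^sub>1 * (k\<^sub>1 * z)\<bar> \<le> 8 * B^3 * t * (B * \<delta>)" by (intro abs_mult_bound w1_le k absx)
    also have "\<dots> = 8 * (B^4 * (\<delta> * t))" by (simp add: eval_nat_numeral mult_ac)
    also have "\<dots> \<le> 8 * (B^6 * (\<delta> * t))" using lift[of 4 6 "\<delta> * t"] \<delta>t by simp
    finally have 2: "\<bar>w\<^sub>1 * (k\<^sub>1 * z)\<bar> \<le> 8 * (B^6 * (\<delta> * t))" .
    have "\<bar>k\<^sub>1 * x\<bar> \<le> B * (\<delta> * t)" "\<bar>k\<^sub>2 * (z * z)\<bar> \<le> B * (\<delta> * t)"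
      by (intro abs_mult_bound k absx z2)+
    then have "\<bar>k\<^sub>1 * x + 1/2 * k\<^sub>2 * z\<^sup>2\<bar> \<le> 2 * B * (\<delta> * t)" by (simp add: power2_eq_square)
    from abs_mult_bound[OF w_le this]
    have "\<bar>w * (k\<^sub>1 * x + 1/2 * k\<^sub>2 * z\<^sup>2)\<bar> \<le> 4 * (B^2 * (\<delta> * t))" by (simp add: power2_eq_square mult_ac)
    also have "\<dots> \<le> 4 * (B^6 * (\<delta> * t))" using lift[of 2 6 "\<delta> * t"] \<delta>t by simp
    finally have "\<bar>w\<^sub>2 * k\<^sub>0 + w\<^sub>1 * (k\<^sub>1 * z) + w * (k\<^sub>1 * x + 1/2 * k\<^sub>2 * z\<^sup>2)\<bar> \<le> 108 * (B^6 * (\<delta> * t))"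
    proof -
      assume 3: "\<bar>w * (k\<^sub>1 * x + 1/2 * k\<^sub>2 * z\<^sup>2)\<bar> \<le> 4 * (B^6 * (\<delta> * t))"
      have "\<bar>w\<^sub>2 * k\<^sub>0 + w\<^sub>1 * (k\<^sub>1 * z) + w * (k\<^sub>1 * x + 1/2 * k\<^sub>2 * z\<^sup>2)\<bar>
          \<le> 96 * (B^6 * (\<delta> * t)) + 8 * (B^6 * (\<delta> * t)) + 4 * (B^6 * (\<delta> * t))"
        by (intro order.trans[OF abs_triangle_ineq] add_mono 1 2 3)
      also have "\<dots> = 108 * (B^6 * (\<delta> * t))" by (simp only: flip: distrib_right) simp
      finally show ?thesis .
    qed
    then have "64 * B^4 * \<bar>w\<^sub>2 * k\<^sub>0 + w\<^sub>1 * (k\<^sub>1 * z) + w * (k\<^sub>1 * x + 1/2 * k\<^sub>2 * z\<^sup>2)\<bar>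
        \<le> 64 * B^4 * (108 * (B^6 * (\<delta> * t)))"
      using B by (intro mult_left_mono) auto
    also have "\<dots> = 6912 * (B^10 * \<delta>) * t" by (simp add: eval_nat_numeral)
    also have "\<dots> \<le> 1 * t" using small[of 10] t(1) by (intro mult_right_mono) auto
    finally show ?thesis using B by (simp add: t_def field_simps)
  qed
qed

section \<open>Spectral stability\<close>

lemma eventually_bounded_if_isCont:
  fixes F :: "(real \<Rightarrow> real) set"
  assumes "finite F" "\<And>f. f \<in> F \<Longrightarrow> isCont f a"
  shows "\<exists>B\<ge>1. eventually (\<lambda>v. \<forall>f\<in>F. \<bar>f v\<bar> \<le> B) (nhds a)"
  using assms
proof (induction F rule: finite_induct)
  case empty
  then show ?case by auto
next
  case (insert f F)
  then obtain B where B: "B \<ge> 1" "eventually (\<lambda>v. \<forall>f\<in>F. \<bar>f v\<bar> \<le> B) (nhds a)" by auto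
  have "((\<lambda>v. \<bar>f v\<bar>) \<longlongrightarrow> \<bar>f a\<bar>) (nhds a)"
    using insert.prems[of f] by (auto intro!: tendsto_rabs simp: continuous_at tendsto_nhds_iff)
  then have "eventually (\<lambda>v. \<bar>f v\<bar> < \<bar>f a\<bar> + 1) (nhds a)" by (rule order_tendstoD) simp
  with B(2) have "eventually (\<lambda>v. \<forall>g\<in>insert f F. \<bar>g v\<bar> \<le> max B (\<bar>f a\<bar> + 1)) (nhds a)"
    by eventually_elim (auto simp: le_max_iff_disj)
  then show ?case using B(1) by (intro exI[of _ "max B (\<bar>f a\<bar> + 1)"]) auto
qed

text \<open>Including the reciprocals 1 / f among the continuous functions to be bounded turns lower
  bounds into upper ones. The required signs near a are hypotheses, except for M, whose sign
  persists by continuity.\<close>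

lemma admissible_neighbourhood:
  fixes p n \<kappa> :: "real \<Rightarrow> real"
  assumes smooth: "smooth_on {0<..} p" "smooth_on {0<..} n" "smooth_on {0<..} \<kappa>"
    and pos: "\<And>v. v > 0 \<Longrightarrow> n v > 0" "\<And>v. v > 0 \<Longrightarrow> \<kappa> v > 0"
      "\<And>v. v > 0 \<Longrightarrow> deriv p v < 0" "\<And>v. v > 0 \<Longrightarrow> deriv (deriv p) v > 0"
    and a: "a > 0" and M: "- deriv \<kappa> a * deriv p a + \<kappa> a * deriv (deriv p) a > 0"
  obtains B d where "B \<ge> 1" "d > 0" "\<And>v. \<bar>v - a\<bar> < d \<Longrightarrow> admissible p n \<kappa> B v"
proof -
  let ?M = "\<lambda>v. \<kappa> v * deriv (deriv p) v - deriv \<kappa> v * deriv p v"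
  let ?F = "{deriv p, deriv (deriv p), deriv (deriv (deriv p)), n, deriv n, deriv (deriv n),
         deriv (deriv (deriv n)), \<kappa>, deriv \<kappa>, deriv (deriv \<kappa>)}"
  let ?H = "{n, \<kappa>, deriv p, deriv (deriv p), ?M}"
  let ?G = "(\<lambda>f v. 1 / f v) ` ?H"
  have cont: "isCont f a" if "smooth_on {0<..} f" for f
    using smooth_on_has_derivative[OF that] a by (auto intro: DERIV_isCont)
  have F: "isCont f a" if "f \<in> ?F" for f
    using that smooth by (auto intro!: cont smooth_on_deriv)
  have contM: "isCont ?M a" by (intro continuous_intros F) auto
  have "?M a > 0" using M by (simp add: algebra_simps)
  then have "\<forall>f\<in>?H. isCont f a \<and> f a \<noteq> 0"
    using pos[OF a] F contM by simp
  then have G: "isCont g a" if "g \<in> ?G" for g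
    using that by (auto simp del: insert_iff intro!: isCont_divide)
  obtain B where B: "B \<ge> 1" "eventually (\<lambda>v. \<forall>f\<in>?F \<union> ?G. \<bar>f v\<bar> \<le> B) (nhds a)"
    using eventually_bounded_if_isCont[of "?F \<union> ?G" a] F G by blast
  have M_ev: "eventually (\<lambda>v. 0 < ?M v) (nhds a)"
  proof (rule order_tendstoD(1)[OF _ \<open>?M a > 0\<close>])
    show "(?M \<longlongrightarrow> ?M a) (nhds a)"
      using contM tendsto_at_iff_tendsto_nhds[of ?M a] unfolding continuous_at by simp
  qed
  have pos_ev: "eventually (\<lambda>v. 0 < v) (nhds a)"
    using order_tendstoD(1)[OF filterlim_ident a] by simp
  have one_le: "1 \<le> B * y" if "\<bar>1 / y\<bar> \<le> B" "y > 0" for y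
    using that by (simp add: field_simps)
  have "eventually (\<lambda>v. admissible p n \<kappa> B v) (nhds a)"
    using B(2) M_ev pos_ev
  proof eventually_elim
    case (elim v)
    have le: "\<bar>1 / f v\<bar> \<le> B" if "f \<in> ?H" for f
    proof -
      have "(\<lambda>v. 1 / f v) \<in> ?F \<union> ?G" by (rule UnI2, rule imageI, rule that)
      then show ?thesis by (rule elim(1)[rule_format])
    qed
    have "1 \<le> B * n v" "1 \<le> B * \<kappa> v" "1 \<le> B * deriv (deriv p) v" "1 \<le> B * ?M v"
      using le[of n] le[of \<kappa>] le[of "deriv (deriv p)"] le[of ?M] elim(2) pos[OF elim(3)]
      by (auto simp del: abs_divide intro!: one_le)
    moreover have "1 \<le> B * - deriv p v"
      using le[of "deriv p"] pos(3)[OF elim(3)] by (intro one_le) auto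
    ultimately show ?case using elim unfolding admissible_def by (intro conjI) auto
  qed
  then obtain d where "d > 0" "\<And>v. dist v a < d \<Longrightarrow> admissible p n \<kappa> B v"
    by (auto simp: eventually_nhds_metric)
  then show ?thesis using that B(1) by (auto simp: dist_real_def)
qed

section \<open>Absence of unstable eigenfunctions\<close>

context travelling_wave
begin

lemma no_unstable_eigenfunction:
  fixes v v1 v2 v3 u u1 u2 :: "real \<Rightarrow> complex" and \<nu> :: complex
  assumes B: "B \<ge> 1" and adm: "\<And>v. \<bar>v - Vm\<bar> \<le> Vm - Vp \<Longrightarrow> admissible p n \<kappa> B v"
    and small: "288 * B^8 * (50000 * B^14 * (Vm - Vp)) \<le> 1"
    and wd: "weakly_differentiable v v1" "weakly_differentiable v1 v2" "weakly_differentiable v2 v3"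
      "weakly_differentiable u u1" "weakly_differentiable u1 u2"
    and eq1: "AE y in lborel. \<nu> * v y = s *\<^sub>R v1 y + u1 y"
    and eq2: "AE y in lborel. \<nu> * u y = s *\<^sub>R u1 y
      + ((- deriv p (V y) - s * deriv n (V y) * z y) - (deriv \<kappa> (V y) * x y + 1/2 * deriv (deriv \<kappa>) (V y) * (z y)\<^sup>2)) *\<^sub>R v1 y
      + n (V y) *\<^sub>R u2 y - \<kappa> (V y) *\<^sub>R v3 y - (deriv \<kappa> (V y) * z y) *\<^sub>R v2 y"
    and Re: "Re \<nu> \<ge> 0"
  shows "(AE y in lborel. v y = 0) \<and> (AE y in lborel. u y = 0)"
proof -
  \<comment> \<open>The most demanding condition is that of \<open>quadratic_form_bound\<close>,
    which amounts to 41472 B^14 |V'| <= 1; 50000 is a round number above it.\<close>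
  define \<delta> where "\<delta> = 1 / (50000 * B^14)"
  have Bpow: "1 \<le> B ^ i" for i using B by simp
  have \<delta>: "\<delta> > 0" "50000 * B^14 * \<delta> = 1" using B by (auto simp: \<delta>_def)
  have \<delta>1: "\<delta> \<le> 1" using \<delta> le_mult_ge_one[of "50000 * B^14" \<delta>] Bpow[of 14] by linarith
  have small': "288 * B^8 * (Vm - Vp) \<le> \<delta>"
    using small B by (simp add: \<delta>_def field_simps)
  have slow: "\<bar>s\<bar> \<le> B" "1 \<le> - B * s" "z y < 0" "\<bar>z y\<bar> \<le> \<delta>" "\<bar>x y\<bar> \<le> \<delta> * \<bar>z y\<bar>" "\<bar>x' y\<bar> \<le> \<delta> * \<bar>z y\<bar>" for y
    by - (rule slow_profile[OF B adm \<delta>(1) \<delta>1 small'], assumption)+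
  define a where "a y = - deriv p (V y) - s * deriv n (V y) * z y" for y
  define a\<^sub>1 where "a\<^sub>1 y = - deriv (deriv p) (V y) * z y - s * deriv (deriv n) (V y) * (z y)\<^sup>2 - s * deriv n (V y) * x y" for y
  define a\<^sub>2 where "a\<^sub>2 y = - deriv (deriv (deriv p)) (V y) * (z y)\<^sup>2 - deriv (deriv p) (V y) * x y
    - s * deriv (deriv (deriv n)) (V y) * (z y)^3 - 3 * s * deriv (deriv n) (V y) * z y * x y - s * deriv n (V y) * x' y" for y
  define w where "w y = 1 / a y" for y
  define w\<^sub>1 where "w\<^sub>1 y = - a\<^sub>1 y * (w y)\<^sup>2" for y
  define w\<^sub>2 where "w\<^sub>2 y = - a\<^sub>2 y * (w y)\<^sup>2 + 2 * (a\<^sub>1 y)\<^sup>2 * (w y)^3" for y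
  have "admissible p n \<kappa> B (V y)" for y using adm V_near by blast
  then have A: "\<bar>deriv p (V y)\<bar> \<le> B" "\<bar>deriv (deriv p) (V y)\<bar> \<le> B" "\<bar>deriv (deriv (deriv p)) (V y)\<bar> \<le> B"
    "1 \<le> - B * deriv p (V y)" "1 \<le> B * deriv (deriv p) (V y)"
    "\<bar>n (V y)\<bar> \<le> B" "\<bar>deriv n (V y)\<bar> \<le> B" "\<bar>deriv (deriv n) (V y)\<bar> \<le> B" "\<bar>deriv (deriv (deriv n)) (V y)\<bar> \<le> B"
    "1 \<le> B * n (V y)"
    "\<bar>\<kappa> (V y)\<bar> \<le> B" "\<bar>deriv \<kappa> (V y)\<bar> \<le> B" "\<bar>deriv (deriv \<kappa>) (V y)\<bar> \<le> B"
    "1 \<le> B * (\<kappa> (V y) * deriv (deriv p) (V y) - deriv \<kappa> (V y) * deriv p (V y))" for y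
    by (simp_all add: admissible_def)
  have zle: "z y \<le> 0" and \<delta>0: "\<delta> \<ge> 0" and \<delta>2: "50000 * B^14 * \<delta> \<le> 1" for y
    using slow(3)[of y] \<delta> by auto
  note cb = coefficient_bounds[OF B \<delta>0 \<delta>2 zle slow(4) slow(5) slow(6) slow(1) slow(2) A]

  have c: "a y > 0" "\<bar>w y\<bar> \<le> 2 * B" "\<bar>w\<^sub>1 y\<bar> \<le> 8 * B^3 * \<bar>z y\<bar>" "\<bar>w\<^sub>2 y\<bar> \<le> 96 * B^5 * \<delta> * \<bar>z y\<bar>"
    "1 / (16 * B^4) * \<bar>z y\<bar> \<le> s / 2 * w\<^sub>1 y"
    "1 / (16 * B^4) * \<bar>z y\<bar> \<le> s / 2 * (w\<^sub>1 y * \<kappa> (V y) + w y * (deriv \<kappa> (V y) * z y))"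
    "1 / (2 * B\<^sup>2) \<le> w y * n (V y)"
    "\<bar>w\<^sub>1 y * n (V y) + w y * (deriv n (V y) * z y)\<bar> \<le> 18 * B^4 * \<bar>z y\<bar>"
    "\<bar>2 * w\<^sub>1 y * \<kappa> (V y) + w y * (deriv \<kappa> (V y) * z y)\<bar> \<le> 18 * B^4 * \<bar>z y\<bar>"
    "\<bar>w\<^sub>2 y * \<kappa> (V y) + w\<^sub>1 y * (deriv \<kappa> (V y) * z y)
        + w y * (deriv \<kappa> (V y) * x y + 1/2 * deriv (deriv \<kappa>) (V y) * (z y)\<^sup>2)\<bar> \<le> 1 / (16 * B^4) / 4 * \<bar>z y\<bar>" for y
    unfolding w_def w\<^sub>1_def w\<^sub>2_def a_def a\<^sub>1_def a\<^sub>2_def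
    by - (rule cb(1), rule cb(2), rule cb(3), rule cb(4), rule cb(5), rule cb(6), rule cb(7), rule cb(8), rule cb(9), rule cb(10))
  have cder: "v > 0 \<Longrightarrow> (deriv (deriv p) has_real_derivative deriv (deriv (deriv p)) v) (at v)"
    "v > 0 \<Longrightarrow> (deriv n has_real_derivative deriv (deriv n) v) (at v)"
    "v > 0 \<Longrightarrow> (deriv (deriv n) has_real_derivative deriv (deriv (deriv n)) v) (at v)" for v
    using smooth by (auto intro!: smooth_on_has_derivative[of "{0<..}"] smooth_on_deriv)
  note comp = comp_der[of p "deriv p"] comp_der[of "deriv p" "deriv (deriv p)"]
    comp_der[of "deriv (deriv p)" "deriv (deriv (deriv p))"] comp_der[of n "deriv n"]
    comp_der[of "deriv n" "deriv (deriv n)"] comp_der[of "deriv (deriv n)" "deriv (deriv (deriv n))"]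
    comp_der[of \<kappa> "deriv \<kappa>"] comp_der[of "deriv \<kappa>" "deriv (deriv \<kappa>)"]
  have a_der: "(a has_real_derivative a\<^sub>1 y) (at y)" for y
    unfolding a_def[abs_def] a\<^sub>1_def
    by (auto intro!: derivative_eq_intros comp coeff_der cder der simp: power2_eq_square algebra_simps)
  have a1_der: "(a\<^sub>1 has_real_derivative a\<^sub>2 y) (at y)" for y
    unfolding a\<^sub>1_def[abs_def] a\<^sub>2_def
    by (auto intro!: derivative_eq_intros comp coeff_der cder der simp: power2_eq_square power3_eq_cube algebra_simps)
  have w_der: "(w has_real_derivative w\<^sub>1 y) (at y)" for y
    unfolding w_def[abs_def] w\<^sub>1_def using c(1)[of y]
    by (auto intro!: derivative_eq_intros a_der simp: power2_eq_square field_simps)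
  have w1_der: "(w\<^sub>1 has_real_derivative w\<^sub>2 y) (at y)" for y
    unfolding w\<^sub>1_def[abs_def] w\<^sub>2_def
    by (auto intro!: derivative_eq_intros a1_der w_der simp: w\<^sub>1_def power2_eq_square power3_eq_cube algebra_simps)
  have contV: "continuous_on UNIV V" using smooth(4) by (rule continuous_on_smooth)
  have cont_comp: "continuous_on UNIV (\<lambda>y. f (V y))" if "smooth_on {0<..} f" for f
  proof (rule continuous_on_compose2[OF _ contV])
    show "continuous_on {0<..} f"
      using smooth_on_has_derivative[OF that] by (auto intro!: continuous_at_imp_continuous_on DERIV_isCont)
    show "range V \<subseteq> {0<..}" using V_pos by auto
  qed
  have cont_z: "continuous_on UNIV z" "continuous_on UNIV x" "continuous_on UNIV x'"
    using smooth(4) by (auto intro!: continuous_on_smooth smooth_on_deriv)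
  have cont_w: "continuous_on UNIV w"
    using w_der by (blast intro: continuous_at_imp_continuous_on DERIV_isCont)
  have "continuous_on UNIV w\<^sub>2"
    unfolding w\<^sub>2_def[abs_def] a\<^sub>2_def a\<^sub>1_def
    using smooth by (intro continuous_intros cont_comp cont_z cont_w smooth_on_deriv)
  moreover have "continuous_on UNIV (\<lambda>y. deriv n (V y) * z y)" "continuous_on UNIV (\<lambda>y. deriv \<kappa> (V y) * z y)"
    using smooth by (auto intro!: continuous_intros cont_comp cont_z smooth_on_deriv)
  moreover have z1: "\<bar>z y\<bar> \<le> 1" for y using slow(4)[of y] \<delta>1 by linarith
  have B5: "B ^ i \<le> 96 * B^5" if "i \<le> 5" for i
    using power_increasing[OF that B] Bpow[of 5] by linarith
  have bounds: "\<bar>w y\<bar> \<le> 96 * B^5" "\<bar>w\<^sub>1 y\<bar> \<le> 96 * B^5" "\<bar>w\<^sub>2 y\<bar> \<le> 96 * B^5"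
    "\<bar>n (V y)\<bar> \<le> 96 * B^5" "\<bar>deriv n (V y) * z y\<bar> \<le> 96 * B^5"
    "\<bar>\<kappa> (V y)\<bar> \<le> 96 * B^5" "\<bar>deriv \<kappa> (V y) * z y\<bar> \<le> 96 * B^5" for y
  proof -
    have B1: "B \<le> 48 * B^5" using power_increasing[OF _ B, of 1 5] Bpow[of 5] by simp
    then show "\<bar>w y\<bar> \<le> 96 * B^5" using c(2)[of y] by linarith
    have "8 * B^3 * \<bar>z y\<bar> \<le> 8 * B^3 * 1" using z1[of y] B by (intro mult_left_mono) auto
    also have "\<dots> \<le> 96 * B^5" using power_increasing[OF _ B, of 3 5] Bpow[of 5] by simp
    finally show "\<bar>w\<^sub>1 y\<bar> \<le> 96 * B^5" using c(3)[of y] by linarith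
    have "\<delta> * \<bar>z y\<bar> \<le> 1" using \<delta>0 \<delta>1 z1[of y] by (simp add: mult_le_one)
    then have "96 * B^5 * (\<delta> * \<bar>z y\<bar>) \<le> 96 * B^5 * 1" using B by (intro mult_left_mono) auto
    then show "\<bar>w\<^sub>2 y\<bar> \<le> 96 * B^5" using c(4)[of y] by (simp add: mult.assoc)
    show "\<bar>n (V y)\<bar> \<le> 96 * B^5" "\<bar>\<kappa> (V y)\<bar> \<le> 96 * B^5"
      using A(6,11)[of y] B1 B by auto
    show "\<bar>deriv n (V y) * z y\<bar> \<le> 96 * B^5" "\<bar>deriv \<kappa> (V y) * z y\<bar> \<le> 96 * B^5"
      using abs_mult_bound[OF A(7)[of y] z1[of y]] abs_mult_bound[OF A(12)[of y] z1[of y]] B1 B by auto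
  qed
  have form: "1 / (16 * B^4) / 4 * \<bar>z y\<bar> * (inner \<alpha> \<alpha> + inner \<gamma> \<gamma>) \<le>
      s / 2 * w\<^sub>1 y * inner \<alpha> \<alpha> + w y * n (V y) * inner \<beta> \<beta>
      + s / 2 * (w\<^sub>1 y * \<kappa> (V y) + w y * (deriv \<kappa> (V y) * z y)) * inner \<gamma> \<gamma>
      + (w\<^sub>1 y * n (V y) + w y * (deriv n (V y) * z y)) * inner \<beta> \<alpha>
      + (2 * w\<^sub>1 y * \<kappa> (V y) + w y * (deriv \<kappa> (V y) * z y)) * inner \<gamma> \<beta>
      + (w\<^sub>2 y * \<kappa> (V y) + w\<^sub>1 y * (deriv \<kappa> (V y) * z y)
          + w y * (deriv \<kappa> (V y) * x y + 1/2 * deriv (deriv \<kappa>) (V y) * (z y)\<^sup>2)) * inner \<gamma> \<alpha>"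
    for y and \<alpha> \<beta> \<gamma> :: complex
  proof (rule quadratic_form_bound[OF _ _ c(5) c(6) c(7) c(8) c(9) c(10)])
    have "4 * (18 * B^4)\<^sup>2 * \<bar>z y\<bar> \<le> 4 * (18 * B^4)\<^sup>2 * \<delta>" using slow(4)[of y] by (intro mult_left_mono) auto
    \<comment> \<open>The factor 32 B^6 = 16 B^4 * 2 B^2 clears the denominators of the lower bounds
      for the two squares and for the diffusion.\<close>
    then have "32 * B^6 * (4 * (18 * B^4)\<^sup>2 * \<bar>z y\<bar>) \<le> 32 * B^6 * (4 * (18 * B^4)\<^sup>2 * \<delta>)"
      using B by (intro mult_left_mono) auto
    also have "\<dots> = 41472 * (B^14 * \<delta>)" by (simp add: power2_eq_square eval_nat_numeral)
    also have "\<dots> \<le> 1" using \<delta> by simp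
    finally show "4 * (18 * B^4)\<^sup>2 * \<bar>z y\<bar> \<le> 1 / (16 * B^4) * (1 / (2 * B\<^sup>2))"
      using B by (simp add: field_simps eval_nat_numeral)
  qed (use B in auto)
  show ?thesis
  proof (rule energy_estimate[where a = a and w = w and w' = w\<^sub>1 and w'' = w\<^sub>2 and b = "\<lambda>y. n (V y)"
        and b' = "\<lambda>y. deriv n (V y) * z y" and k = "\<lambda>y. \<kappa> (V y)" and k' = "\<lambda>y. deriv \<kappa> (V y) * z y"
        and c = "\<lambda>y. deriv \<kappa> (V y) * x y + 1/2 * deriv (deriv \<kappa>) (V y) * (z y)\<^sup>2"
        and r = "\<lambda>y. 1 / (16 * B^4) / 4 * \<bar>z y\<bar>" and B = "96 * B^5" and z = \<nu> and s = s,
        OF wd eq1 _ _ w_der w1_der _ _ _ _ _ bounds _ _ _ Re form])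
    show "AE y in lborel. \<nu> * u y = s *\<^sub>R u1 y
        + (a y - (deriv \<kappa> (V y) * x y + 1/2 * deriv (deriv \<kappa>) (V y) * (z y)\<^sup>2)) *\<^sub>R v1 y
        + n (V y) *\<^sub>R u2 y - \<kappa> (V y) *\<^sub>R v3 y - (deriv \<kappa> (V y) * z y) *\<^sub>R v2 y"
      using eq2 unfolding a_def .
    show "w y * a y = 1" "w y > 0" for y using c(1)[of y] by (auto simp: w_def)
    show "((\<lambda>y. n (V y)) has_real_derivative deriv n (V y) * z y) (at y)"
      "((\<lambda>y. \<kappa> (V y)) has_real_derivative deriv \<kappa> (V y) * z y) (at y)" for y
      by (intro comp coeff_der; assumption)+
    show "\<kappa> (V y) > 0" for y by (rule \<kappa>_pos[OF V_pos])
    show "1 / (16 * B^4) / 4 * \<bar>z y\<bar> > 0" for y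
      using slow(3)[of y] B by (intro mult_pos_pos) auto
  qed fact+
qed

end

text \<open>Inserting U' = - s V' turns the momentum equation into a total derivative, whose
  constant is read off at 0. The Lax inequality at \<open>Vm\<close> becomes s^2 > - p'(Vm), which
  makes \<open>Vm\<close> a strict local minimum of the potential P.\<close>

lemma travelling_wave_if_shock_profile:
  assumes smooth: "smooth_on {0<..} p" "smooth_on {0<..} \<mu>" "smooth_on {0<..} \<kappa>"
    and pos: "\<And>v. v > 0 \<Longrightarrow> \<mu> v > 0" "\<And>v. v > 0 \<Longrightarrow> \<kappa> v > 0" "\<And>v. v > 0 \<Longrightarrow> deriv (deriv p) v > 0"
    and neg: "\<And>v. v > 0 \<Longrightarrow> deriv p v < 0"
    and shock: "compressive_1_shock p Vm Um Vp Up s" "Vp < Vm"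
    and profile: "shock_profile p \<mu> \<kappa> Vm Um Vp Up s V U"
  obtains C where "travelling_wave p (\<lambda>v. \<mu> v / v) \<kappa> V s Vm Vp C"
    "deriv U = (\<lambda>y. - s * deriv V y)"
proof -
  let ?n = "\<lambda>v. \<mu> v / v"
  have n: "smooth_on {0<..} ?n"
    using smooth_on_mult[OF _ smooth(2) smooth_on_inverse] by simp
  have V: "smooth_on UNIV V" "\<And>y. V y > 0"
    and lim: "(V \<longlongrightarrow> Vm) at_bot" "(V \<longlongrightarrow> Vp) at_top"
    and ode1: "\<And>y. - s * deriv V y - deriv U y = 0"
    and ode2: "\<And>y. - s * deriv U y + deriv (\<lambda>z. p (V z)) y =
        deriv (\<lambda>z. \<mu> (V z) / V z * deriv U z) y -
        deriv (\<lambda>z. \<kappa> (V z) * deriv (deriv V) z + 1/2 * deriv \<kappa> (V z) * (deriv V z)\<^sup>2) y"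
    using profile unfolding shock_profile_def by auto
  have U: "deriv U = (\<lambda>y. - s * deriv V y)" using ode1 by (auto simp: fun_eq_iff algebra_simps)
  have der: "(V has_real_derivative deriv V y) (at y)" "(deriv V has_real_derivative deriv (deriv V) y) (at y)"
    "(deriv (deriv V) has_real_derivative deriv (deriv (deriv V)) y) (at y)" for y
    using V(1) by (auto intro!: smooth_on_has_derivative[of UNIV] smooth_on_deriv)
  have comp: "((\<lambda>y. f (V y)) has_real_derivative deriv f (V y) * deriv V y) (at y)" if "smooth_on {0<..} f" for f y
    by (rule DERIV_chain2[OF smooth_on_has_derivative[OF that] der(1)]) (simp add: V)
  let ?K = "\<lambda>z. \<kappa> (V z) * deriv (deriv V) z + 1/2 * deriv \<kappa> (V z) * (deriv V z)\<^sup>2"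
  \<comment> \<open>The profile equation speaks of \<open>deriv\<close> of composite expressions,
    which says something about them only once they are known to be differentiable.\<close>
  have "?K differentiable (at y)" "(\<lambda>z. ?n (V z) * deriv V z) differentiable (at y)" for y
    unfolding real_differentiable_def
    by (rule exI, (rule derivative_eq_intros comp smooth smooth_on_deriv n der refl)+)+
  then have K: "(?K has_real_derivative deriv ?K y) (at y)"
    and N: "((\<lambda>z. ?n (V z) * deriv V z) has_real_derivative deriv (\<lambda>z. ?n (V z) * deriv V z) y) (at y)" for y
    by (simp_all add: DERIV_deriv_iff_real_differentiable)
  have NU: "deriv (\<lambda>z. \<mu> (V z) / V z * deriv U z) y = - s * deriv (\<lambda>z. ?n (V z) * deriv V z) y" for y
    by (rule DERIV_imp_deriv) (use DERIV_cmult[OF N, of "- s"] in \<open>simp add: U mult_ac\<close>)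
  have P: "((\<lambda>y. p (V y)) has_real_derivative deriv (\<lambda>z. p (V z)) y) (at y)" for y
    using comp[OF smooth(1), of y] DERIV_imp_deriv by metis
  let ?G = "\<lambda>y. ?K y + s * (?n (V y) * deriv V y) + s\<^sup>2 * V y + p (V y)"
  have "(?G has_real_derivative
      deriv ?K y + s * deriv (\<lambda>z. ?n (V z) * deriv V z) y + s\<^sup>2 * deriv V y + deriv (\<lambda>z. p (V z)) y) (at y)" for y
    by (intro DERIV_add DERIV_cmult K N P der)
  moreover have "deriv ?K y + s * deriv (\<lambda>z. ?n (V z) * deriv V z) y + s\<^sup>2 * deriv V y + deriv (\<lambda>z. p (V z)) y = 0" for y
    using ode2[of y] unfolding NU by (simp add: U power2_eq_square)
  ultimately have "(?G has_real_derivative 0) (at y)" for y by simp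
  then have G: "?G y = ?G 0" for y by (rule DERIV_isconst_all[rule_format]) 
  have s: "s < 0" "- deriv p Vm < s\<^sup>2" and Vpm: "Vp > 0" "Vm > 0"
    and RH: "s * (Vp - Vm) = Um - Up" "s * (Up - Um) = p Vp - p Vm"
  proof -
    show "Vp > 0" "Vm > 0" "s * (Vp - Vm) = Um - Up" "s * (Up - Um) = p Vp - p Vm"
      using shock(1) by (auto simp: compressive_1_shock_def)
    have lt: "s < - sqrt (- deriv p Vm)" and nn: "- deriv p Vm > 0"
      using shock(1) neg[OF \<open>Vm > 0\<close>] by (auto simp: compressive_1_shock_def)
    then show "s < 0" using real_sqrt_ge_zero[of "- deriv p Vm"] by linarith
    have "(sqrt (- deriv p Vm))\<^sup>2 < (- s)\<^sup>2" using lt nn by (intro power_strict_mono) auto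
    then show "- deriv p Vm < s\<^sup>2" using nn by simp
  qed
  have "s\<^sup>2 * (Vm - Vp) = s * - (s * (Vp - Vm))" by (simp add: power2_eq_square algebra_simps)
  also have "\<dots> = p Vp - p Vm" unfolding RH(1) RH(2)[symmetric] by simp
  finally have RH': "s\<^sup>2 * (Vm - Vp) = p Vp - p Vm" .
  have "travelling_wave p ?n \<kappa> V s Vm Vp (?G 0)"
  proof
    show "\<kappa> (V y) * deriv (deriv V) y + 1/2 * deriv \<kappa> (V y) * (deriv V y)\<^sup>2 + s * ?n (V y) * deriv V y
        + s\<^sup>2 * V y + p (V y) = ?G 0" for y
      using G[of y] by (simp only: mult.assoc)
  qed (use smooth n V pos lim shock(2) s Vpm RH' in auto)
  then show ?thesis using U that by blast
qed

theorem proposition2: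
  fixes p \<mu> \<kappa> :: "real \<Rightarrow> real" and Vm :: real
  assumes "smooth_on {0<..} p" and "smooth_on {0<..} \<mu>" and "smooth_on {0<..} \<kappa>"
    and "\<And>v. v > 0 \<Longrightarrow> \<mu> v > 0" and "\<And>v. v > 0 \<Longrightarrow> \<kappa> v > 0"
    and "\<And>v. v > 0 \<Longrightarrow> deriv p v < 0" and "\<And>v. v > 0 \<Longrightarrow> deriv (deriv p) v > 0"
    and "Vm > 0"
    and "- deriv \<kappa> Vm * deriv p Vm + \<kappa> Vm * deriv (deriv p) Vm > 0"
  shows "\<exists>\<epsilon>\<^sub>0>0. \<forall>Um Vp Up s V U.
    compressive_1_shock p Vm Um Vp Up s \<longrightarrow> 0 < Vm - Vp \<longrightarrow> Vm - Vp < \<epsilon>\<^sub>0 \<longrightarrow>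
    shock_profile p \<mu> \<kappa> Vm Um Vp Up s V U \<longrightarrow>
    point_spectrum (integrated_operator p \<mu> \<kappa> s V U) \<subseteq> {z. Re z < 0}"
proof -
  let ?n = "\<lambda>v. \<mu> v / v"
  have n: "smooth_on {0<..} ?n"
    using smooth_on_mult[OF _ assms(2) smooth_on_inverse] by simp
  obtain B d where B: "B \<ge> 1" and d: "d > 0" "\<And>v. \<bar>v - Vm\<bar> < d \<Longrightarrow> admissible p ?n \<kappa> B v"
    using admissible_neighbourhood[OF assms(1) n assms(3) _ assms(5-9)] assms(4) by auto
  \<comment> \<open>It depends only on B and d, hence on \<open>Vm\<close> and the coefficient
    functions. The second entry combines the 288 B^8 of \<open>slow_profile\<close> with \<delta> =
    1 / (50000 B^14).\<close>
  define \<epsilon>\<^sub>0 where "\<epsilon>\<^sub>0 = min d (1 / (288 * B^8 * (50000 * B^14)))"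
  show ?thesis
  proof (intro exI[of _ \<epsilon>\<^sub>0] conjI allI impI subsetI)
    show "\<epsilon>\<^sub>0 > 0" using d B by (simp add: \<epsilon>\<^sub>0_def)
    fix Um Vp Up s V U \<nu>
    assume shock: "compressive_1_shock p Vm Um Vp Up s" and lt: "0 < Vm - Vp" and small: "Vm - Vp < \<epsilon>\<^sub>0"
      and profile: "shock_profile p \<mu> \<kappa> Vm Um Vp Up s V U"
      and \<nu>: "\<nu> \<in> point_spectrum (integrated_operator p \<mu> \<kappa> s V U)"
    obtain C where wave: "travelling_wave p ?n \<kappa> V s Vm Vp C" and U: "deriv U = (\<lambda>y. - s * deriv V y)"
      using travelling_wave_if_shock_profile[OF assms(1-5,7,6) shock _ profile] lt by auto
    interpret travelling_wave p ?n \<kappa> V s Vm Vp C by (rule wave)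
    obtain v u where vu: "(v, u) \<noteq> 0" "((v, u), \<nu> *\<^sub>C (v, u)) \<in> integrated_operator p \<mu> \<kappa> s V U"
      using \<nu> unfolding point_spectrum_def ker_def minus_scalar_def by auto
    then have op: "v \<in> sobolev 3" "u \<in> sobolev 2" "\<nu> *\<^sub>C v = s *\<^sub>R weak_deriv v + weak_deriv u"
      and AE_op: "AE y in lborel. rep_l2 (\<nu> *\<^sub>C u) y =
           s *\<^sub>R rep_l2 (weak_deriv u) y
           + (- deriv p (V y) + (deriv \<mu> (V y) * V y - \<mu> (V y)) / (V y)\<^sup>2 * deriv U y)
               *\<^sub>R rep_l2 (weak_deriv v) y
           + (\<mu> (V y) / V y) *\<^sub>R rep_l2 ((weak_deriv ^^ 2) u) y
           + capillary_term \<kappa> V v y"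
      by (auto simp: integrated_operator_def scaleC_prod_def)
    have three: "(3::nat) = Suc (Suc (Suc 0))" "(2::nat) = Suc (Suc 0)" by simp_all
    have v: "weakly_differentiable (rep_l2 v) (rep_l2 (weak_deriv v))"
      "weakly_differentiable (rep_l2 (weak_deriv v)) (rep_l2 ((weak_deriv ^^ 2) v))"
      "weakly_differentiable (rep_l2 ((weak_deriv ^^ 2) v)) (rep_l2 ((weak_deriv ^^ 3) v))"
      and u: "weakly_differentiable (rep_l2 u) (rep_l2 (weak_deriv u))"
      "weakly_differentiable (rep_l2 (weak_deriv u)) (rep_l2 ((weak_deriv ^^ 2) u))"
    proof -
      note v1 = sobolev_SucD[OF op(1)[unfolded three]]
      note v2 = sobolev_SucD[OF v1(2)]
      note v3 = sobolev_SucD[OF v2(2)]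
      note u1 = sobolev_SucD[OF op(2)[unfolded three]]
      note u2 = sobolev_SucD[OF u1(2)]
      have pow: "(weak_deriv ^^ 2) f = weak_deriv (weak_deriv f)"
        "(weak_deriv ^^ 3) f = weak_deriv (weak_deriv (weak_deriv f))" for f
        unfolding three by simp_all
      show "weakly_differentiable (rep_l2 v) (rep_l2 (weak_deriv v))"
        "weakly_differentiable (rep_l2 (weak_deriv v)) (rep_l2 ((weak_deriv ^^ 2) v))"
        "weakly_differentiable (rep_l2 ((weak_deriv ^^ 2) v)) (rep_l2 ((weak_deriv ^^ 3) v))"
        "weakly_differentiable (rep_l2 u) (rep_l2 (weak_deriv u))"
        "weakly_differentiable (rep_l2 (weak_deriv u)) (rep_l2 ((weak_deriv ^^ 2) u))"
        unfolding pow by (rule v1(1) v2(1) v3(1) u1(1) u2(1))+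
    qed
    \<comment> \<open>With U' = - s V' the viscous coefficient of v' in the operator is - s
      (\<mu>(V) / V)' V', the form in which the weight expects it.\<close>
    have dn: "deriv ?n (V y) = (deriv \<mu> (V y) * V y - \<mu> (V y)) / (V y)\<^sup>2" for y
      by (rule DERIV_imp_deriv)
        (use smooth_on_has_derivative[OF assms(2)] V_pos[of y] in
          \<open>auto intro!: derivative_eq_intros simp: power2_eq_square\<close>)
    have eq1: "AE y in lborel. \<nu> * rep_l2 v y = s *\<^sub>R rep_l2 (weak_deriv v) y + rep_l2 (weak_deriv u) y"
      using rep_l2_scaleC[of \<nu> v] rep_l2_add[of "s *\<^sub>R weak_deriv v" "weak_deriv u"] rep_l2_scaleR[of s "weak_deriv v"]
      unfolding op(3) by eventually_elim (simp add: scaleR_conv_of_real)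
    have eq2: "AE y in lborel. \<nu> * rep_l2 u y = s *\<^sub>R rep_l2 (weak_deriv u) y
      + ((- deriv p (V y) - s * deriv ?n (V y) * z y)
          - (deriv \<kappa> (V y) * x y + 1/2 * deriv (deriv \<kappa>) (V y) * (z y)\<^sup>2)) *\<^sub>R rep_l2 (weak_deriv v) y
      + ?n (V y) *\<^sub>R rep_l2 ((weak_deriv ^^ 2) u) y - \<kappa> (V y) *\<^sub>R rep_l2 ((weak_deriv ^^ 3) v) y
      - (deriv \<kappa> (V y) * z y) *\<^sub>R rep_l2 ((weak_deriv ^^ 2) v) y"
      using rep_l2_scaleC[of \<nu> u] AE_op unfolding dn[symmetric]
      by eventually_elim (simp add: U capillary_term_def algebra_simps)
    show "\<nu> \<in> {z. Re z < 0}"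
    proof (rule ccontr)
      assume "\<nu> \<notin> {z. Re z < 0}"
      then have Re: "Re \<nu> \<ge> 0" by simp
      have adm: "admissible p ?n \<kappa> B v" if "\<bar>v - Vm\<bar> \<le> Vm - Vp" for v
        using that small by (intro d) (simp add: \<epsilon>\<^sub>0_def)
      have "Vm - Vp \<le> 1 / (288 * B^8 * (50000 * B^14))" using small by (simp add: \<epsilon>\<^sub>0_def)
      then have "288 * B^8 * (50000 * B^14 * (Vm - Vp)) \<le> 1" using B by (simp add: field_simps)
      from no_unstable_eigenfunction[OF B adm this v u eq1 eq2 Re]
      have zero: "AE y in lborel. rep_l2 v y = 0" "AE y in lborel. rep_l2 u y = 0" by auto
      have "v = 0" "u = 0"
        using zero rep_l2_zero by (auto simp: l2_eq_iff elim: eventually_elim2)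
      then show False using vu(1) by (simp add: zero_prod_def)
    qed
  qed
qed

end
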